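(* Let $\varphi[a_1,a_2,a_3,a_4](z)\in M_2(\Gamma_0(24),\chi_{12})$ be any of the 8 theta products with $(a_1,a_2,a_3,a_4)$ in the table below. Then $$\begin{aligned}\varphi[a_1,a_2,a_3,a_4](z)={}&b_1E_{12,1}(z)+b_2E_{12,1}(2z)+b_3E_{1,12}(z)+b_4E_{1,12}(2z)\\&+b_5E_{-4,-3}(z)+b_6E_{-4,-3}(2z)+b_7E_{-3,-4}(z)+b_8E_{-3,-4}(2z),\end{aligned}$$ where the coefficients are given by the corresponding row: $$\begin{array}{c|cccccccc} (a_1,a_2,a_3,a_4)&b_1&b_2&b_3&b_4&b_5&b_6&b_7&b_8\\ \hline (1,1,1,3)&-1&0&6&0&3&0&-2&0\\ (1,1,2,6)&0&-1&3&0&0&3&1&0\\ (1,2,2,3)&0&-1&3&0&0&-3&-1&0\\ (1,3,3,3)&-1&0&2&0&-1&0&2&0\\ (1,3,6,6)&0&-1&1&0&0&1&1&0\\ (2,2,2,6)&0&-1&0&6&0&3&0&-2\\ (2,3,3,6)&0&-1&1&0&0&-1&-1&0\\ (2,6,6,6)&0&-1&0&2&0&-1&0&2 \end{array}$$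
   Context: Here $z\in\mathbb{H}$ (upper half plane) and $q=e^{2\pi i z}$. For $t\in\{-4,-3,1,12\}$, $\chi_t(m)=\left(\frac{t}{m}\right)$ (Kronecker symbol); $\chi_1$ is trivial. $M_2(\Gamma_0(24),\chi_{12})$ is the space of weight 2 modular forms for $\Gamma_0(24)$ with multiplier system $\chi_{12}$. Ramanujan's theta function is $\varphi(z)=\sum_{n=-\infty}^{\infty}q^{n^2}$, and $\varphi[a_1,a_2,a_3,a_4](z)=\varphi(a_1z)\varphi(a_2z)\varphi(a_3z)\varphi(a_4z)$. For Dirichlet characters $\chi,\psi$ and $n\in\mathbb{N}$, $\sigma_{(\chi,\psi)}(n)=\sum_{1\le m\mid n}\chi(m)\psi(n/m)\,m$. Define $$E_{t_1,t_2}(z)=C_{t_1,t_2}+\sum_{n=1}^\infty\sigma_{(\chi_{t_1},\chi_{t_2})}(n)q^n,$$ with $C_{12,1}=-1$ and $C_{1,12}=C_{-3,-4}=C_{-4,-3}=0$. *)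

theory Defs
  imports "HOL-Complex_Analysis.Complex_Analysis" "HOL-Number_Theory.Number_Theory"
begin

text \<open>The Kronecker symbol $(t/m)$ for integers $t$ and natural numbers $m$. It extends the
  Legendre symbol multiplicatively in $m$; the only values not covered by \<^const>\<open>Legendre\<close> are
  those at the prime 2 and at $m = 0$.\<close>

definition kronecker_prime :: "int \<Rightarrow> nat \<Rightarrow> int" where
  "kronecker_prime t p =
     (if p = 2 then (if even t then 0 else if t mod 8 \<in> {1, 7} then 1 else -1)
      else Legendre t (int p))"

definition kronecker :: "int \<Rightarrow> nat \<Rightarrow> int" where
  "kronecker t m =
     (if m = 0 then (if \<bar>t\<bar> = 1 then 1 else 0)
      else (\<Prod>p\<in>prime_factors m. kronecker_prime t p ^ multiplicity p m))"

definition chi :: "int \<Rightarrow> nat \<Rightarrow> complex" where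
  "chi t m = of_int (kronecker t m)"

definition sigma_chars :: "(nat \<Rightarrow> complex) \<Rightarrow> (nat \<Rightarrow> complex) \<Rightarrow> nat \<Rightarrow> complex" where
  "sigma_chars f g n = (\<Sum>m | m dvd n. f m * g (n div m) * of_nat m)"

definition nome :: "complex \<Rightarrow> complex" where
  "nome z = exp (2 * of_real pi * \<i> * z)"

definition phi :: "complex \<Rightarrow> complex" where
  "phi z = (\<Sum>\<^sub>\<infinity>n\<in>(UNIV :: int set). nome z powi (n ^ 2))"

definition phi_prod :: "nat \<Rightarrow> nat \<Rightarrow> nat \<Rightarrow> nat \<Rightarrow> complex \<Rightarrow> complex" where
  "phi_prod a1 a2 a3 a4 z =
     phi (of_nat a1 * z) * phi (of_nat a2 * z) * phi (of_nat a3 * z) * phi (of_nat a4 * z)"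

text \<open>Only the constant terms for the index pairs $(12,1)$, $(1,12)$, $(-3,-4)$ and $(-4,-3)$
  are meaningful; the value 0 at all other pairs is a dummy.\<close>

definition eis_const :: "int \<Rightarrow> int \<Rightarrow> complex" where
  "eis_const t1 t2 = (if (t1, t2) = (12, 1) then -1 else 0)"

definition eis :: "int \<Rightarrow> int \<Rightarrow> complex \<Rightarrow> complex" where
  "eis t1 t2 z =
     eis_const t1 t2 + (\<Sum>n. sigma_chars (chi t1) (chi t2) (Suc n) * nome z ^ Suc n)"

end

theory Submission
  imports Defs
begin

text \<open>
  Write \<open>q = exp (2 \<pi> i z)\<close>, \<open>X = \<phi>(q)\<^sup>2\<close>, \<open>Y = \<phi>(q\<^sup>3)\<^sup>2\<close>, \<open>Z = \<phi>(q) \<phi>(q\<^sup>3)\<close> and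
  \<open>U = X - Y\<close>, \<open>V = X + Y\<close>, \<open>W = 3 Y - X\<close>, \<open>T = X + 3 Y\<close>. These four linear forms have no zeros in
  the upper half plane: they are eta quotients, and so are the four Eisenstein series at \<open>z\<close>.
  Comparing exponents gives
  \<open>32 Z E(1,12) = U V T\<close>, \<open>32 Z E(-3,-4) = U W T\<close>, \<open>16 Z E(-4,-3) = U V W\<close> and
  \<open>16 Z E(12,1) = - V W T\<close> (lemma \<open>eisq_products\<close>). As \<open>Z\<^sup>2 = X Y\<close>, the rows (1,1,1,3) and (1,3,3,3)
  are then polynomial identities in \<open>X\<close> and \<open>Y\<close> (\<open>rows_level_12\<close>), and the rows (2,2,2,6) and
  (2,6,6,6) are the same identities at \<open>2 z\<close>.

  The remaining rows mix \<open>q\<close> and \<open>q\<^sup>2\<close>. The differences of the values of \<open>X\<close>, \<open>Y\<close> and \<open>Z\<close> at \<open>q\<close>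
  and at \<open>- q\<close> are again eta quotients; they are proportional to one another, with factors that
  involve only \<open>U\<close>, \<open>T\<close> and \<open>Z\<close> at \<open>q\<^sup>2\<close> (\<open>level_24_relations\<close>). The corresponding sums of \<open>X\<close> and
  \<open>Y\<close> are \<open>2 \<phi>(q\<^sup>2)\<^sup>2\<close> and \<open>2 \<phi>(q\<^sup>6)\<^sup>2\<close>. With these facts the four rows are polynomial identities
  as well (\<open>rows_level_24\<close>).

  The factorisations come from elliptic functions in the nome, without the theory of modular
  forms. By the Jacobi triple product the theta series is an infinite product, and theta values at
  torsion points are eta quotients. Kronecker's series \<open>F(a,b) = \<Sum> a\<^sup>n / (1 - b q\<^sup>n)\<close> is a quotient
  of theta values (\<open>kronecker_product\<close>); since \<open>\<phi>(q)\<^sup>2\<close> is a value of \<open>F\<close>, this yields \<open>U\<close> and \<open>V\<close>. The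
  product of \<open>F(a,b)\<close> with \<open>F(q/a,b)\<close>, expanded in powers of \<open>a\<close>, shows that a difference of two
  values of the Weierstrass function is a product of theta values (\<open>wp_diff\<close>). Every Eisenstein series
  here is such a difference at torsion points, hence an eta quotient. Finally \<open>W\<close> and \<open>T\<close> need
  additive relations between eta quotients, and these are instances of
  \<open>(wp a - wp c) - (wp b - wp c) = wp a - wp b\<close>.
\<close>

section \<open>Infinite products and the theta function\<close>

text \<open>The q-Pochhammer symbol \<open>(w; q)\<^sub>\<infinity>\<close>.\<close>
definition qpoch :: "complex \<Rightarrow> complex \<Rightarrow> complex" where
  "qpoch w q = (\<Prod>k. 1 - w * q ^ k)"

lemma qpoch_convergent:
  fixes w q :: complex
  assumes "norm q < 1"
  shows "convergent_prod (\<lambda>k. 1 - w * q ^ k)"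
proof -
  have "summable (\<lambda>k. norm w * norm q ^ k)"
    using assms by (intro summable_mult summable_geometric) auto
  also have "(\<lambda>k. norm w * norm q ^ k) = (\<lambda>k. norm ((1 - w * q ^ k) - 1))"
    by (simp add: norm_mult norm_power)
  finally have "abs_convergent_prod (\<lambda>k. 1 - w * q ^ k)"
    by (rule summable_imp_abs_convergent_prod)
  thus ?thesis
    by (rule abs_convergent_prod_imp_convergent_prod)
qed

lemma qpoch_LIMSEQ:
  assumes "norm q < 1"
  shows "(\<lambda>n. \<Prod>k<n. 1 - w * q ^ k) \<longlonglongrightarrow> qpoch w q"
  using convergent_prod_LIMSEQ[OF qpoch_convergent[OF assms, of w]]
  unfolding qpoch_def LIMSEQ_lessThan_iff_atMost .

lemma qpoch_unfold:
  assumes "norm q < 1"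
  shows "qpoch w q = (1 - w) * qpoch (w * q) q"
proof (rule LIMSEQ_unique)
  show "(\<lambda>n. \<Prod>k<Suc n. 1 - w * q ^ k) \<longlonglongrightarrow> qpoch w q"
    using qpoch_LIMSEQ[OF assms, of w] by (rule LIMSEQ_Suc)
  have "(\<lambda>n. (1 - w) * (\<Prod>k<n. 1 - w * q * q ^ k)) \<longlonglongrightarrow> (1 - w) * qpoch (w * q) q"
    by (intro tendsto_mult qpoch_LIMSEQ assms tendsto_const)
  thus "(\<lambda>n. \<Prod>k<Suc n. 1 - w * q ^ k) \<longlonglongrightarrow> (1 - w) * qpoch (w * q) q"
    by (simp add: prod.lessThan_Suc_shift mult_ac del: prod.lessThan_Suc)
qed

lemma qpoch_nonzero:
  assumes "norm q < 1" "\<And>k. w * q ^ k \<noteq> 1"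
  shows "qpoch w q \<noteq> 0"
  unfolding qpoch_def using assms(2)
  by (intro prodinf_nonzero qpoch_convergent assms) (metis eq_iff_diff_eq_0)

lemma qpoch_nonzero':
  assumes "norm q < 1" "norm w < 1"
  shows "qpoch w q \<noteq> 0"
proof (rule qpoch_nonzero[OF assms(1)])
  fix k
  have "norm (w * q ^ k) \<le> norm w * 1"
    unfolding norm_mult norm_power using assms by (intro mult_left_mono power_le_one) auto
  thus "w * q ^ k \<noteq> 1" using assms(2) by auto
qed

lemma qpoch_0 [simp]: "norm q < 1 \<Longrightarrow> qpoch 1 q = 0"
  using qpoch_unfold[of q 1] by simp

lemma norm_power_less_1:
  fixes q :: complex assumes "norm q < 1" "N > 0" shows "norm (q ^ N) < 1"
  using assms by (simp add: norm_power power_less_one_iff)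

lemma prod_lessThan_add:
  fixes f :: "nat \<Rightarrow> 'a :: comm_monoid_mult"
  shows "(\<Prod>k<m+n. f k) = (\<Prod>k<m. f k) * (\<Prod>j<n. f (m + j))"
  by (induction n) (simp_all add: mult.assoc)

text \<open>Sorting the exponents by their residue modulo \<open>N\<close>. This and the next two identities, which come from
  factoring \<open>1 - x\<^sup>2\<close> and \<open>1 - x\<^sup>3\<close>, serve to turn theta values into eta quotients.\<close>
lemma qpoch_dissect:
  assumes "norm q < 1" "N > 0"
  shows "qpoch w q = (\<Prod>j<N. qpoch (w * q ^ j) (q ^ N))"
proof (rule LIMSEQ_unique)
  have "strict_mono (\<lambda>n::nat. N * n)"
    using assms(2) by (auto simp: strict_mono_def)
  from LIMSEQ_subseq_LIMSEQ[OF qpoch_LIMSEQ[OF assms(1), of w] this]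
  show "(\<lambda>n. \<Prod>k<N*n. 1 - w * q ^ k) \<longlonglongrightarrow> qpoch w q" by (simp add: o_def)
  have *: "(\<Prod>k<N*n. 1 - w * q ^ k) = (\<Prod>j<N. \<Prod>k<n. 1 - w * q ^ j * (q ^ N) ^ k)" for n
  proof (induction n)
    case (Suc n)
    have "(\<Prod>k<N * Suc n. 1 - w * q ^ k) = (\<Prod>k<N*n + N. 1 - w * q ^ k)"
      by (simp add: add.commute)
    also have "\<dots> = (\<Prod>k<N*n. 1 - w * q ^ k) * (\<Prod>j<N. 1 - w * q ^ (N * n + j))"
      by (rule prod_lessThan_add)
    also have "\<dots> = (\<Prod>j<N. \<Prod>k<Suc n. 1 - w * q ^ j * (q ^ N) ^ k)"
      unfolding Suc.IH by (simp add: prod.distrib power_add power_mult mult_ac)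
    finally show ?case .
  qed simp
  have "(\<lambda>n. \<Prod>j<N. \<Prod>k<n. 1 - w * q ^ j * (q ^ N) ^ k) \<longlonglongrightarrow> (\<Prod>j<N. qpoch (w * q ^ j) (q ^ N))"
    by (intro tendsto_prod qpoch_LIMSEQ norm_power_less_1 assms)
  thus "(\<lambda>n. \<Prod>k<N*n. 1 - w * q ^ k) \<longlonglongrightarrow> (\<Prod>j<N. qpoch (w * q ^ j) (q ^ N))"
    unfolding * .
qed

lemma qpoch_minus:
  assumes "norm q < 1"
  shows "qpoch w q * qpoch (-w) q = qpoch (w^2) (q^2)"
  unfolding qpoch_def
  by (subst prodinf_mult[OF qpoch_convergent[OF assms] qpoch_convergent[OF assms]])
     (auto intro!: prodinf_cong simp: algebra_simps power2_eq_square power_mult_distrib)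

lemma cube_root_of_unity:
  fixes w :: complex
  assumes "w^2 + w + 1 = 0"
  shows "w ^ 3 = 1" "w \<noteq> 0" "norm w = 1" "w - w^2 \<noteq> 0"
proof -
  have "w ^ 3 = 1 + (w - 1) * (w ^ 2 + w + 1)"
    by (simp add: eval_nat_numeral algebra_simps)
  thus w3: "w ^ 3 = 1" by (simp add: assms)
  thus "w \<noteq> 0" by auto
  show "norm w = 1" using power_eq_1_iff[OF w3] by simp
  have "w \<noteq> 1" using assms by auto
  thus "w - w^2 \<noteq> 0" using \<open>w \<noteq> 0\<close> by (simp add: power2_eq_square)
qed

lemma qpoch_cube_roots:
  assumes "norm q < 1" and c: "c ^ 2 + c + 1 = 0"
  shows "qpoch w q * qpoch (c * w) q * qpoch (c^2 * w) q = qpoch (w^3) (q^3)"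
proof -
  have "c ^ 3 = 1" by (rule cube_root_of_unity[OF c])
  moreover have "(1 - x) * (1 - c * x) * (1 - c^2 * x) =
      1 - (c ^ 2 + c + 1) * x + c * (c ^ 2 + c + 1) * x ^ 2 - c ^ 3 * x ^ 3" for x
    by (simp add: eval_nat_numeral algebra_simps)
  ultimately have "(1 - x) * (1 - c * x) * (1 - c^2 * x) = 1 - x ^ 3" for x
    by (simp add: c)
  hence eq: "(1 - w * q ^ k) * (1 - c * w * q ^ k) * (1 - c^2 * w * q ^ k) = 1 - w ^ 3 * (q ^ 3) ^ k" for k
    by (simp only: mult.assoc power_mult_distrib power_commutes flip: power_mult)
       (simp add: mult.commute)
  show ?thesis
    unfolding qpoch_def
    by (simp only: eq prodinf_mult qpoch_convergent convergent_prod_mult assms)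
qed

text \<open>Continuity in \<open>w\<close> is used for two limits: \<open>a \<rightarrow> 1\<close>, which finds the constant in Kronecker's identity, and
  the passage from the open annulus to the unit circle in the formula for differences of Weierstrass values.\<close>
lemma isCont_qpoch [continuous_intros]:
  assumes q: "norm q < 1"
  shows "isCont (\<lambda>w. qpoch w q) w"
proof -
  define A where "A = cball (0::complex) (norm w + 1)"
  have "uniformly_convergent_on A (\<lambda>N w. \<Prod>n<N. 1 - w * q ^ n)"
  proof (rule uniformly_convergent_on_prod')
    show "uniformly_convergent_on A (\<lambda>N x. \<Sum>n<N. norm (1 - x * q ^ n - 1))"
      unfolding uniformly_convergent_on_def
    proof (rule exI, rule Weierstrass_m_test_ev)
      show "\<forall>\<^sub>F n in sequentially. \<forall>x\<in>A. norm (norm (1 - x * q ^ n - 1)) \<le> (norm w + 1) * norm q ^ n"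
        by (intro always_eventually) (auto simp: A_def norm_mult norm_power intro!: mult_right_mono)
      show "summable (\<lambda>n. (norm w + 1) * norm q ^ n)"
        using q by (intro summable_mult summable_geometric) auto
    qed
  qed (auto simp: A_def intro!: continuous_intros)
  then obtain l where l: "uniform_limit A (\<lambda>N w. \<Prod>n<N. 1 - w * q ^ n) l sequentially"
    by (auto simp: uniformly_convergent_on_def)
  have "continuous_on A l"
    by (rule uniform_limit_theorem[OF _ l]) (auto intro!: always_eventually continuous_intros)
  moreover have "l x = qpoch x q" if "x \<in> A" for x
    using tendsto_uniform_limitI[OF l that] qpoch_LIMSEQ[OF q, of x] LIMSEQ_unique by blast
  ultimately have "continuous_on A (\<lambda>w. qpoch w q)"
    by (metis (no_types, lifting) continuous_on_cong)
  hence "continuous_on (ball 0 (norm w + 1)) (\<lambda>w. qpoch w q)"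
    by (rule continuous_on_subset) (auto simp: A_def)
  thus ?thesis
    by (subst (asm) continuous_on_eq_continuous_at) (auto dest!: bspec[of _ _ w])
qed

text \<open>The theta function in multiplicative form, with a simple zero at every integral power of \<open>q\<close>.\<close>
definition theta :: "complex \<Rightarrow> complex \<Rightarrow> complex" where
  "theta w q = qpoch w q * qpoch (q / w) q * qpoch q q"

lemma theta_reflect: "w \<noteq> 0 \<Longrightarrow> q \<noteq> 0 \<Longrightarrow> theta (q / w) q = theta w q"
  by (simp add: theta_def)

lemma theta_inverse:
  assumes "norm q < 1" "w \<noteq> 0"
  shows "theta (1 / w) q = - theta w q / w"
proof -
  have eq: "qpoch (1/w) q = (1 - 1/w) * qpoch (q/w) q" "qpoch w q = (1 - w) * qpoch (q * w) q"
    using qpoch_unfold[OF assms(1), of "1/w"] qpoch_unfold[OF assms(1), of w]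
    by (simp_all add: mult.commute)
  have "theta (1 / w) q = (1 - 1/w) * qpoch (q/w) q * qpoch (q * w) q * qpoch q q"
    unfolding theta_def eq(1) by simp
  also have "\<dots> = - theta w q / w"
    unfolding theta_def eq(2) using assms(2) by (simp add: field_simps)
  finally show ?thesis .
qed

lemma theta_nonzero:
  assumes "norm q < 1" "w \<noteq> 0" "q \<noteq> 0" "\<And>k::int. w \<noteq> q powi k"
  shows "theta w q \<noteq> 0"
proof -
  have 1: "w * q ^ k \<noteq> 1" for k
    using assms(4)[of "- int k"] assms by (auto simp: power_int_minus field_simps)
  have 2: "q / w * q ^ k \<noteq> 1" for k
    using assms(4)[of "int (Suc k)"] assms(2)
    by (auto simp del: of_nat_Suc simp: power_int_def nat_add_distrib field_simps)
  show ?thesis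
    unfolding theta_def using qpoch_nonzero[OF assms(1) 1] qpoch_nonzero[OF assms(1) 2]
      qpoch_nonzero'[OF assms(1,1)] by simp
qed

lemma isCont_theta:
  assumes "norm q < 1" "w \<noteq> 0"
  shows "isCont (\<lambda>w. theta w q) w"
  unfolding theta_def
  by (intro continuous_mult isCont_qpoch assms isCont_o2[OF _ isCont_qpoch[OF assms(1)], of _ "\<lambda>w. q / w"])
     (use assms(2) in \<open>auto intro!: continuous_intros\<close>)

section \<open>Sums over the integers\<close>

lemma abs_summable_on_int:
  fixes f :: "int \<Rightarrow> 'a :: real_normed_vector"
  assumes "summable (\<lambda>n. norm (f (int n)))" "summable (\<lambda>n. norm (f (- int n)))"
  shows "(\<lambda>j. norm (f j)) summable_on UNIV"
proof -
  have "(\<lambda>x. norm (f x)) summable_on range int"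
    by (subst summable_on_reindex)
       (use assms(1) in \<open>auto simp: o_def intro!: norm_summable_imp_summable_on\<close>)
  moreover have "(\<lambda>x. norm (f x)) summable_on range (\<lambda>n. - int n)"
    by (subst summable_on_reindex)
       (use assms(2) in \<open>auto simp: o_def inj_def intro!: norm_summable_imp_summable_on\<close>)
  ultimately have "(\<lambda>x. norm (f x)) summable_on (range int \<union> range (\<lambda>n. - int n))"
    by (rule summable_on_union)
  also have "range int \<union> range (\<lambda>n. - int n) = UNIV"
    by (auto simp: image_def) (metis nat_eq_iff2 int_cases2)
  finally show ?thesis .
qed

lemma infsum_int_eq_suminf:
  fixes f :: "int \<Rightarrow> complex"
  assumes "(\<lambda>j. norm (f j)) summable_on UNIV"
  shows "infsum f UNIV = (\<Sum>k. f (int_decode k))" "summable (\<lambda>k. norm (f (int_decode k)))"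
proof -
  have *: "(\<lambda>k. norm (f (int_decode k))) summable_on UNIV"
    using assms by (subst summable_on_reindex_bij_betw[OF bij_int_decode])
  thus "summable (\<lambda>k. norm (f (int_decode k)))"
    by (rule summable_on_imp_summable)
  have "(\<lambda>k. f (int_decode k)) summable_on UNIV"
    using * by (rule abs_summable_summable)
  hence "((\<lambda>k. f (int_decode k)) has_sum (\<Sum>\<^sub>\<infinity>k. f (int_decode k))) UNIV"
    by simp
  hence "(\<Sum>k. f (int_decode k)) = (\<Sum>\<^sub>\<infinity>k. f (int_decode k))"
    using has_sum_imp_sums sums_unique by metis
  thus "infsum f UNIV = (\<Sum>k. f (int_decode k))"
    using infsum_reindex_bij_betw[OF bij_int_decode, of f] by simp
qed

text \<open>Tannery's theorem, transported from the naturals along a bijection.\<close>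
lemma tendsto_infsum_dominated:
  fixes f :: "nat \<Rightarrow> int \<Rightarrow> complex"
  assumes lim: "\<And>j. (\<lambda>N. f N j) \<longlonglongrightarrow> g j"
    and bound: "\<And>N j. norm (f N j) \<le> h j" and h: "h summable_on UNIV"
  shows "(\<lambda>N. infsum (f N) UNIV) \<longlonglongrightarrow> infsum g UNIV"
proof -
  have h0: "h j \<ge> 0" for j using bound[of 0 j] norm_ge_zero order_trans by blast
  have f: "(\<lambda>j. norm (f N j)) summable_on UNIV" for N
    by (rule Infinite_Sum.abs_summable_on_comparison_test'[OF h]) (use bound in auto)
  have "norm (g j) \<le> h j" for j
    by (rule LIMSEQ_le_const2[OF tendsto_norm[OF lim]]) (use bound in auto)
  hence g: "(\<lambda>j. norm (g j)) summable_on UNIV"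
    by (intro Infinite_Sum.abs_summable_on_comparison_test'[OF h]) auto
  have "(\<lambda>k. h (int_decode k)) summable_on UNIV"
    using h by (subst summable_on_reindex_bij_betw[OF bij_int_decode])
  hence "summable (\<lambda>k. h (int_decode k))"
    by (rule summable_on_imp_summable)
  hence "(\<lambda>N. \<Sum>k. f N (int_decode k)) \<longlonglongrightarrow> (\<Sum>k. g (int_decode k))"
    by (intro conjunct2[OF conjunct2[OF tannerys_theorem]])
       (use lim bound in \<open>auto simp: case_prod_beta intro: always_eventually\<close>)
  thus ?thesis
    by (simp add: infsum_int_eq_suminf f g)
qed

section \<open>The Jacobi triple product\<close>

text \<open>The exponent of \<open>q\<close> in the theta series. The index runs through all integers, and the value is
  nonnegative at the negative ones too.\<close>
definition tri :: "int \<Rightarrow> int" where "tri n = n * (n - 1) div 2"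

lemma two_tri: "2 * tri n = n * (n - 1)"
  unfolding tri_def by simp

lemma tri_add: "tri (m + n) = tri m + tri n + m * n"
  using two_tri[of "m + n"] two_tri[of m] two_tri[of n] by (simp add: algebra_simps)

lemma tri_simps [simp]: "tri 0 = 0" "tri 1 = 0"
  by (simp_all add: tri_def)

lemma tri_plus_1: "tri (n + 1) = tri n + n"
  by (simp add: tri_add)

lemma tri_nonneg: "tri n \<ge> 0"
proof -
  have "n * (n - 1) \<ge> 0"
    by (cases "n \<ge> 1") (auto intro: mult_nonneg_nonneg mult_nonpos_nonpos)
  thus ?thesis using two_tri[of n] by linarith
qed

lemma tri_uminus: "tri (- n) = tri n + n"
  using two_tri[of "-n"] two_tri[of n] by (simp add: algebra_simps)

abbreviation theta_term :: "complex \<Rightarrow> complex \<Rightarrow> int \<Rightarrow> complex" where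
  "theta_term w q n \<equiv> (-w) powi n * q powi (tri n)"

lemma summable_power_tri:
  fixes r t :: real
  assumes "0 \<le> t" "t < 1" "r \<ge> 0"
  shows "summable (\<lambda>n. r ^ n * t ^ nat (tri (int n)))"
proof -
  have "(\<lambda>n. r * t ^ n) \<longlonglongrightarrow> r * 0"
    using assms by (intro tendsto_mult tendsto_const LIMSEQ_power_zero) auto
  hence "eventually (\<lambda>n. r * t ^ n < 1/2) sequentially"
    by (rule order_tendstoD) auto
  then obtain N where N: "\<And>n. n \<ge> N \<Longrightarrow> r * t ^ n < 1/2"
    by (auto simp: eventually_at_top_linorder)
  show ?thesis
  proof (rule summable_ratio_test[of "1/2" N])
    fix n assume n: "n \<ge> N"
    have "nat (tri (int (Suc n))) = nat (tri (int n)) + n"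
      using tri_plus_1[of "int n"] tri_nonneg[of "int n"] by (simp add: nat_add_distrib add.commute)
    hence "r ^ Suc n * t ^ nat (tri (int (Suc n))) = (r * t ^ n) * (r ^ n * t ^ nat (tri (int n)))"
      by (simp add: power_add mult_ac del: of_nat_Suc)
    also have "\<dots> \<le> 1/2 * (r ^ n * t ^ nat (tri (int n)))"
      using N[OF n] assms by (intro mult_right_mono) auto
    finally show "norm (r ^ Suc n * t ^ nat (tri (int (Suc n)))) \<le> 1/2 * norm (r ^ n * t ^ nat (tri (int n)))"
      using assms by simp
  qed auto
qed

lemma theta_term_abs_summable:
  assumes "norm q < 1" "w \<noteq> 0" "q \<noteq> 0"
  shows "(\<lambda>n. norm (theta_term w q n)) summable_on UNIV"
proof (rule abs_summable_on_int)
  have "norm (theta_term w q (int n)) = norm w ^ n * norm q ^ nat (tri (int n))" for n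
    using tri_nonneg[of "int n"] by (simp add: norm_mult norm_power norm_power_int power_int_def)
  thus "summable (\<lambda>n. norm (theta_term w q (int n)))"
    using summable_power_tri[of "norm q" "norm w"] assms by simp
  have "norm (theta_term w q (- int n)) = (norm q / norm w) ^ n * norm q ^ nat (tri (int n))" for n
  proof -
    have "nat (tri (- int n)) = nat (tri (int n)) + n"
      using tri_uminus[of "int n"] tri_nonneg[of "int n"] by (simp add: nat_add_distrib)
    moreover have "norm (theta_term w q (- int n)) = inverse (norm w ^ n) * norm q ^ nat (tri (- int n))"
      using tri_nonneg[of "- int n"]
      by (simp add: norm_mult norm_power norm_power_int power_int_def norm_inverse power_inverse)
    ultimately show ?thesis
      by (simp add: power_add field_simps)
  qed
  thus "summable (\<lambda>n. norm (theta_term w q (- int n)))"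
    using summable_power_tri[of "norm q" "norm q / norm w"] assms by simp
qed

definition qfac :: "complex \<Rightarrow> nat \<Rightarrow> complex" where
  "qfac q n = (\<Prod>k<n. 1 - q * q ^ k)"

definition qbinom :: "complex \<Rightarrow> nat \<Rightarrow> nat \<Rightarrow> complex" where
  "qbinom q n k = (if k \<le> n then qfac q n / (qfac q k * qfac q (n - k)) else 0)"

lemma qfac_nonzero: "norm q < 1 \<Longrightarrow> qfac q n \<noteq> 0"
proof -
  assume q: "norm q < 1"
  have "q * q ^ k \<noteq> 1" for k
    using norm_power_less_1[OF q, of "Suc k"] by auto
  thus ?thesis by (auto simp: qfac_def)
qed

lemma qfac_Suc: "qfac q (Suc n) = qfac q n * (1 - q ^ Suc n)"
  by (simp add: qfac_def)

lemma qbinom_pascal: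
  assumes q: "norm q < 1"
  shows "qbinom q (Suc n) (Suc k) = qbinom q n (Suc k) + (if k \<le> n then q ^ (n - k) else 0) * qbinom q n k"
proof -
  note nz = qfac_nonzero[OF q]
  consider "k > n" | "k = n" | m where "n = Suc (k + m)"
    using less_iff_Suc_add by (metis linorder_neqE_nat add_Suc_right)
  thus ?thesis
  proof cases
    case (3 m)
    have 1: "1 - q ^ Suc k \<noteq> 0" "1 - q ^ Suc m \<noteq> 0"
      using norm_power_less_1[OF q, of "Suc k"] norm_power_less_1[OF q, of "Suc m"] by auto
    have "q ^ Suc n = q ^ Suc k * q ^ Suc m" using 3 by (simp add: power_add)
    hence "qbinom q (Suc n) (Suc k) = qfac q n * (1 - q ^ Suc k * q ^ Suc m) /
        (qfac q k * (1 - q ^ Suc k) * (qfac q m * (1 - q ^ Suc m)))"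
      unfolding qbinom_def qfac_Suc[of q n] qfac_Suc[of q k] using 3 by (simp add: qfac_Suc)
    moreover have "qbinom q n (Suc k) = qfac q n / (qfac q k * (1 - q ^ Suc k) * qfac q m)"
      unfolding qbinom_def qfac_Suc[of q k] using 3 by simp
    moreover have "qbinom q n k = qfac q n / (qfac q k * (qfac q m * (1 - q ^ Suc m)))"
      unfolding qbinom_def using 3 by (simp add: Suc_diff_le qfac_Suc)
    moreover have "A * (1 - x * y) / (b * (1 - x) * (c * (1 - y))) =
        A / (b * (1 - x) * c) + y * (A / (b * (c * (1 - y))))"
      if "b \<noteq> 0" "c \<noteq> 0" "1 - x \<noteq> 0" "1 - y \<noteq> 0" for A b c x y :: complex
      using that by (simp add: divide_simps) (simp add: algebra_simps)
    moreover have "n - k = Suc m" "k \<le> n" using 3 by simp_all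
    ultimately show ?thesis
      using nz[of k] nz[of m] 1 by simp
  qed (use nz in \<open>auto simp: qbinom_def\<close>)
qed

text \<open>Induction on \<open>n\<close>, with the coefficients compared by the q-analogue of Pascal's rule.\<close>
lemma q_binomial_theorem:
  assumes q: "norm q < 1"
  shows "(\<Prod>k<n. 1 + x * q ^ k) = (\<Sum>k\<le>n. q ^ (k * (k - 1) div 2) * qbinom q n k * x ^ k)"
proof (induction n)
  case 0
  show ?case by (simp add: qbinom_def qfac_def)
next
  case (Suc n)
  let ?a = "\<lambda>n k. q ^ (k * (k - 1) div 2) * qbinom q n k * x ^ k"
  have Sk: "Suc k * (Suc k - 1) div 2 = k * (k - 1) div 2 + k" for k :: nat
  proof -
    have "Suc k * (Suc k - 1) = k * (k - 1) + k * 2" by (cases k) (auto simp: algebra_simps)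
    thus ?thesis by simp
  qed
  have "?a (Suc n) (Suc k) = ?a n (Suc k) + x * q ^ n * ?a n k" if "k \<le> n" for k
  proof -
    have "q ^ n = q ^ (n - k) * q ^ k" using that by (simp flip: power_add)
    thus ?thesis unfolding Sk qbinom_pascal[OF q] using that
      by (simp add: power_add algebra_simps)
  qed
  hence "(\<Sum>k\<le>Suc n. ?a (Suc n) k) = ?a (Suc n) 0 + (\<Sum>k\<le>n. ?a n (Suc k) + x * q ^ n * ?a n k)"
    by (subst sum.atMost_Suc_shift) simp
  also have "\<dots> = (?a n 0 + (\<Sum>k\<le>n. ?a n (Suc k))) + x * q ^ n * (\<Sum>k\<le>n. ?a n k)"
    using qfac_nonzero[OF q] by (simp add: sum.distrib sum_distrib_left qbinom_def[of _ _ 0] qfac_def[of _ 0])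
  also have "?a n 0 + (\<Sum>k\<le>n. ?a n (Suc k)) = (\<Sum>k\<le>Suc n. ?a n k)"
    by (subst sum.atMost_Suc_shift) simp
  also have "\<dots> = (\<Sum>k\<le>n. ?a n k)"
    by (simp add: qbinom_def)
  finally have "(\<Sum>k\<le>Suc n. ?a (Suc n) k) = (\<Sum>k\<le>n. ?a n k) + x * q ^ n * (\<Sum>k\<le>n. ?a n k)" .
  moreover have "s * (1 + x * q ^ n) = s + x * q ^ n * s" for s
    by (simp add: algebra_simps)
  ultimately show ?case
    unfolding prod.lessThan_Suc Suc.IH by (simp only:)
qed

lemma tri_of_nat: "tri (int k) = int (k * (k - 1) div 2)"
proof -
  have "int k * (int k - 1) = int (k * (k - 1))"
    by (cases k) (auto simp: algebra_simps)
  thus ?thesis unfolding tri_def by (simp only: zdiv_int of_nat_numeral)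
qed

text \<open>The q-binomial theorem with \<open>2 n\<close> factors at \<open>x = - w q\<^sup>-\<^sup>n\<close>: half of the factors give
  \<open>1 - w q\<^sup>k\<close>, and the other half give \<open>1 - q\<^sup>k\<^sup>+\<^sup>1 / w\<close> after \<open>- w q\<^sup>-\<^sup>k\<^sup>-\<^sup>1\<close> is taken out of each.\<close>
lemma finite_triple_product:
  assumes q: "norm q < 1" "q \<noteq> 0" and w: "w \<noteq> 0"
  shows "(\<Prod>k<n. 1 - w * q ^ k) * (\<Prod>k<n. 1 - q / w * q ^ k) =
     (\<Sum>j\<in>{-int n..int n}. theta_term w q j * qbinom q (2*n) (nat (int n + j)))"
proof -
  let ?x = "- w * q powi (- int n)"
  have "(\<Prod>k<n+n. 1 + ?x * q ^ k) = (\<Prod>k<n. 1 + ?x * q ^ k) * (\<Prod>k<n. 1 + ?x * q ^ (n + k))"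
    by (rule prod_lessThan_add)
  also have "(\<Prod>k<n. 1 + ?x * q ^ (n + k)) = (\<Prod>k<n. 1 - w * q ^ k)"
    using q by (intro prod.cong) (auto simp: power_add power_int_minus field_simps)
  also have "(\<Prod>k<n. 1 + ?x * q ^ k) = (\<Prod>k<n. 1 + ?x * q ^ (n - Suc k))"
    by (rule prod.nat_diff_reindex[symmetric])
  also have "\<dots> = (\<Prod>k<n. (- w * q powi (- int (Suc k))) * (1 - q / w * q ^ k))"
  proof (intro prod.cong refl)
    fix k assume "k \<in> {..<n}"
    hence "q ^ n = q ^ (n - Suc k) * q ^ Suc k" by (simp flip: power_add power_Suc)
    thus "1 + ?x * q ^ (n - Suc k) = (- w * q powi (- int (Suc k))) * (1 - q / w * q ^ k)"
      using q w by (simp add: power_int_minus field_simps del: of_nat_Suc)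
  qed
  also have "\<dots> = (\<Prod>k<n. - w * q powi (- int (Suc k))) * (\<Prod>k<n. 1 - q / w * q ^ k)"
    by (rule prod.distrib)
  also have "(\<Prod>k<n. - w * q powi (- int (Suc k))) = (-w) powi (int n) * q powi (- tri (int n + 1))"
  proof (induction n)
    case (Suc n)
    have "tri (int (Suc n) + 1) = tri (int n + 1) + (int n + 1)"
      using tri_plus_1[of "int n + 1"] by (simp add: add.commute)
    hence "- tri (int (Suc n) + 1) = - tri (int n + 1) + (- int (Suc n))" by simp
    hence "q powi (- tri (int (Suc n) + 1)) = q powi (- tri (int n + 1)) * q powi (- int (Suc n))"
      using q by (metis power_int_add)
    moreover have "(-w) powi (int (Suc n)) = (-w) powi (int n) * (-w)"
      by (simp only: power_int_of_nat power_Suc2)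
    ultimately show ?case unfolding prod.lessThan_Suc Suc.IH
      by (simp only: mult_ac)
  qed simp
  finally have eq: "(\<Prod>k<n+n. 1 + ?x * q ^ k) = (-w) powi (int n) * q powi (- tri (int n + 1)) *
      (\<Prod>k<n. 1 - q / w * q ^ k) * (\<Prod>k<n. 1 - w * q ^ k)" .
  have "(-w) powi (- int n) * (-w) powi (int n) = 1"
    "q powi (tri (int n + 1)) * q powi (- tri (int n + 1)) = 1"
    using q w by (auto simp: power_int_minus)
  note inv = this
  have "(\<Prod>k<n. 1 - w * q ^ k) * (\<Prod>k<n. 1 - q / w * q ^ k) =
     (-w) powi (- int n) * q powi (tri (int n + 1)) * (\<Prod>k<2*n. 1 + ?x * q ^ k)"
  proof -
    have "x * y = a * c * (b * d * y * x)" if "a * b = 1" "c * d = 1" for a b c d x y :: complex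
    proof -
      have "a * c * (b * d * y * x) = (a * b) * (c * d) * (x * y)" by (simp only: mult_ac)
      thus ?thesis by (simp only: that mult_1)
    qed
    note this[OF inv]
    thus ?thesis unfolding mult_2 eq .
  qed
  also have "(\<Prod>k<2*n. 1 + ?x * q ^ k) = (\<Sum>k\<le>2*n. q ^ (k * (k - 1) div 2) * qbinom q (2*n) k * ?x ^ k)"
    by (rule q_binomial_theorem) fact
  also have "(-w) powi (- int n) * q powi (tri (int n + 1)) * \<dots> =
    (\<Sum>k\<le>2*n. theta_term w q (int k - int n) * qbinom q (2*n) k)"
    unfolding sum_distrib_left
  proof (intro sum.cong refl)
    fix k
    have t: "tri (int k - int n) = tri (int n + 1) + (tri (int k) + (- int n) * int k)"
      using two_tri[of "int k - int n"] two_tri[of "int k"] two_tri[of "int n + 1"] by (simp add: algebra_simps)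
    have "q powi tri (int k - int n) = q powi (tri (int n + 1)) * (q powi (tri (int k)) * (q powi (- int n)) powi (int k))"
      unfolding t using q by (metis power_int_add power_int_mult)
    moreover have "(-w) powi (int k - int n) = (-w) powi (- int n) * (-w) powi (int k)"
      using w by (metis power_int_add uminus_add_conv_diff neg_equal_0_iff_equal)
    ultimately have "theta_term w q (int k - int n) = (-w) powi (- int n) * q powi (tri (int n + 1)) *
       (q powi (tri (int k)) * ((-w) powi (int k) * (q powi (- int n)) powi (int k)))"
      by (simp only: mult_ac)
    also have "q powi (tri (int k)) * ((-w) powi (int k) * (q powi (- int n)) powi (int k)) =
       q ^ (k * (k - 1) div 2) * ?x ^ k"
      unfolding tri_of_nat by (simp add: power_mult_distrib[symmetric])
    finally show "(-w) powi (- int n) * q powi (tri (int n + 1)) * (q ^ (k * (k - 1) div 2) * qbinom q (2*n) k * ?x ^ k)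
      = theta_term w q (int k - int n) * qbinom q (2*n) k"
      by (simp add: mult_ac)
  qed
  also have "\<dots> = (\<Sum>j\<in>{-int n..int n}. theta_term w q j * qbinom q (2*n) (nat (int n + j)))"
    by (rule sum.reindex_bij_witness[of _ "\<lambda>j. nat (int n + j)" "\<lambda>k. int k - int n"]) auto
  finally show ?thesis .
qed

text \<open>The limit of the finite version. The Gaussian binomials tend to \<open>1 / (q; q)\<^sub>\<infinity>\<close> and are bounded
  uniformly, because the finite products \<open>(q; q)\<^sub>n\<close> and their inverses are bounded; so the limit may be
  taken termwise.\<close>
theorem jacobi_triple_product:
  assumes q: "norm q < 1" "q \<noteq> 0" and w: "w \<noteq> 0"
  shows "theta w q = (\<Sum>\<^sub>\<infinity>n. theta_term w q n)"
proof -
  define E where "E = qpoch q q"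
  have E: "E \<noteq> 0" unfolding E_def by (intro qpoch_nonzero' q)
  have lim: "qfac q \<longlonglongrightarrow> E"
    unfolding E_def qfac_def[abs_def] by (intro qpoch_LIMSEQ q)
  hence "Bseq (qfac q)"
    by (metis Bseq_eq_bounded convergentI convergent_imp_Bseq)
  then obtain B where B: "B > 0" "\<And>n. norm (qfac q n) \<le> B"
    by (auto simp: Bseq_def)
  have "(\<lambda>n. inverse (qfac q n)) \<longlonglongrightarrow> inverse E"
    by (intro tendsto_inverse lim E)
  hence "Bseq (\<lambda>n. inverse (qfac q n))"
    using convergentI convergent_imp_Bseq by blast
  then obtain C where C: "C > 0" "\<And>n. norm (inverse (qfac q n)) \<le> C"
    by (auto simp: Bseq_def)
  have bound: "norm (qbinom q n k) \<le> B * C * C" for n k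
  proof (cases "k \<le> n")
    case True
    hence "qbinom q n k = qfac q n * inverse (qfac q k) * inverse (qfac q (n - k))"
      by (simp add: qbinom_def field_simps)
    also have "norm \<dots> \<le> B * C * C"
      unfolding norm_mult using B C by (intro mult_mono) auto
    finally show ?thesis .
  qed (use B C in \<open>auto simp: qbinom_def\<close>)
  define f where "f = (\<lambda>n j. if \<bar>j\<bar> \<le> int n then theta_term w q j * qbinom q (2*n) (nat (int n + j)) else 0)"
  have "(\<lambda>n. infsum (f n) UNIV) \<longlonglongrightarrow> infsum (\<lambda>j. theta_term w q j / E) UNIV"
  proof (rule tendsto_infsum_dominated)
    show "(\<lambda>n. f n j) \<longlonglongrightarrow> theta_term w q j / E" for j
    proof -
      have 1: "filterlim (\<lambda>n. nat (int n + j)) sequentially sequentially"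
        unfolding filterlim_at_top
      proof
        fix Z
        show "\<forall>\<^sub>F n in sequentially. Z \<le> nat (int n + j)"
          using eventually_ge_at_top[of "nat (int Z - j)"] by eventually_elim linarith
      qed
      have 2: "filterlim (\<lambda>n. nat (int n - j)) sequentially sequentially"
        unfolding filterlim_at_top
      proof
        fix Z
        show "\<forall>\<^sub>F n in sequentially. Z \<le> nat (int n - j)"
          using eventually_ge_at_top[of "nat (int Z + j)"] by eventually_elim linarith
      qed
      have 3: "filterlim (\<lambda>n. 2 * n) sequentially (sequentially :: nat filter)"
        by (intro filterlim_subseq) (auto simp: strict_mono_def)
      have "(\<lambda>n. theta_term w q j * (qfac q (2*n) / (qfac q (nat (int n + j)) * qfac q (nat (int n - j)))))
        \<longlonglongrightarrow> theta_term w q j * (E / (E * E))"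
        using E by (intro tendsto_intros filterlim_compose[OF lim] 1 2 3) auto
      moreover have "\<forall>\<^sub>F n in sequentially. theta_term w q j * (qfac q (2*n) / (qfac q (nat (int n + j)) * qfac q (nat (int n - j)))) = f n j"
        using eventually_ge_at_top[of "nat \<bar>j\<bar>"]
      proof eventually_elim
        case (elim n)
        hence "nat (int n + j) \<le> 2 * n" "2 * n - nat (int n + j) = nat (int n - j)" "\<bar>j\<bar> \<le> int n" by linarith+
        thus ?case by (simp add: f_def qbinom_def)
      qed
      ultimately show ?thesis
        using E by (simp add: Lim_transform_eventually)
    qed
    show "norm (f n j) \<le> norm (theta_term w q j) * (B * C * C)" for n j
      using bound[of "2*n" "nat (int n + j)"] B C
      by (auto simp: f_def norm_mult intro!: mult_left_mono)
    show "(\<lambda>j. norm (theta_term w q j) * (B * C * C)) summable_on UNIV"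
      by (intro summable_on_cmult_left theta_term_abs_summable q w)
  qed
  moreover have "infsum (f n) UNIV = (\<Prod>k<n. 1 - w * q ^ k) * (\<Prod>k<n. 1 - q / w * q ^ k)" for n
  proof -
    have "infsum (f n) UNIV = infsum (f n) {-int n..int n}"
      by (rule infsum_cong_neutral) (auto simp: f_def)
    also have "\<dots> = (\<Prod>k<n. 1 - w * q ^ k) * (\<Prod>k<n. 1 - q / w * q ^ k)"
      unfolding finite_triple_product[OF q w] by (auto simp: f_def intro!: sum.cong)
    finally show ?thesis .
  qed
  ultimately have "(\<lambda>n. (\<Prod>k<n. 1 - w * q ^ k) * (\<Prod>k<n. 1 - q / w * q ^ k)) \<longlonglongrightarrow>
      infsum (\<lambda>j. theta_term w q j / E) UNIV" by simp
  moreover have "(\<lambda>n. (\<Prod>k<n. 1 - w * q ^ k) * (\<Prod>k<n. 1 - q / w * q ^ k)) \<longlonglongrightarrow> qpoch w q * qpoch (q / w) q"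
    by (intro tendsto_mult qpoch_LIMSEQ q)
  ultimately have "qpoch w q * qpoch (q / w) q = infsum (\<lambda>j. theta_term w q j / E) UNIV"
    using LIMSEQ_unique by blast
  also have "\<dots> = (\<Sum>\<^sub>\<infinity>n. theta_term w q n) / E"
    unfolding divide_inverse by (rule infsum_cmult_left')
  finally show ?thesis
    using E by (simp add: theta_def E_def field_simps)
qed

lemma infsum_product:
  fixes f :: "'a \<Rightarrow> complex" and g :: "'b \<Rightarrow> complex"
  assumes f: "(\<lambda>x. norm (f x)) summable_on A" and g: "(\<lambda>y. norm (g y)) summable_on B"
  shows "(\<lambda>(x, y). f x * g y) summable_on A \<times> B"
    and "infsum f A * infsum g B = infsum (\<lambda>(x, y). f x * g y) (A \<times> B)"
proof -
  have "(\<lambda>z. norm ((\<lambda>(x, y). f x * g y) z)) summable_on A \<times> B"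
    using f g
    by (subst Infinite_Sum.abs_summable_on_Sigma_iff)
       (auto simp: norm_mult infsum_cmult_right' abs_of_nonneg infsum_nonneg mult_nonneg_nonneg intro!: summable_on_cmult_right summable_on_cmult_left)
  thus s: "(\<lambda>(x, y). f x * g y) summable_on A \<times> B"
    by (rule abs_summable_summable)
  have "infsum (\<lambda>(x, y). f x * g y) (A \<times> B) = infsum (\<lambda>x. infsum (\<lambda>y. f x * g y) B) A"
    using infsum_Sigma_banach[OF s] by simp
  also have "\<dots> = infsum f A * infsum g B"
    by (simp add: infsum_cmult_right' infsum_cmult_left')
  finally show "infsum f A * infsum g B = infsum (\<lambda>(x, y). f x * g y) (A \<times> B)" ..
qed

lemma infsum_int_split:
  fixes f :: "int \<Rightarrow> complex"
  assumes "(\<lambda>n. norm (f n)) summable_on UNIV"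
  shows "summable (\<lambda>n. f (int n))" "summable (\<lambda>n. f (- int (Suc n)))"
    "infsum f UNIV = (\<Sum>n. f (int n)) + (\<Sum>n. f (- int (Suc n)))"
proof -
  have s: "f summable_on A" for A
    using abs_summable_summable[OF assms] summable_on_subset_banach by blast
  have UN: "UNIV = range int \<union> range (\<lambda>n. - int (Suc n))"
  proof -
    have "x \<in> range int \<union> range (\<lambda>n. - int (Suc n))" for x
      by (cases x rule: int_cases) auto
    thus ?thesis by blast
  qed
  have "infsum f UNIV = infsum f (range int) + infsum f (range (\<lambda>n. - int (Suc n)))"
    by (subst UN, rule infsum_Un_disjoint) (auto intro: s)
  moreover have "((f \<circ> int) has_sum infsum f (range int)) UNIV"
    by (subst has_sum_reindex[symmetric]) (auto intro!: has_sum_infsum s)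
  hence "(\<lambda>n. f (int n)) sums infsum f (range int)"
    unfolding o_def by (rule has_sum_imp_sums)
  moreover have "((f \<circ> (\<lambda>n. - int (Suc n))) has_sum infsum f (range (\<lambda>n. - int (Suc n)))) UNIV"
    by (subst has_sum_reindex[symmetric]) (auto simp: inj_def intro!: has_sum_infsum s)
  hence "(\<lambda>n. f (- int (Suc n))) sums infsum f (range (\<lambda>n. - int (Suc n)))"
    unfolding o_def by (rule has_sum_imp_sums)
  ultimately show "summable (\<lambda>n. f (int n))" "summable (\<lambda>n. f (- int (Suc n)))"
    "infsum f UNIV = (\<Sum>n. f (int n)) + (\<Sum>n. f (- int (Suc n)))"
    by (auto simp: sums_iff)
qed

lemma infsum_shift_int: "infsum (\<lambda>m::int. f (m + k)) UNIV = infsum f UNIV"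
  by (rule infsum_reindex_bij_witness[of _ "\<lambda>m. m - k" "\<lambda>m. m + k"]) auto

section \<open>Kronecker's bilateral series\<close>

definition kcoeff :: "complex \<Rightarrow> complex \<Rightarrow> int \<Rightarrow> complex" where
  "kcoeff b q n = 1 / (1 - b * q powi n)"

definition kronecker_series :: "complex \<Rightarrow> complex \<Rightarrow> complex \<Rightarrow> complex" where
  "kronecker_series a b q = (\<Sum>\<^sub>\<infinity>n. a powi n * kcoeff b q n)"

text \<open>The nome is fixed in a locale. The identities are used at many powers of one nome, and each of these
  is an interpretation with base \<open>q ^ n\<close>.\<close>
locale theta_base =
  fixes q :: complex
  assumes q1: "norm q < 1" and q0: "q \<noteq> 0"
begin

text \<open>The points where neither the Weierstrass function nor the reciprocal of theta has a pole.\<close>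
definition admissible :: "complex \<Rightarrow> bool" where
  "admissible b \<longleftrightarrow> b \<noteq> 0 \<and> (\<forall>k::int. b \<noteq> q powi k)"

lemma admissible_denom: "admissible b \<Longrightarrow> 1 - b * q powi n \<noteq> 0"
proof
  assume b: "admissible b" and "1 - b * q powi n = 0"
  hence "b = q powi (-n)" using q0 by (simp add: power_int_minus field_simps)
  thus False using b by (auto simp: admissible_def)
qed

lemma norm_power_int_ge_1: "k \<le> 0 \<Longrightarrow> norm (q powi k) \<ge> 1"
  using power_int_decreasing[of k 0 "norm q"] q1 q0 by (simp add: norm_power_int)

lemma norm_power_int_le: "k \<ge> 1 \<Longrightarrow> norm (q powi k) \<le> norm q"
  using power_int_decreasing[of 1 k "norm q"] q1 q0 by (simp add: norm_power_int)

lemma admissible_annulus: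
  assumes "norm q < norm a" "norm a < 1"
  shows "admissible a"
  unfolding admissible_def
proof safe
  fix k assume "a = q powi k"
  thus False using norm_power_int_ge_1[of k] norm_power_int_le[of k] assms by (cases "k \<le> 0") auto
qed (use assms in auto)

lemma admissible_circle:
  assumes "norm a = 1" "a \<noteq> 1"
  shows "admissible a"
  unfolding admissible_def
proof safe
  fix k assume k: "a = q powi k"
  have "k \<noteq> 0" using k assms by auto
  moreover have "\<not> k \<ge> 1" using norm_power_int_le[of k] k assms q1 by auto
  moreover have "\<not> k \<le> -1"
  proof
    assume "k \<le> -1"
    hence "norm (q powi (-k)) \<le> norm q" by (intro norm_power_int_le) auto
    moreover have "norm (q powi (-k)) = 1"
      using k assms by (simp add: power_int_minus norm_inverse)
    ultimately show False using q1 by simp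
  qed
  ultimately show False by linarith
qed (use assms in auto)

lemma theta_admissible: "admissible b \<Longrightarrow> theta b q \<noteq> 0"
  by (intro theta_nonzero q1 q0) (auto simp: admissible_def)

lemma kcoeff_bounds:
  assumes b: "admissible b"
  obtains C where "C > 0" "\<And>n. norm (kcoeff b q (int n)) \<le> C"
    "\<And>n. norm (kcoeff b q (- int n)) \<le> C * norm q ^ n" "\<And>n. norm (kcoeff b q n) \<le> C"
proof -
  have lim: "(\<lambda>n. q ^ n) \<longlonglongrightarrow> 0" using q1 by (intro LIMSEQ_power_zero)
  have "(\<lambda>n. 1 / (1 - b * q ^ n)) \<longlonglongrightarrow> 1 / (1 - b * 0)"
    by (intro tendsto_intros lim) auto
  hence "Bseq (\<lambda>n. 1 / (1 - b * q ^ n))"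
    using convergentI convergent_imp_Bseq by blast
  then obtain C1 where C1: "C1 > 0" "\<And>n. norm (1 / (1 - b * q ^ n)) \<le> C1"
    by (auto simp: Bseq_def)
  have "(\<lambda>n. 1 / (q ^ n - b)) \<longlonglongrightarrow> 1 / (0 - b)"
    using b by (intro tendsto_intros lim) (auto simp: admissible_def)
  hence "Bseq (\<lambda>n. 1 / (q ^ n - b))"
    using convergentI convergent_imp_Bseq by blast
  then obtain C2 where C2: "C2 > 0" "\<And>n. norm (1 / (q ^ n - b)) \<le> C2"
    by (auto simp: Bseq_def)
  define C where "C = max C1 C2"
  have 1: "norm (kcoeff b q (int n)) \<le> C" for n
    using C1(2)[of n] by (simp add: kcoeff_def C_def)
  have 2: "norm (kcoeff b q (- int n)) \<le> C * norm q ^ n" for n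
  proof -
    have "kcoeff b q (- int n) = q ^ n * (1 / (q ^ n - b))"
      using q0 by (simp add: kcoeff_def power_int_minus field_simps)
    also have "norm \<dots> \<le> norm q ^ n * C"
      unfolding norm_mult norm_power using C2(2)[of n] by (intro mult_left_mono) (auto simp: C_def)
    finally show ?thesis by (simp add: mult.commute)
  qed
  have 3: "C > 0" using C1 by (simp add: C_def)
  have 4: "norm (kcoeff b q n) \<le> C" for n
  proof (cases "n \<ge> 0")
    case True
    thus ?thesis using 1[of "nat n"] by simp
  next
    case False
    have "C * norm q ^ nat (-n) \<le> C * 1"
      using 3 q1 by (intro mult_left_mono power_le_one) auto
    thus ?thesis using 2[of "nat (-n)"] False by simp
  qed
  show ?thesis by (rule that[OF 3 1 2 4])
qed

lemma kronecker_abs_summable: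
  assumes b: "admissible b" and a: "norm q < norm a" "norm a < 1"
  shows "(\<lambda>n. norm (a powi n * kcoeff b q n)) summable_on UNIV"
proof -
  obtain C where C: "C > 0" "\<And>n. norm (kcoeff b q (int n)) \<le> C"
    "\<And>n. norm (kcoeff b q (- int n)) \<le> C * norm q ^ n"
    using kcoeff_bounds[OF b] by metis
  show ?thesis
  proof (rule abs_summable_on_int)
    show "summable (\<lambda>n. norm (a powi int n * kcoeff b q (int n)))"
    proof (rule summable_comparison_test')
      show "summable (\<lambda>n. norm a ^ n * C)"
        using a by (intro summable_mult2 summable_geometric) auto
      show "norm (norm (a powi int n * kcoeff b q (int n))) \<le> norm a ^ n * C" for n
        using C(2)[of n] by (simp add: norm_mult norm_power mult_left_mono)
    qed
    show "summable (\<lambda>n. norm (a powi (- int n) * kcoeff b q (- int n)))"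
    proof (rule summable_comparison_test')
      have "norm a > 0" using a(1) norm_ge_zero[of q] by linarith
      thus "summable (\<lambda>n. (norm q / norm a) ^ n * C)"
        using a by (intro summable_mult2 summable_geometric) auto
      show "norm (norm (a powi (- int n) * kcoeff b q (- int n))) \<le> (norm q / norm a) ^ n * C" for n
      proof -
        have "norm (a powi (- int n) * kcoeff b q (- int n)) \<le> inverse (norm a ^ n) * (C * norm q ^ n)"
          unfolding norm_mult using C(3)[of n]
          by (intro mult_mono) (auto simp: norm_power_int power_int_minus norm_inverse norm_power)
        thus ?thesis by (simp add: field_simps)
      qed
    qed
  qed
qed

lemma theta_1: "theta 1 q = 0" and theta_q: "theta q q = 0"
  using q1 q0 by (simp_all add: theta_def)

text \<open>The coefficient of \<open>a\<^sup>N\<close> in the product of Kronecker's series with \<open>theta a q\<close>. Passing from \<open>N\<close> to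
  \<open>N + 1\<close> and shifting the summation index, the denominators cancel in \<open>c (N + 1) + b q\<^sup>N c N\<close>, and what
  remains is \<open>theta 1 q = 0\<close>. So the coefficients are those of \<open>theta (a * b) q\<close> up to a factor.\<close>
lemma kcoeff_recurrence:
  assumes b: "admissible b"
  defines "c \<equiv> \<lambda>N. \<Sum>\<^sub>\<infinity>m. theta_term 1 q m * kcoeff b q (N - m)"
  shows "c N = (-b) powi N * q powi (tri N) * c 0"
proof -
  have s: "(\<lambda>m. theta_term 1 q m * kcoeff b q (N - m)) summable_on UNIV" for N
  proof (rule abs_summable_summable)
    obtain C where C: "C > 0" "\<And>n. norm (kcoeff b q n) \<le> C" using kcoeff_bounds[OF b] by metis
    show "(\<lambda>m. norm (theta_term 1 q m * kcoeff b q (N - m))) summable_on UNIV"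
    proof (rule Infinite_Sum.abs_summable_on_comparison_test')
      show "(\<lambda>m. norm (theta_term 1 q m) * C) summable_on UNIV"
        by (intro summable_on_cmult_left theta_term_abs_summable q1 q0) auto
      show "norm (theta_term 1 q m * kcoeff b q (N - m)) \<le> norm (theta_term 1 q m) * C" for m
        unfolding norm_mult by (intro mult_left_mono C) auto
    qed
  qed
  have step: "c (N + 1) = - b * q powi N * c N" for N
  proof -
    have "c (N + 1) = (\<Sum>\<^sub>\<infinity>m. theta_term 1 q (m + 1) * kcoeff b q (N - m))"
      unfolding c_def by (subst infsum_shift_int[of _ 1, symmetric]) simp
    moreover have "theta_term 1 q (m + 1) * kcoeff b q (N - m) + b * q powi N * (theta_term 1 q m * kcoeff b q (N - m)) = theta_term 1 q (m + 1)" for m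
    proof -
      have t: "theta_term 1 q (m + 1) = - (theta_term 1 q m * q powi m)"
        using q0 by (simp add: tri_plus_1 power_int_add)
      have "q powi N = q powi m * q powi (N - m)"
        using q0 by (metis power_int_add add.commute diff_add_cancel)
      hence "theta_term 1 q (m + 1) * kcoeff b q (N - m) + b * q powi N * (theta_term 1 q m * kcoeff b q (N - m)) =
          - (theta_term 1 q m * q powi m) * ((1 - b * q powi (N - m)) * kcoeff b q (N - m))"
        unfolding t by (simp add: algebra_simps)
      also have "(1 - b * q powi (N - m)) * kcoeff b q (N - m) = 1"
        using admissible_denom[OF b] by (simp add: kcoeff_def)
      finally show ?thesis unfolding t by simp
    qed
    moreover have "(\<lambda>m. theta_term 1 q (m + 1) * kcoeff b q (N - m)) summable_on UNIV"
    proof -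
      have "(\<lambda>m. theta_term 1 q (m + 1) * kcoeff b q (N - m)) summable_on UNIV \<longleftrightarrow>
            (\<lambda>m. theta_term 1 q m * kcoeff b q (N + 1 - m)) summable_on UNIV"
        by (rule summable_on_reindex_bij_witness[of _ "\<lambda>m. m - 1" "\<lambda>m. m + 1"]) auto
      thus ?thesis using s[of "N + 1"] by blast
    qed
    hence "(\<Sum>\<^sub>\<infinity>m. theta_term 1 q (m + 1) * kcoeff b q (N - m)) + b * q powi N * c N =
       (\<Sum>\<^sub>\<infinity>m. theta_term 1 q (m + 1) * kcoeff b q (N - m) + b * q powi N * (theta_term 1 q m * kcoeff b q (N - m)))"
      unfolding c_def infsum_cmult_right'[symmetric]
      by (intro infsum_add[symmetric] summable_on_cmult_right s)
    moreover have "(\<Sum>\<^sub>\<infinity>m. theta_term 1 q (m + 1)) = 0"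
      using jacobi_triple_product[OF q1 q0, of 1] theta_1 infsum_shift_int[of "theta_term 1 q" 1] by simp
    ultimately have "c (N + 1) + b * q powi N * c N = 0" by simp
    thus ?thesis by (simp add: add_eq_0_iff)
  qed
  have b0: "b \<noteq> 0" using b by (simp add: admissible_def)
  let ?g = "\<lambda>N. (-b) powi N * q powi (tri N)"
  have gstep: "?g (N + 1) = - b * q powi N * ?g N" for N
    using b0 q0 by (simp add: tri_plus_1 power_int_add)
  show ?thesis
  proof (induction N rule: int_induct[where k = 0])
    case (step1 i)
    show ?case unfolding step[of i] gstep[of i] step1.IH by (simp only: mult_ac)
  next
    case (step2 i)
    have "- b * q powi (i - 1) * c (i - 1) = c i"
      using step[of "i - 1"] by simp
    also have "\<dots> = ?g i * c 0" by (rule step2.IH)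
    also have "?g i = - b * q powi (i - 1) * ?g (i - 1)"
      using gstep[of "i - 1"] by simp
    finally have "(- b * q powi (i - 1)) * c (i - 1) = (- b * q powi (i - 1)) * (?g (i - 1) * c 0)"
      by (simp only: mult.assoc)
    moreover have "- b * q powi (i - 1) \<noteq> 0" using b0 q0 by simp
    ultimately show ?case by (simp only: mult_cancel_left simp_thms)
  qed simp
qed

lemma kronecker_mult_theta:
  assumes b: "admissible b" and a: "norm q < norm a" "norm a < 1"
  shows "kronecker_series a b q * theta a q =
    (\<Sum>\<^sub>\<infinity>m. theta_term 1 q m * kcoeff b q (- m)) * theta (a * b) q"
proof -
  have a0: "a \<noteq> 0" using a by auto
  have b0: "b \<noteq> 0" using b by (simp add: admissible_def)
  note s1 = kronecker_abs_summable[OF b a] and s2 = theta_term_abs_summable[OF q1 a0 q0]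
  let ?h = "\<lambda>(n, m). a powi n * kcoeff b q n * theta_term a q m"
  have bij: "bij_betw (\<lambda>(N, m). (N - m, m)) UNIV (UNIV :: (int \<times> int) set)"
    by (rule bij_betwI[of _ _ _ "\<lambda>(n, m). (n + m, m)"]) auto
  have "kronecker_series a b q * theta a q = infsum ?h (UNIV \<times> UNIV)"
    unfolding kronecker_series_def jacobi_triple_product[OF q1 q0 a0]
    by (rule infsum_product[OF s1 s2])
  also have "\<dots> = infsum (\<lambda>(N, m). ?h (N - m, m)) (UNIV \<times> UNIV)"
    using infsum_reindex_bij_betw[OF bij, of ?h, symmetric] by (simp add: case_prod_unfold)
  also have "\<dots> = (\<Sum>\<^sub>\<infinity>N. \<Sum>\<^sub>\<infinity>m. ?h (N - m, m))"
  proof (rule infsum_Sigma'_banach[symmetric])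
    have "?h summable_on UNIV" using infsum_product(1)[OF s1 s2] by simp
    thus "(\<lambda>(N, m). ?h (N - m, m)) summable_on UNIV \<times> UNIV"
      using summable_on_reindex_bij_betw[OF bij, of ?h] by (simp add: case_prod_unfold)
  qed
  also have "\<dots> = (\<Sum>\<^sub>\<infinity>N. a powi N * (\<Sum>\<^sub>\<infinity>m. theta_term 1 q m * kcoeff b q (N - m)))"
  proof (intro infsum_cong)
    fix N :: int
    have "?h (N - m, m) = a powi N * (theta_term 1 q m * kcoeff b q (N - m))" for m
    proof -
      have "a powi N = a powi (N - m) * a powi m" using a0 by (metis power_int_add diff_add_cancel)
      moreover have "(-a) powi m = a powi m * (-1) powi m"
        using power_int_mult_distrib[of a "-1" m] by simp
      ultimately show ?thesis by simp
    qed
    thus "(\<Sum>\<^sub>\<infinity>m. ?h (N - m, m)) = a powi N * (\<Sum>\<^sub>\<infinity>m. theta_term 1 q m * kcoeff b q (N - m))"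
      by (simp only: infsum_cmult_right')
  qed
  also have "\<dots> = (\<Sum>\<^sub>\<infinity>N. theta_term (a * b) q N * (\<Sum>\<^sub>\<infinity>m. theta_term 1 q m * kcoeff b q (0 - m)))"
  proof (intro infsum_cong)
    fix N :: int
    have "(- (a * b)) powi N = a powi N * (-b) powi N"
      using power_int_mult_distrib[of a "-b" N] by simp
    thus "a powi N * (\<Sum>\<^sub>\<infinity>m. theta_term 1 q m * kcoeff b q (N - m)) =
      theta_term (a * b) q N * (\<Sum>\<^sub>\<infinity>m. theta_term 1 q m * kcoeff b q (0 - m))"
      unfolding kcoeff_recurrence[OF b, of N] by (simp only: mult_ac)
  qed
  also have "\<dots> = theta (a * b) q * (\<Sum>\<^sub>\<infinity>m. theta_term 1 q m * kcoeff b q (0 - m))"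
    unfolding infsum_cmult_left' using jacobi_triple_product[OF q1 q0, of "a * b"] a0 b0 by simp
  finally show ?thesis by (simp add: mult.commute)
qed

text \<open>Points inside the annulus, where all series converge, that tend to a given point of its closure.\<close>
lemma approach_seq:
  fixes a :: complex
  assumes "norm q < norm a" "norm a \<le> 1"
  obtains x where "x \<longlonglongrightarrow> a" "\<And>n. norm q < norm (x n)" "\<And>n. norm (x n) < 1"
proof
  define d where "d n = (norm a - norm q) / real (n + 2)" for n
  let ?x = "\<lambda>n. a * of_real (1 - d n)"
  have "d n \<le> (norm a - norm q) / 2" for n
    unfolding d_def using assms by (intro divide_left_mono) auto
  moreover have "0 < d n" for n
    unfolding d_def using assms by (intro divide_pos_pos) auto
  ultimately have d: "0 < d n" "d n \<le> (norm a - norm q) / 2" for n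
    by blast+
  have "d \<longlonglongrightarrow> 0" unfolding d_def by real_asymp
  hence "?x \<longlonglongrightarrow> a * of_real (1 - 0)" by (intro tendsto_intros)
  thus "?x \<longlonglongrightarrow> a" by simp
  fix n
  have "norm q \<ge> 0" by simp
  hence d1: "1 - d n > 0" using d(2)[of n] assms by argo
  have eq: "norm (?x n) = norm a * (1 - d n)"
    using d1 by (simp only: norm_mult norm_of_real abs_of_pos)
  have "norm a * d n \<le> 1 * d n" using assms d(1)[of n] by (intro mult_right_mono) auto
  moreover have "d n < norm a - norm q" using d(2)[of n] assms(1) by argo
  ultimately have "norm a * d n < norm a - norm q" by simp
  thus "norm q < norm (?x n)" unfolding eq by (simp only: right_diff_distrib mult_1_right)
  have "norm a * d n > 0" using assms d(1)[of n] norm_ge_zero[of q] by (intro mult_pos_pos) linarith+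
  thus "norm (?x n) < 1" unfolding eq using assms by (simp only: right_diff_distrib mult_1_right)
qed

text \<open>Let \<open>a\<close> tend to 1 in the identity \<open>kronecker_mult_theta\<close>. The series behaves like \<open>1 / (1 - a)\<close>, while
  \<open>theta a q / (1 - a)\<close> tends to \<open>(q; q)\<^sub>\<infinity>\<^sup>3\<close>.\<close>
lemma kcoeff_constant:
  assumes b: "admissible b"
  shows "(\<Sum>\<^sub>\<infinity>m. theta_term 1 q m * kcoeff b q (- m)) * theta b q = qpoch q q ^ 3"
proof -
  define c0 where "c0 = (\<Sum>\<^sub>\<infinity>m. theta_term 1 q m * kcoeff b q (- m))"
  obtain a :: "nat \<Rightarrow> complex" where a: "a \<longlonglongrightarrow> 1" "\<And>n. norm q < norm (a n)" "\<And>n. norm (a n) < 1"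
    by (rule approach_seq[of 1]) (use q1 in auto)
  have a1: "a n \<noteq> 0" "1 - a n \<noteq> 0" for n using a(2,3)[of n] by auto
  define g1 where "g1 n = b * q ^ n * kcoeff b q (int n)" for n
  define g2 where "g2 n = kcoeff b q (- int (Suc n))" for n
  obtain C where C: "C > 0" "\<And>n. norm (kcoeff b q (int n)) \<le> C"
    "\<And>n. norm (kcoeff b q (- int n)) \<le> C * norm q ^ n"
    using kcoeff_bounds[OF b] by metis
  \<comment> \<open>Both power series below converge on a disc of radius \<open>r > 1\<close>, hence are continuous at 1.\<close>
  obtain r where r: "1 < r" "r * norm q < 1"
  proof
    have "1 + norm q > 0" using norm_ge_zero[of q] by linarith
    thus "1 < 2 / (1 + norm q)" "2 / (1 + norm q) * norm q < 1"
      using q1 by (simp_all add: pos_less_divide_eq pos_divide_less_eq)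
  qed
  have s1: "summable (\<lambda>n. g1 n * of_real r ^ n)"
  proof (rule summable_comparison_test')
    show "summable (\<lambda>n. norm b * C * (r * norm q) ^ n)"
      using r by (intro summable_mult summable_geometric) auto
    show "norm (g1 n * of_real r ^ n) \<le> norm b * C * (r * norm q) ^ n" for n
      using mult_left_mono[OF C(2)[of n], of "norm b * (r * norm q) ^ n"] r
      by (simp add: g1_def norm_mult norm_power power_mult_distrib mult_ac)
  qed
  have s2: "summable (\<lambda>n. g2 n * of_real r ^ n)"
  proof (rule summable_comparison_test')
    show "summable (\<lambda>n. C * norm q * (r * norm q) ^ n)"
      using r by (intro summable_mult summable_geometric) auto
    show "norm (g2 n * of_real r ^ n) \<le> C * norm q * (r * norm q) ^ n" for n
      using C(3)[of "Suc n"] r mult_right_mono[OF C(3)[of "Suc n"], of "r ^ n"]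
      by (simp add: g2_def norm_mult norm_power power_mult_distrib mult_ac)
  qed
  \<comment> \<open>The part of the series that stays regular at \<open>a = 1\<close>, after splitting off \<open>1 / (1 - a)\<close>.\<close>
  define G where "G x = (\<Sum>n. g1 n * x ^ n) + (1 / x) * (\<Sum>n. g2 n * (1 / x) ^ n)" for x :: complex
  have "isCont (\<lambda>x. \<Sum>n. g1 n * x ^ n) 1" 
    by (rule isCont_powser[OF s1]) (use r in auto)
  moreover have "isCont (\<lambda>x. \<Sum>n. g2 n * x ^ n) (1 / 1)"
    by (rule isCont_powser[OF s2]) (use r in auto)
  hence "isCont (\<lambda>x. \<Sum>n. g2 n * (1 / x) ^ n) 1"
    by (rule isCont_o2[rotated]) (auto intro!: continuous_intros)
  ultimately have "isCont G 1"
    unfolding G_def by (auto intro!: continuous_intros)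
  hence G: "(\<lambda>n. G (a n)) \<longlonglongrightarrow> G 1"
    using a(1) by (rule isCont_tendsto_compose)
  have F: "kronecker_series (a n) b q = 1 / (1 - a n) + G (a n)" for n
  proof -
    let ?f = "\<lambda>k. a n powi k * kcoeff b q k"
    note s = kronecker_abs_summable[OF b a(2,3)[of n]]
    have "?f (int k) = a n ^ k + g1 k * a n ^ k" for k
    proof -
      have "kcoeff b q (int k) = 1 + b * q ^ k * kcoeff b q (int k)"
        using admissible_denom[OF b, of "int k"] by (simp add: kcoeff_def field_simps)
      hence "a n powi int k * kcoeff b q (int k) = a n ^ k * (1 + b * q ^ k * kcoeff b q (int k))"
        by simp
      thus ?thesis by (simp add: g1_def algebra_simps)
    qed
    moreover have "(\<lambda>k. a n ^ k) sums (1 / (1 - a n))"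
      using a(3)[of n] by (rule geometric_sums)
    moreover have "summable (\<lambda>k. g1 k * a n ^ k)"
      by (rule powser_inside[OF s1]) (use a(3)[of n] r in auto)
    ultimately have "(\<Sum>k. ?f (int k)) = 1 / (1 - a n) + (\<Sum>k. g1 k * a n ^ k)"
      by (simp add: suminf_add[symmetric] sums_iff)
    moreover have "?f (- int (Suc k)) = (1 / a n) * (g2 k * (1 / a n) ^ k)" for k
      using a1[of n] by (simp add: g2_def power_int_def power_divide field_simps nat_add_distrib del: of_nat_Suc)
    moreover have "summable (\<lambda>k. g2 k * (1 / a n) ^ k)"
    proof -
      have "summable (\<lambda>k. ?f (- int (Suc k)))" by (rule infsum_int_split[OF s])
      hence "summable (\<lambda>k. a n * ?f (- int (Suc k)))" by (rule summable_mult)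
      moreover have "a n * ?f (- int (Suc k)) = g2 k * (1 / a n) ^ k" for k
        using a1[of n] by (simp add: g2_def power_int_def power_divide field_simps nat_add_distrib del: of_nat_Suc)
      ultimately show ?thesis by (simp only:)
    qed
    ultimately show ?thesis
      unfolding kronecker_series_def infsum_int_split(3)[OF s] G_def by (simp only: suminf_mult add.assoc)
  qed
  have th: "theta (a n) q = (1 - a n) * (qpoch (a n * q) q * qpoch (q / a n) q * qpoch q q)" for n
    using qpoch_unfold[OF q1, of "a n"] by (simp add: theta_def)
  have eq: "(1 + (1 - a n) * G (a n)) * (qpoch (a n * q) q * qpoch (q / a n) q * qpoch q q) = c0 * theta (a n * b) q" for n
  proof -
    have "(1 + (1 - a n) * G (a n)) = kronecker_series (a n) b q * (1 - a n)"
      unfolding F using a1[of n] by (simp add: field_simps)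
    thus ?thesis using kronecker_mult_theta[OF b a(2,3)[of n]] unfolding th c0_def by (simp add: mult_ac)
  qed
  have "(\<lambda>n. (1 + (1 - a n) * G (a n)) * (qpoch (a n * q) q * qpoch (q / a n) q * qpoch q q)) \<longlonglongrightarrow>
      (1 + (1 - 1) * G 1) * (qpoch (1 * q) q * qpoch (q / 1) q * qpoch q q)"
    by (intro tendsto_intros G a(1) isCont_tendsto_compose[OF isCont_qpoch[OF q1]]) auto
  moreover have "(\<lambda>n. c0 * theta (a n * b) q) \<longlonglongrightarrow> c0 * theta (1 * b) q"
    using b by (intro tendsto_intros isCont_tendsto_compose[OF isCont_theta[OF q1]] a(1)) (auto simp: admissible_def)
  ultimately have "c0 * theta (1 * b) q = (1 + (1 - 1) * G 1) * (qpoch (1 * q) q * qpoch (q / 1) q * qpoch q q)"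
    unfolding eq using LIMSEQ_unique by blast
  thus ?thesis by (simp add: c0_def power3_eq_cube)
qed

theorem kronecker_product:
  assumes b: "admissible b" and a: "norm q < norm a" "norm a < 1"
  shows "kronecker_series a b q = qpoch q q ^ 3 * theta (a * b) q / (theta a q * theta b q)"
proof -
  let ?S = "\<Sum>\<^sub>\<infinity>m. theta_term 1 q m * kcoeff b q (- m)"
  have "kronecker_series a b q * (theta a q * theta b q) = (kronecker_series a b q * theta a q) * theta b q"
    by (simp only: mult.assoc)
  also have "\<dots> = (?S * theta b q) * theta (a * b) q"
    unfolding kronecker_mult_theta[OF b a] by (simp only: mult_ac)
  also have "\<dots> = qpoch q q ^ 3 * theta (a * b) q"
    unfolding kcoeff_constant[OF b] ..
  finally show ?thesis
    using theta_admissible[OF b] theta_admissible[OF admissible_annulus[OF a]]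
    by (simp add: eq_divide_eq)
qed

end

section \<open>Differences of values of the Weierstrass function\<close>

text \<open>Up to an additive constant and scaling, this is the Weierstrass function of the lattice of periods of
  \<open>\<complex>\<^sup>* / q\<^sup>\<int>\<close>.\<close>
definition wp :: "complex \<Rightarrow> complex \<Rightarrow> complex" where
  "wp b q = (\<Sum>\<^sub>\<infinity>m::int. b * q powi m / (1 - b * q powi m) ^ 2)"

context theta_base
begin

lemma kcoeff_diff:
  assumes b: "admissible b"
  shows "kcoeff b q m - kcoeff b q (m + k) = b * (1 - q powi k) * (q powi m * kcoeff b q m * kcoeff b q (m + k))"
proof -
  define x y where "x = b * q powi m" and "y = b * q powi (m + k)"
  have "1 - x \<noteq> 0" "1 - y \<noteq> 0" unfolding x_def y_def by (intro admissible_denom b)+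
  hence "1 / (1 - x) - 1 / (1 - y) = (x - y) * (1 / (1 - x) * (1 / (1 - y)))"
    by (simp add: divide_simps)
  moreover have "x - y = b * (1 - q powi k) * q powi m"
    using q0 by (simp add: x_def y_def power_int_add algebra_simps)
  ultimately show ?thesis by (simp add: kcoeff_def x_def y_def)
qed

lemma power_int_ne_1: "k \<noteq> 0 \<Longrightarrow> q powi k \<noteq> 1"
proof
  assume "k \<noteq> 0" "q powi k = 1"
  moreover from this have "q powi (-k) = 1" by (simp add: power_int_minus)
  ultimately show False
    using norm_power_int_le[of k] norm_power_int_le[of "-k"] q1 by (cases "k \<ge> 1") auto
qed

text \<open>For \<open>k = 1\<close> the sum telescopes, and the terms tend to 1 on the right and to 0 on the left; both
  directions of the induction on \<open>k\<close> add or remove one shifted copy.\<close>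
lemma kcoeff_diff_sum:
  assumes b: "admissible b"
  shows "((\<lambda>m. kcoeff b q m - kcoeff b q (m + k)) has_sum (- of_int k)) UNIV"
proof -
  obtain C where C: "C > 0" "\<And>n. norm (kcoeff b q (int n)) \<le> C"
    "\<And>n. norm (kcoeff b q (- int n)) \<le> C * norm q ^ n" "\<And>n. norm (kcoeff b q n) \<le> C"
    using kcoeff_bounds[OF b] by metis
  let ?f = "\<lambda>m. kcoeff b q m - kcoeff b q (m + 1)"
  have geo: "summable (\<lambda>n. K * norm q ^ n)" for K
    using q1 by (intro summable_mult summable_geometric) auto
  have abs: "(\<lambda>m. norm (?f m)) summable_on UNIV"
  proof (rule abs_summable_on_int)
    show "summable (\<lambda>n. norm (?f (int n)))"
    proof (rule summable_comparison_test'[OF geo])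
      fix n
      have "norm (?f (int n)) = norm (b * (1 - q)) * norm q ^ n * norm (kcoeff b q (int n)) * norm (kcoeff b q (int n + 1))"
        unfolding kcoeff_diff[OF b] by (simp add: norm_mult norm_power mult_ac)
      also have "\<dots> \<le> norm (b * (1 - q)) * norm q ^ n * C * C"
        by (intro mult_mono mult_nonneg_nonneg C order_refl) (use C in auto)
      finally show "norm (norm (?f (int n))) \<le> (norm (b * (1 - q)) * C * C) * norm q ^ n"
        by (simp add: mult_ac)
    qed
    show "summable (\<lambda>n. norm (?f (- int n)))"
    proof (rule summable_comparison_test'[OF geo])
      fix n
      have 1: "norm (kcoeff b q (- int n)) \<le> C * norm q ^ n / norm q"
      proof -
        have "C * norm q ^ n * 1 \<le> C * norm q ^ n * (1 / norm q)"
          using q1 q0 C by (intro mult_left_mono) auto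
        thus ?thesis using C(3)[of n] by simp
      qed
      have 2: "norm (kcoeff b q (- int n + 1)) \<le> C * norm q ^ n / norm q"
      proof (cases n)
        case 0
        have "C * 1 \<le> C * (1 / norm q)"
          using q1 q0 C by (intro mult_left_mono) auto
        thus ?thesis using 0 C(4)[of 1] by simp
      next
        case (Suc k)
        thus ?thesis using C(3)[of k] q0 by simp
      qed
      have "norm (?f (- int n)) \<le> norm (kcoeff b q (- int n)) + norm (kcoeff b q (- int n + 1))"
        by (rule norm_triangle_ineq4)
      also have "\<dots> \<le> C * norm q ^ n / norm q + C * norm q ^ n / norm q"
        by (intro add_mono 1 2)
      finally show "norm (norm (?f (- int n))) \<le> (2 * C / norm q) * norm q ^ n"
        by (simp add: field_simps)
    qed
  qed
  have "(\<lambda>n. q ^ n) \<longlonglongrightarrow> 0" using q1 by (intro LIMSEQ_power_zero)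
  from tendsto_divide[OF tendsto_const[of 1] tendsto_diff[OF tendsto_const[of 1] tendsto_mult[OF tendsto_const[of b] this]]]
  have "(\<lambda>n. 1 / (1 - b * q ^ n)) \<longlonglongrightarrow> 1 / (1 - b * 0)" by simp
  hence lim1: "(\<lambda>n. kcoeff b q (int n)) \<longlonglongrightarrow> 1" by (simp add: kcoeff_def)
  have lim2: "(\<lambda>n. kcoeff b q (- int n)) \<longlonglongrightarrow> 0"
  proof (rule Lim_null_comparison)
    show "\<forall>\<^sub>F n in sequentially. norm (kcoeff b q (- int n)) \<le> C * norm q ^ n"
      using C(3) by simp
    have "(\<lambda>n. C * norm q ^ n) \<longlonglongrightarrow> C * 0"
      using q1 by (intro tendsto_intros LIMSEQ_power_zero) auto
    thus "(\<lambda>n. C * norm q ^ n) \<longlonglongrightarrow> 0" by simp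
  qed
  have "(\<Sum>n. ?f (int n)) = kcoeff b q 0 - 1"
    using telescope_sums'[OF lim1] by (auto simp: sums_iff add.commute)
  moreover have "(\<Sum>n. ?f (- int (Suc n))) = 0 - kcoeff b q 0"
    using telescope_sums[OF lim2] by (auto simp: sums_iff)
  ultimately have "infsum ?f UNIV = -1"
    unfolding infsum_int_split(3)[OF abs] by simp
  hence one: "(?f has_sum -1) UNIV"
    using has_sum_infsum[OF abs_summable_summable[OF abs]] by simp
  have shift: "((\<lambda>m. ?f (m + k)) has_sum -1) UNIV" for k
    using has_sum_reindex_bij_witness[of UNIV "\<lambda>m. m - k" "\<lambda>m. m + k" UNIV ?f "\<lambda>m. ?f (m + k)" "-1" "-1"] one
    by simp
  show ?thesis
  proof (induction k rule: int_induct[where k = 0])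
    case base
    show ?case by simp
  next
    case (step1 k)
    have "((\<lambda>m. (kcoeff b q m - kcoeff b q (m + k)) + ?f (m + k)) has_sum (- of_int k + -1)) UNIV"
      by (intro has_sum_add step1.IH shift)
    thus ?case by (simp add: add_ac)
  next
    case (step2 k)
    have "((\<lambda>m. (kcoeff b q m - kcoeff b q (m + k)) + - ?f (m + (k - 1))) has_sum (- of_int k + - (-1))) UNIV"
      by (intro has_sum_add step2.IH has_sum_uminusI shift)
    thus ?case by (simp add: algebra_simps)
  qed
qed

text \<open>The coefficient of \<open>a\<^sup>k\<close> in the product of the two series is \<open>\<Sum> q\<^sup>m / ((1 - b q\<^sup>m) (1 - b q\<^sup>m\<^sup>+\<^sup>k))\<close>. For
  \<open>k = 0\<close> it is \<open>wp b q / b\<close>; for \<open>k \<noteq> 0\<close> partial fractions and \<open>kcoeff_diff_sum\<close> evaluate it. Thus the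
  dependence on \<open>a\<close> and on \<open>b\<close> separates.\<close>
lemma kronecker_reflected_product:
  assumes b: "admissible b" and a: "norm q < norm a" "norm a < 1"
  shows "b * kronecker_series a b q * kronecker_series (q / a) b q =
    wp b q - (\<Sum>\<^sub>\<infinity>k::int. if k = 0 then 0 else of_int k * a powi k / (1 - q powi k))"
proof -
  have a0: "a \<noteq> 0" using a by auto
  have b0: "b \<noteq> 0" using b by (simp add: admissible_def)
  have a': "norm q < norm (q / a)" "norm (q / a) < 1"
    using a q0 norm_ge_zero[of q] by (auto simp: norm_divide divide_simps)
  note s1 = kronecker_abs_summable[OF b a] and s2 = kronecker_abs_summable[OF b a']
  let ?h = "\<lambda>(n, m). (a powi n * kcoeff b q n) * ((q / a) powi m * kcoeff b q m)"
  let ?L = "\<lambda>k::int. if k = 0 then 0 else of_int k * a powi k / (1 - q powi k)"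
  let ?g = "\<lambda>k m. a powi k * (q powi m * kcoeff b q m * kcoeff b q (m + k))"
  have bij: "bij_betw (\<lambda>(k, m). (m + k, m)) UNIV (UNIV :: (int \<times> int) set)"
    by (rule bij_betwI[of _ _ _ "\<lambda>(n, m). (n - m, m)"]) auto
  have h: "?h (m + k, m) = ?g k m" for k m
    using a0 q0 by (simp add: power_int_add power_int_divide_distrib)
  have hs: "?h summable_on UNIV" using infsum_product(1)[OF s1 s2] by simp
  have resub: "(\<lambda>x. ?h (case x of (k, m) \<Rightarrow> (m + k, m))) = (\<lambda>(k, m). ?g k m)"
    using h by (auto simp only: fun_eq_iff split_paired_all prod.case)
  have gs: "(\<lambda>(k, m). ?g k m) summable_on UNIV \<times> UNIV"
    using hs summable_on_reindex_bij_betw[OF bij, of ?h] unfolding resub by simp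
  have inner: "(\<Sum>\<^sub>\<infinity>m. ?g k m) = (if k = 0 then wp b q / b else 0) + (- ?L k / b)" for k
    proof (cases "k = 0")
      case True
      have "(\<Sum>\<^sub>\<infinity>m. ?g 0 m) = (\<Sum>\<^sub>\<infinity>m. b * q powi m / (1 - b * q powi m) ^ 2 * (1 / b))"
        using b0 by (intro infsum_cong) (auto simp: kcoeff_def power2_eq_square)
      also have "\<dots> = wp b q * (1 / b)"
        unfolding wp_def by (rule infsum_cmult_left')
      finally show ?thesis using True by simp
    next
      case False
      have qk: "1 - q powi k \<noteq> 0"
        using power_int_ne_1[OF False] by auto
      have "(\<Sum>\<^sub>\<infinity>m. ?g k m) =
          (\<Sum>\<^sub>\<infinity>m. a powi k / (b * (1 - q powi k)) * (kcoeff b q m - kcoeff b q (m + k)))"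
        unfolding kcoeff_diff[OF b] using qk b0 by (intro infsum_cong) simp
      also have "\<dots> = a powi k / (b * (1 - q powi k)) * (- of_int k)"
        unfolding infsum_cmult_right' infsumI[OF kcoeff_diff_sum[OF b]] ..
      finally show ?thesis using False by (simp add: mult_ac)
    qed
  have "kronecker_series a b q * kronecker_series (q / a) b q = infsum ?h (UNIV \<times> UNIV)"
    unfolding kronecker_series_def by (rule infsum_product[OF s1 s2])
  also have "\<dots> = infsum (\<lambda>(k, m). ?g k m) (UNIV \<times> UNIV)"
    using infsum_reindex_bij_betw[OF bij, of ?h, symmetric] unfolding resub by simp
  also have "\<dots> = (\<Sum>\<^sub>\<infinity>k. \<Sum>\<^sub>\<infinity>m. ?g k m)"
    by (rule infsum_Sigma'_banach[symmetric, OF gs])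
  also have "\<dots> = (\<Sum>\<^sub>\<infinity>k. (if k = 0 then wp b q / b else 0) + (- ?L k / b))"
    by (simp only: inner)
  also have "\<dots> = wp b q / b - (\<Sum>\<^sub>\<infinity>k. ?L k) / b"
  proof -
    have 1: "((\<lambda>k. if k = 0 then wp b q / b else 0) has_sum wp b q / b) (UNIV :: int set)"
      by (rule has_sum_finite_neutralI[of "{0}"]) auto
    have "(\<lambda>k. \<Sum>\<^sub>\<infinity>m. ?g k m) summable_on UNIV"
      using summable_on_Sigma_banach[OF gs] by simp
    hence "(\<lambda>k. (\<Sum>\<^sub>\<infinity>m. ?g k m) + - (if k = 0 then wp b q / b else 0)) summable_on UNIV"
      by (intro summable_on_add iffD2[OF summable_on_uminus] has_sum_imp_summable[OF 1])
    hence 2: "(\<lambda>k. - ?L k / b) summable_on UNIV"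
      unfolding inner by simp
    have "(\<Sum>\<^sub>\<infinity>k. (if k = 0 then wp b q / b else 0) + (- ?L k / b)) =
       (\<Sum>\<^sub>\<infinity>k::int. if k = 0 then wp b q / b else 0) + (\<Sum>\<^sub>\<infinity>k. - ?L k / b)"
      by (rule infsum_add[OF has_sum_imp_summable[OF 1] 2])
    also have "(\<Sum>\<^sub>\<infinity>k::int. if k = 0 then wp b q / b else 0) = wp b q / b"
      by (rule infsumI[OF 1])
    also have "(\<Sum>\<^sub>\<infinity>k. - ?L k / b) = (\<Sum>\<^sub>\<infinity>k. ?L k * (- 1 / b))"
      by (intro infsum_cong) simp
    also have "\<dots> = (\<Sum>\<^sub>\<infinity>k. ?L k) * (- 1 / b)"
      by (rule infsum_cmult_left')
    finally show ?thesis by simp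
  qed
  finally show ?thesis using b0 by (simp add: field_simps)
qed

definition wp_quotient :: "complex \<Rightarrow> complex \<Rightarrow> complex" where
  "wp_quotient a b = b * qpoch q q ^ 6 * theta (a * b) q * theta (a / b) q / (theta a q * theta b q) ^ 2"

lemma wp_diff_interior:
  assumes b: "admissible b" and a: "norm q < norm a" "norm a < 1"
  shows "wp b q - wp a q = wp_quotient a b"
proof -
  have a': "norm q < norm (q / a)" "norm (q / a) < 1"
    using a q0 norm_ge_zero[of q] by (auto simp: norm_divide divide_simps)
  have a0: "a \<noteq> 0" using a by auto
  let ?L = "\<Sum>\<^sub>\<infinity>k::int. if k = 0 then 0 else of_int k * a powi k / (1 - q powi k)"
  have main: "wp b q - ?L = wp_quotient a b" if b: "admissible b" for b
  proof -
    have b0: "b \<noteq> 0" using b by (simp add: admissible_def)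
    have "theta (q / a) q = theta a q" using a0 q0 by (intro theta_reflect)
    moreover have "theta (q / a * b) q = theta (a / b) q"
      using theta_reflect[of "a / b" q] a0 b0 q0 by simp
    ultimately show ?thesis
      using kronecker_reflected_product[OF b a] kronecker_product[OF b a] kronecker_product[OF b a']
      unfolding wp_quotient_def by (simp add: power2_eq_square eval_nat_numeral mult_ac)
  qed
  have "theta (a / a) q = 0" using theta_1 a0 by simp
  \<comment> \<open>At \<open>b = a\<close> the theta quotient vanishes, so the sum over \<open>k\<close> is a second expansion of \<open>wp a q\<close>.\<close>
  hence "wp a q = ?L"
    using main[OF admissible_annulus[OF a]] by (simp add: wp_quotient_def)
  thus ?thesis using main[OF b] by simp
qed

text \<open>For \<open>a\<close> on the unit circle and \<open>b\<close> arbitrary, both values are compared with the value at an interior point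
  \<open>x\<close>. The relation between the three theta quotients holds when \<open>a\<close> is replaced by interior points, and it
  persists in the limit because theta is continuous.\<close>
theorem wp_diff:
  assumes b: "admissible b" and a: "norm q < norm a" "norm a \<le> 1" "a \<noteq> 1"
  shows "wp b q - wp a q = wp_quotient a b"
proof -
  have adm: "admissible a"
    using admissible_annulus[of a] admissible_circle[of a] a by fastforce
  obtain x :: complex where x: "norm q < norm x" "norm x < 1"
  proof
    have "\<bar>(1 + norm q) / 2\<bar> = (1 + norm q) / 2" by (rule abs_of_nonneg) simp
    thus "norm q < norm (complex_of_real ((1 + norm q) / 2))" "norm (complex_of_real ((1 + norm q) / 2)) < 1"
      unfolding norm_of_real using q1 by simp_all
  qed
  obtain s :: "nat \<Rightarrow> complex" where s: "s \<longlonglongrightarrow> a" "\<And>n. norm q < norm (s n)" "\<And>n. norm (s n) < 1"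
    by (rule approach_seq[OF a(1,2)]) blast
  have nz: "a \<noteq> 0" "b \<noteq> 0" "x \<noteq> 0" using a b x by (auto simp: admissible_def)
  have th: "theta a q \<noteq> 0" "theta b q \<noteq> 0" "theta x q \<noteq> 0"
    using b adm admissible_annulus[OF x] theta_admissible by blast+
  have eq: "wp_quotient (s n) b = wp_quotient x b - wp_quotient x (s n)" for n
    unfolding wp_diff_interior[OF b s(2,3)[of n], symmetric] wp_diff_interior[OF b x, symmetric]
      wp_diff_interior[OF admissible_annulus[OF s(2,3)[of n]] x, symmetric] by simp
  note tend = tendsto_intros s(1) isCont_tendsto_compose[OF isCont_theta[OF q1]]
  have "(\<lambda>n. wp_quotient (s n) b) \<longlonglongrightarrow> wp_quotient a b"
    unfolding wp_quotient_def by (intro tend) (use nz th in auto)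
  hence "(\<lambda>n. wp_quotient x b - wp_quotient x (s n)) \<longlonglongrightarrow> wp_quotient a b"
    by (simp only: eq)
  moreover have "(\<lambda>n. wp_quotient x b - wp_quotient x (s n)) \<longlonglongrightarrow> wp_quotient x b - wp_quotient x a"
    unfolding wp_quotient_def by (intro tend) (use nz th in auto)
  ultimately have "wp_quotient a b = wp_quotient x b - wp_quotient x a"
    by (rule LIMSEQ_unique)
  thus ?thesis
    unfolding wp_diff_interior[OF b x, symmetric] wp_diff_interior[OF adm x, symmetric] by simp
qed

end

section \<open>Theta values as eta quotients\<close>

definition euler :: "complex \<Rightarrow> complex" where "euler q = qpoch q q"

context theta_base
begin

lemma theta_base_power: "n > 0 \<Longrightarrow> theta_base (q ^ n)"
  by unfold_locales (use q1 q0 in \<open>auto intro: norm_power_less_1\<close>)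

lemma euler_nonzero [simp]: "n > 0 \<Longrightarrow> euler (q ^ n) \<noteq> 0"
  unfolding euler_def by (intro qpoch_nonzero' norm_power_less_1 q1)

lemma euler_q_nonzero [simp]: "euler q \<noteq> 0"
  using euler_nonzero[of 1] by simp

lemma qpoch_dissect_2: "qpoch w q = qpoch w (q^2) * qpoch (w * q) (q^2)"
  using qpoch_dissect[OF q1, of 2 w] by (simp add: numeral_2_eq_2 lessThan_Suc mult_ac)

lemma qpoch_dissect_3: "qpoch w q = qpoch w (q^3) * qpoch (w * q) (q^3) * qpoch (w * q^2) (q^3)"
  using qpoch_dissect[OF q1, of 3 w] by (simp add: numeral_3_eq_3 numeral_2_eq_2 lessThan_Suc mult_ac)

lemma theta_mult_minus:
  "w \<noteq> 0 \<Longrightarrow> theta w q * theta (-w) q = theta (w^2) (q^2) * euler q ^ 2 / euler (q^2)"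
proof -
  assume w: "w \<noteq> 0"
  have "qpoch w q * qpoch (-w) q = qpoch (w^2) (q^2)" "qpoch (q / w) q * qpoch (-(q / w)) q = qpoch ((q / w)^2) (q^2)"
    by (rule qpoch_minus[OF q1])+
  hence "theta w q * theta (-w) q = qpoch (w^2) (q^2) * qpoch ((q / w)^2) (q^2) * euler q ^ 2"
    by (simp add: theta_def euler_def power2_eq_square mult_ac)
  thus ?thesis using euler_nonzero[of 2] by (simp add: theta_def euler_def power_divide)
qed

lemma theta_mult_shift:
  "w \<noteq> 0 \<Longrightarrow> theta w (q^2) * theta (w * q) (q^2) = theta w q * euler (q^2) ^ 2 / euler q"
proof -
  assume w: "w \<noteq> 0"
  have "qpoch w q = qpoch w (q^2) * qpoch (w * q) (q^2)" "qpoch (q / w) q = qpoch (q / w) (q^2) * qpoch (q^2 / w) (q^2)"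
    using qpoch_dissect_2[of w] qpoch_dissect_2[of "q / w"] by (simp_all add: power2_eq_square)
  moreover have "q^2 / (w * q) = q / w" using q0 w by (simp add: power2_eq_square)
  ultimately show ?thesis using euler_q_nonzero by (simp add: theta_def euler_def power2_eq_square)
qed

lemma theta_mult_cube_roots:
  assumes w: "w \<noteq> 0" and c: "c^2 + c + 1 = 0"
  shows "theta w q * theta (c * w) q * theta (c^2 * w) q = theta (w^3) (q^3) * euler q ^ 3 / euler (q^3)"
proof -
  note c3 = cube_root_of_unity(1)[OF c] and c0 = cube_root_of_unity(2)[OF c]
  have inv: "q / (c * w) = c^2 * (q / w)" "q / (c^2 * w) = c * (q / w)"
    using c3 c0 w by (auto simp: field_simps eval_nat_numeral)
  have "theta w q * theta (c * w) q * theta (c^2 * w) q =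
     (qpoch w q * qpoch (c * w) q * qpoch (c^2 * w) q) *
     (qpoch (q / w) q * qpoch (c * (q / w)) q * qpoch (c^2 * (q / w)) q) * euler q ^ 3"
    unfolding theta_def inv euler_def by (simp add: power3_eq_cube mult_ac)
  also have "\<dots> = qpoch (w^3) (q^3) * qpoch ((q / w)^3) (q^3) * euler q ^ 3"
    unfolding qpoch_cube_roots[OF q1 c] ..
  finally show ?thesis using euler_nonzero[of 3] by (simp add: theta_def euler_def power_divide)
qed

lemma theta_minus_1: "theta (-1) q = 2 * euler (q^2) ^ 2 / euler q"
proof -
  have 1: "qpoch (-1) q = 2 * qpoch (-q) q" using qpoch_unfold[OF q1, of "-1"] by simp
  have "qpoch q q * qpoch (-q) q = euler (q^2)"
    using qpoch_minus[OF q1, of q] by (simp add: euler_def)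
  hence "qpoch (-q) q = euler (q^2) / euler q"
    using euler_q_nonzero by (simp add: eq_divide_eq mult.commute euler_def)
  hence "theta (-1) q = 2 * (euler (q^2) / euler q) * (euler (q^2) / euler q) * euler q"
    using 1 by (simp add: theta_def euler_def)
  thus ?thesis using euler_q_nonzero by (simp add: power2_eq_square[of "euler _"])
qed

lemma qpoch_q_q2: "qpoch q (q^2) = euler q / euler (q^2)"
  using qpoch_dissect_2[of q] euler_nonzero[of 2] by (simp add: euler_def power2_eq_square)

lemma theta_q_base_2: "theta q (q^2) = euler q ^ 2 / euler (q^2)"
proof -
  have "q^2 / q = q" using q0 by (simp add: power2_eq_square)
  thus ?thesis using qpoch_q_q2 euler_nonzero[of 2] unfolding theta_def euler_def[of "q^2", symmetric]
    by (simp add: power2_eq_square)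
qed

lemma theta_minus_q_base_2: "theta (-q) (q^2) = euler (q^2) ^ 5 / (euler q ^ 2 * euler (q^4) ^ 2)"
proof -
  interpret q2: theta_base "q^2" by (rule theta_base_power) simp
  have A: "theta q (q^2) * theta (-q) (q^2) = theta (q^2) (q^4) * euler (q^2) ^ 2 / euler (q^4)"
    using q2.theta_mult_minus[of q] q0 by (simp flip: power_mult)
  have B: "theta (q^2) (q^4) = euler (q^2) ^ 2 / euler (q^4)"
    using q2.theta_q_base_2 by (simp flip: power_mult)
  have "t = b ^ 5 / (a ^ 2 * c ^ 2)"
    if "a^2 / b * t = s * b^2 / c" "s = b^2 / c" "a \<noteq> 0" "b \<noteq> 0" "c \<noteq> 0" for a b c s t :: complex
    using that by (simp add: field_simps) (simp add: eval_nat_numeral mult_ac)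
  from this[OF A[unfolded theta_q_base_2] B] show ?thesis by simp
qed

text \<open>The factors \<open>(q; q\<^sup>3)\<close>, \<open>(q\<^sup>2; q\<^sup>3)\<close> and \<open>(q\<^sup>3; q\<^sup>3)\<close> together form \<open>(q; q)\<close> (Euler's pentagonal product).\<close>
lemma theta_q_base_3: "theta q (q^3) = euler q"
proof -
  have "q^3 / q = q^2" using q0 by (simp add: power2_eq_square power3_eq_cube)
  thus ?thesis using qpoch_dissect_3[of q] unfolding theta_def euler_def
    by (simp add: power2_eq_square power3_eq_cube mult_ac)
qed

lemma theta_q_base_4: "theta q (q^4) = euler q * euler (q^4) / euler (q^2)"
proof -
  interpret q2: theta_base "q^2" by (rule theta_base_power) simp
  have "q^4 / q = q * q^2" using q0 by (simp add: eval_nat_numeral)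
  moreover have "qpoch q (q^2) = qpoch q (q^4) * qpoch (q * q^2) (q^4)"
    using q2.qpoch_dissect_2[of q] by (simp flip: power_mult)
  ultimately have "theta q (q^4) = qpoch q (q^2) * euler (q^4)"
    by (simp add: theta_def euler_def)
  thus ?thesis by (simp add: qpoch_q_q2)
qed

lemma theta_q_base_6: "theta q (q^6) = euler q * euler (q^6) ^ 2 / (euler (q^2) * euler (q^3))"
proof -
  interpret q2: theta_base "q^2" by (rule theta_base_power) simp
  interpret q3: theta_base "q^3" by (rule theta_base_power) simp
  have "q^6 / q = q * (q^2)^2" "q * q^2 = q^3" using q0 by (simp_all add: eval_nat_numeral)
  moreover have "qpoch q (q^2) = qpoch q (q^6) * qpoch (q * q^2) (q^6) * qpoch (q * (q^2)^2) (q^6)"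
    using q2.qpoch_dissect_3[of q] by (simp flip: power_mult)
  moreover have "qpoch (q^3) (q^6) = euler (q^3) / euler (q^6)"
    using q3.qpoch_q_q2 by (simp flip: power_mult)
  ultimately have "euler q / euler (q^2) = theta q (q^6) * euler (q^3) / euler (q^6) ^ 2"
    using qpoch_q_q2 euler_nonzero[of 6] by (simp add: theta_def euler_def power2_eq_square mult_ac)
  thus ?thesis using euler_nonzero[of 6] euler_nonzero[of 2] euler_nonzero[of 3] by (simp add: field_simps)
qed

lemma theta_cube_root:
  assumes c: "c^2 + c + 1 = 0"
  shows "theta c q = (1 - c) * euler (q^3)"
proof -
  note c3 = cube_root_of_unity(1)[OF c]
  have "c \<noteq> 0" by (rule cube_root_of_unity[OF c])
  moreover have "c^2 * q * c = c^3 * q" by (simp add: eval_nat_numeral mult_ac)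
  ultimately have "q / c = c^2 * q" using c3 by (simp add: nonzero_divide_eq_eq)
  thus ?thesis
    using qpoch_cube_roots[OF q1 c, of q] qpoch_unfold[OF q1, of c]
    by (simp add: theta_def euler_def mult_ac)
qed

text \<open>Up to a power of \<open>q\<close>, \<open>e n\<close> is \<open>\<eta>(n z)\<close>, and a product of powers of the \<open>e n\<close> is an eta quotient. Two eta
  quotients are compared below after abstracting the \<open>e n\<close> to variables: unless a proof says otherwise, \<open>a\<close>,
  \<open>b\<close>, \<open>c\<close>, \<open>d\<close>, \<open>f\<close>, \<open>g\<close> stand for \<open>e 1\<close>, \<open>e 2\<close>, \<open>e 3\<close>, \<open>e 4\<close>, \<open>e 6\<close>, \<open>e 12\<close>.\<close>
abbreviation e :: "nat \<Rightarrow> complex" where "e n \<equiv> euler (q ^ n)"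

lemma theta_values_4:
  "theta (q^2) (q^4) = e 2 ^ 2 / e 4"
  "theta (- (q^2)) (q^4) = e 4 ^ 5 / (e 2 ^ 2 * e 8 ^ 2)"
  "theta (-1) (q^4) = 2 * e 8 ^ 2 / e 4"
proof -
  interpret q2: theta_base "q^2" by (rule theta_base_power) simp
  interpret q4: theta_base "q^4" by (rule theta_base_power) simp
  show "theta (q^2) (q^4) = e 2 ^ 2 / e 4"
    using q2.theta_q_base_2 by (simp flip: power_mult)
  show "theta (- (q^2)) (q^4) = e 4 ^ 5 / (e 2 ^ 2 * e 8 ^ 2)"
    using q2.theta_minus_q_base_2 by (simp flip: power_mult)
  show "theta (-1) (q^4) = 2 * e 8 ^ 2 / e 4"
    using q4.theta_minus_1 by (simp flip: power_mult)
qed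

lemma theta_values_6:
  "theta (q^3) (q^6) = e 3 ^ 2 / e 6"
  "theta (- (q^3)) (q^6) = e 6 ^ 5 / (e 3 ^ 2 * e 12 ^ 2)"
  "theta (-1) (q^6) = 2 * e 12 ^ 2 / e 6"
  "theta q (q^6) = e 1 * e 6 ^ 2 / (e 2 * e 3)"
  "theta (q^2) (q^6) = e 2"
  "theta (-q) (q^6) = e 2 ^ 2 * e 3 * e 12 / (e 1 * e 4 * e 6)"
  "theta (- (q^2)) (q^6) = e 4 * e 6 ^ 2 / (e 2 * e 12)"
proof -
  interpret q2: theta_base "q^2" by (rule theta_base_power) simp
  interpret q3: theta_base "q^3" by (rule theta_base_power) simp
  interpret q4: theta_base "q^4" by (rule theta_base_power) simp
  interpret q6: theta_base "q^6" by (rule theta_base_power) simp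
  note [simp] = q0
  show "theta (q^3) (q^6) = e 3 ^ 2 / e 6"
    using q3.theta_q_base_2 by (simp flip: power_mult)
  show "theta (- (q^3)) (q^6) = e 6 ^ 5 / (e 3 ^ 2 * e 12 ^ 2)"
    using q3.theta_minus_q_base_2 by (simp flip: power_mult)
  show "theta (-1) (q^6) = 2 * e 12 ^ 2 / e 6"
    using q6.theta_minus_1 by (simp flip: power_mult)
  show q: "theta q (q^6) = e 1 * e 6 ^ 2 / (e 2 * e 3)"
    using theta_q_base_6 by simp
  show q2: "theta (q^2) (q^6) = e 2"
    using q2.theta_q_base_3 by (simp flip: power_mult)
  have "theta (q^2) (q^12) = e 2 * e 12 ^ 2 / (e 4 * e 6)"
    using q2.theta_q_base_6 by (simp flip: power_mult)
  moreover have "theta q (q^6) * theta (-q) (q^6) = theta (q^2) (q^12) * e 6 ^ 2 / e 12"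
    using q6.theta_mult_minus[of q] by (simp flip: power_mult)
  moreover have "t = b ^ 2 * c * g / (a * d * f)"
    if "a * f^2 / (b * c) * t = s * f^2 / g" "s = b * g^2 / (d * f)"
      "a \<noteq> 0" "b \<noteq> 0" "c \<noteq> 0" "d \<noteq> 0" "f \<noteq> 0" "g \<noteq> 0" for a b c d f g s t :: complex
    using that by (simp add: field_simps) (simp add: eval_nat_numeral mult_ac)
  ultimately show "theta (-q) (q^6) = e 2 ^ 2 * e 3 * e 12 / (e 1 * e 4 * e 6)"
    unfolding q by (metis euler_nonzero zero_less_numeral zero_less_one)
  have "theta (q^4) (q^12) = e 4"
    using q4.theta_q_base_3 by (simp flip: power_mult)
  moreover have "theta (q^2) (q^6) * theta (- (q^2)) (q^6) = theta (q^4) (q^12) * e 6 ^ 2 / e 12"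
    using q6.theta_mult_minus[of "q^2"] by (simp flip: power_mult)
  ultimately show "theta (- (q^2)) (q^6) = e 4 * e 6 ^ 2 / (e 2 * e 12)"
    unfolding q2 by (simp add: field_simps)
qed

end

section \<open>Squares of Ramanujan's theta function\<close>

lemma infsum_int_residues:
  fixes f :: "int \<Rightarrow> complex"
  assumes f: "f summable_on UNIV" and N: "N > 0"
  shows "infsum f UNIV = (\<Sum>r\<in>{0..<N}. \<Sum>\<^sub>\<infinity>n. f (N * n + r))"
proof -
  have bij: "bij_betw (\<lambda>(r, n). N * n + r) ({0..<N} \<times> UNIV) UNIV"
    by (rule bij_betwI[of _ _ _ "\<lambda>m. (m mod N, m div N)"]) (use N in auto)
  have "(\<lambda>x. f (case x of (r, n) \<Rightarrow> N * n + r)) summable_on {0..<N} \<times> UNIV"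
    using summable_on_reindex_bij_betw[OF bij, of f] f by simp
  hence s: "(\<lambda>(r, n). f (N * n + r)) summable_on {0..<N} \<times> UNIV"
    by (simp add: case_prod_unfold)
  have "infsum f UNIV = infsum (\<lambda>(r, n). f (N * n + r)) ({0..<N} \<times> UNIV)"
    using infsum_reindex_bij_betw[OF bij, of f] by (simp add: case_prod_unfold)
  also have "\<dots> = (\<Sum>r\<in>{0..<N}. \<Sum>\<^sub>\<infinity>n. f (N * n + r))"
    using infsum_Sigma'_banach[OF s] by simp
  finally show ?thesis .
qed

lemma infsum_int_reflect: "infsum (\<lambda>n::int. f (k - n)) UNIV = infsum f UNIV"
  by (rule infsum_reindex_bij_witness[of _ "\<lambda>n. k - n" "\<lambda>n. k - n"]) auto

text \<open>The theta function as a function of the nome, so that it can be evaluated at \<open>- q\<close>.\<close>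
definition phiq :: "complex \<Rightarrow> complex" where
  "phiq q = (\<Sum>\<^sub>\<infinity>n::int. q powi (n ^ 2))"

definition two_squares_term :: "complex \<Rightarrow> int \<Rightarrow> complex" where
  "two_squares_term q m = q powi m / (1 + q powi (2 * m))"

lemma two_squares_term_power: "two_squares_term (q ^ k) m = two_squares_term q (int k * m)"
  by (simp add: two_squares_term_def power_int_power mult_ac)

context theta_base
begin

lemma norm_powers:
  assumes "0 < k" "k < n"
  shows "norm (q ^ n) < norm (q ^ k)" "norm (q ^ k) < 1"
  using assms q1 q0 by (auto simp: norm_power power_strict_decreasing power_less_one_iff)

lemma power_admissible:
  assumes "0 < k" "k < n"
  shows "theta_base.admissible (q ^ n) (q ^ k)" "theta_base.admissible (q ^ n) (- (q ^ k))"
proof -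
  interpret qn: theta_base "q ^ n" by (rule theta_base_power) (use assms in auto)
  show "qn.admissible (q ^ k)" "qn.admissible (- (q ^ k))"
    using norm_powers[OF assms] by (auto intro!: qn.admissible_annulus)
qed

lemma minus_1_admissible: "n > 0 \<Longrightarrow> theta_base.admissible (q ^ n) (-1)"
  using theta_base.admissible_circle[OF theta_base_power, of n "-1"] by simp

lemma phiq_eq_theta: "phiq q = theta (-q) (q^2)"
proof -
  interpret q2: theta_base "q^2" by (rule theta_base_power) simp
  have "q powi (n^2) = theta_term (-q) (q^2) n" for n
  proof -
    have "n ^ 2 = n + 2 * tri n" unfolding two_tri by (simp add: algebra_simps power2_eq_square)
    hence "q powi (n^2) = q powi n * q powi (2 * tri n)" using q0 by (simp add: power_int_add)
    thus ?thesis by (simp add: power_int_mult)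
  qed
  thus ?thesis
    unfolding phiq_def using jacobi_triple_product[OF q2.q1 q2.q0, of "-q"] q0 by simp
qed

lemma phiq_eta: "phiq q = e 2 ^ 5 / (e 1 ^ 2 * e 4 ^ 2)"
  using phiq_eq_theta theta_minus_q_base_2 by simp

lemma two_squares_term_kronecker: "two_squares_term q m = q powi m * kcoeff (-1) (q^2) m"
  by (simp add: two_squares_term_def kcoeff_def power_int_mult)

lemma two_squares_term_abs_summable: "(\<lambda>m. norm (two_squares_term q m)) summable_on UNIV"
  unfolding two_squares_term_kronecker
  using theta_base.kronecker_abs_summable[OF theta_base_power minus_1_admissible, of 2 q] norm_powers[of 1 2]
  by simp

lemma two_squares_term_summable: "two_squares_term q summable_on UNIV"
  by (rule abs_summable_summable[OF two_squares_term_abs_summable])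

lemma two_squares_term_even: "two_squares_term q (- m) = two_squares_term q m"
proof -
  have "q powi (2 * m) = (q powi m)^2" "q powi (2 * (-m)) = inverse (q powi m)^2"
    by (simp_all add: power_int_minus mult.commute[of 2] power_int_mult power_inverse)
  thus ?thesis using q0 by (simp add: two_squares_term_def power_int_minus divide_simps power2_eq_square add.commute)
qed

text \<open>The theorem on sums of two squares: the right-hand side is Kronecker's series at \<open>a = q\<close>, \<open>b = -1\<close> with base
  \<open>q\<^sup>2\<close>, and its product form agrees with the square of the eta quotient of \<open>phiq q\<close>.\<close>
lemma phiq_square: "phiq q ^ 2 = 2 * (\<Sum>\<^sub>\<infinity>m. two_squares_term q m)"
proof -
  interpret q2: theta_base "q^2" by (rule theta_base_power) simp
  have "(\<Sum>\<^sub>\<infinity>m. two_squares_term q m) = kronecker_series q (-1) (q^2)"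
    by (simp add: kronecker_series_def two_squares_term_kronecker)
  also have "\<dots> = e 2 ^ 3 * phiq q / (theta q (q^2) * theta (-1) (q^2))"
    using q2.kronecker_product[OF minus_1_admissible[of 2], of q] norm_powers[of 1 2]
    by (simp add: phiq_eq_theta euler_def)
  also have "theta (-1) (q^2) = 2 * e 4 ^ 2 / e 2"
    using q2.theta_minus_1 by (simp flip: power_mult)
  also have "e 2 ^ 3 * phiq q / (theta q (q^2) * (2 * e 4 ^ 2 / e 2)) = (1 / 2) * (e 2 ^ 5 / (e 1 ^ 2 * e 4 ^ 2)) * phiq q"
  proof -
    have "b ^ 3 * p / (a^2 / b * (2 * c^2 / b)) = (1 / 2) * (b ^ 5 / (a^2 * c^2)) * p"
      if "a \<noteq> 0" "b \<noteq> 0" "c \<noteq> 0" for a b c p :: complex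
      using that by (simp add: field_simps) (simp add: eval_nat_numeral)
    thus ?thesis unfolding theta_q_base_2 by simp
  qed
  also have "e 2 ^ 5 / (e 1 ^ 2 * e 4 ^ 2) = phiq q"
    by (rule phiq_eta[symmetric])
  finally show ?thesis by (simp add: power2_eq_square mult_ac)
qed

lemma minus_theta_base: "theta_base (-q)"
  by unfold_locales (use q1 q0 in auto)

text \<open>Even indices in \<open>phiq_square\<close> give the series for \<open>q\<^sup>2\<close>; odd indices change sign with \<open>q\<close> and form a
  Kronecker series with base \<open>q\<^sup>4\<close>.\<close>
lemma phiq_square_even_part: "phiq q ^ 2 + phiq (-q) ^ 2 = 2 * phiq (q^2) ^ 2"
  and phiq_square_odd_part: "phiq q ^ 2 - phiq (-q) ^ 2 = 8 * q * e 8 ^ 4 / e 4 ^ 2"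
proof -
  interpret m: theta_base "-q" by (rule minus_theta_base)
  interpret q2: theta_base "q^2" by (rule theta_base_power) simp
  interpret q4: theta_base "q^4" by (rule theta_base_power) simp
  have ev: "(\<Sum>\<^sub>\<infinity>n. two_squares_term q (2 * n)) = phiq (q^2) ^ 2 / 2"
    unfolding q2.phiq_square two_squares_term_power by simp
  have set2: "{0..<2::int} = {0, 1}" by auto
  have 1: "phiq q ^ 2 = 2 * ((\<Sum>\<^sub>\<infinity>n. two_squares_term q (2 * n)) + (\<Sum>\<^sub>\<infinity>n. two_squares_term q (2 * n + 1)))"
    unfolding phiq_square infsum_int_residues[OF two_squares_term_summable, of 2, simplified] set2 by simp
  have "two_squares_term (-q) (2 * n) = two_squares_term q (2 * n)" "two_squares_term (-q) (2 * n + 1) = - two_squares_term q (2 * n + 1)" for n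
    by (simp_all add: two_squares_term_def power_int_minus_left)
  hence 2: "phiq (-q) ^ 2 = 2 * ((\<Sum>\<^sub>\<infinity>n. two_squares_term q (2 * n)) - (\<Sum>\<^sub>\<infinity>n. two_squares_term q (2 * n + 1)))"
    unfolding m.phiq_square infsum_int_residues[OF m.two_squares_term_summable, of 2, simplified] set2 
    by (simp add: infsum_uminus)
  show "phiq q ^ 2 + phiq (-q) ^ 2 = 2 * phiq (q^2) ^ 2"
    unfolding 1 2 using ev by (simp add: field_simps)
  have "two_squares_term q (2 * n + 1) = q * ((q^2) powi n * kcoeff (-(q^2)) (q^4) n)" for n
  proof -
    have "q powi (2 * (2 * n + 1)) = q^2 * (q^4) powi n"
    proof -
      have "2 * (2 * n + 1) = 2 + 4 * n" by simp
      hence "q powi (2 * (2 * n + 1)) = q powi 2 * q powi (4 * n)" using q0 by (metis power_int_add)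
      thus ?thesis by (simp add: power_int_power)
    qed
    moreover have "q powi (2 * n + 1) = q * (q^2) powi n"
      using q0 by (simp add: power_int_add power_int_power)
    ultimately show ?thesis by (simp add: two_squares_term_def kcoeff_def)
  qed
  hence "(\<Sum>\<^sub>\<infinity>n. two_squares_term q (2 * n + 1)) = q * kronecker_series (q^2) (-(q^2)) (q^4)"
    by (simp add: kronecker_series_def infsum_cmult_right')
  also have "kronecker_series (q^2) (-(q^2)) (q^4) = e 4 ^ 3 * theta (-(q^4)) (q^4) / (theta (q^2) (q^4) * theta (-(q^2)) (q^4))"
    using q4.kronecker_product[OF power_admissible(2)[of 2 4], of "q^2"] norm_powers[of 2 4]
    by (simp add: euler_def flip: power_add)
  also have "theta (-(q^4)) (q^4) = theta (-1) (q^4)"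
    using theta_reflect[of "-1" "q^4"] q0 by simp
  also have "q * (e 4 ^ 3 * theta (-1) (q^4) / (theta (q^2) (q^4) * theta (-(q^2)) (q^4))) = 2 * q * e 8 ^ 4 / e 4 ^ 2"
  proof -
    have "q * (b^3 * (2 * c^2 / b) / (a^2 / b * (b^5 / (a^2 * c^2)))) = 2 * q * c^4 / b^2"
      if "a \<noteq> 0" "b \<noteq> 0" "c \<noteq> 0" for a b c :: complex
      using that by (simp add: field_simps)
    note * = this
    show ?thesis unfolding theta_values_4 by (rule *) simp_all
  qed
  finally have "(\<Sum>\<^sub>\<infinity>n. two_squares_term q (2 * n + 1)) = 2 * q * e 8 ^ 4 / e 4 ^ 2" .
  thus "phiq q ^ 2 - phiq (-q) ^ 2 = 8 * q * e 8 ^ 4 / e 4 ^ 2"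
    unfolding 1 2 by simp
qed

text \<open>The multiples of 3 in \<open>phiq_square\<close> account for \<open>phiq (q^3) ^ 2\<close>. The other two residue classes are
  exchanged by \<open>m \<mapsto> - m\<close>, and each is a Kronecker series with base \<open>q\<^sup>6\<close>.\<close>
lemma phiq_square_diff_3:
  "phiq q ^ 2 - phiq (q^3) ^ 2 = 4 * q * e 2 ^ 3 * e 6 * e 12 ^ 2 / (e 1 * e 3 * e 4 ^ 2)"
proof -
  interpret q3: theta_base "q^3" by (rule theta_base_power) simp
  interpret q6: theta_base "q^6" by (rule theta_base_power) simp
  have ev: "(\<Sum>\<^sub>\<infinity>n. two_squares_term q (3 * n)) = phiq (q^3) ^ 2 / 2"
    unfolding q3.phiq_square two_squares_term_power by simp
  have set3: "{0..<3::int} = {0, 1, 2}" by auto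
  have "(\<Sum>\<^sub>\<infinity>n. two_squares_term q (3 * n + 2)) = (\<Sum>\<^sub>\<infinity>n. two_squares_term q (3 * (-1 - n) + 2))"
    by (rule infsum_int_reflect[symmetric])
  also have "\<dots> = (\<Sum>\<^sub>\<infinity>n. two_squares_term q (3 * n + 1))"
  proof (intro infsum_cong)
    fix n :: int
    have "3 * (-1 - n) + 2 = - (3 * n + 1)" by simp
    thus "two_squares_term q (3 * (-1 - n) + 2) = two_squares_term q (3 * n + 1)" by (simp only: two_squares_term_even)
  qed
  finally have 1: "phiq q ^ 2 = 2 * ((\<Sum>\<^sub>\<infinity>n. two_squares_term q (3 * n)) + 2 * (\<Sum>\<^sub>\<infinity>n. two_squares_term q (3 * n + 1)))"
    unfolding phiq_square infsum_int_residues[OF two_squares_term_summable, of 3, simplified] set3 by simp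
  have "two_squares_term q (3 * n + 1) = q * ((q^3) powi n * kcoeff (-(q^2)) (q^6) n)" for n
  proof -
    have "q powi (2 * (3 * n + 1)) = q^2 * (q^6) powi n"
    proof -
      have "2 * (3 * n + 1) = 2 + 6 * n" by simp
      hence "q powi (2 * (3 * n + 1)) = q powi 2 * q powi (6 * n)" using q0 by (metis power_int_add)
      thus ?thesis by (simp add: power_int_power)
    qed
    moreover have "q powi (3 * n + 1) = q * (q^3) powi n"
      using q0 by (simp add: power_int_add power_int_power)
    ultimately show ?thesis by (simp add: two_squares_term_def kcoeff_def)
  qed
  hence "(\<Sum>\<^sub>\<infinity>n. two_squares_term q (3 * n + 1)) = q * kronecker_series (q^3) (-(q^2)) (q^6)"
    by (simp add: kronecker_series_def infsum_cmult_right')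
  also have "kronecker_series (q^3) (-(q^2)) (q^6) = e 6 ^ 3 * theta (-(q^5)) (q^6) / (theta (q^3) (q^6) * theta (-(q^2)) (q^6))"
    using q6.kronecker_product[OF power_admissible(2)[of 2 6], of "q^3"] norm_powers[of 3 6]
    by (simp add: euler_def flip: power_add)
  also have "theta (-(q^5)) (q^6) = theta (-q) (q^6)"
    using theta_reflect[of "-q" "q^6"] q0 by (simp add: eval_nat_numeral)
  also have "q * (e 6 ^ 3 * theta (-q) (q^6) / (theta (q^3) (q^6) * theta (-(q^2)) (q^6))) =
      q * e 2 ^ 3 * e 6 * e 12 ^ 2 / (e 1 * e 3 * e 4 ^ 2)"
  proof -
    have "q * (f^3 * (b^2 * c * g / (a * d * f)) / (c^2 / f * (d * f^2 / (b * g)))) = q * b^3 * f * g^2 / (a * c * d^2)"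
      if "a \<noteq> 0" "b \<noteq> 0" "c \<noteq> 0" "d \<noteq> 0" "f \<noteq> 0" "g \<noteq> 0" for a b c d f g :: complex
      using that by (simp add: field_simps) (simp add: eval_nat_numeral)
    note * = this
    show ?thesis unfolding theta_values_6 by (rule *) simp_all
  qed
  finally have S1: "(\<Sum>\<^sub>\<infinity>n. two_squares_term q (3 * n + 1)) = q * e 2 ^ 3 * e 6 * e 12 ^ 2 / (e 1 * e 3 * e 4 ^ 2)" .
  show ?thesis unfolding 1 S1 ev by simp
qed

text \<open>Adding the two series of \<open>phiq_square\<close> term by term gives twice a Kronecker series with base \<open>q\<^sup>6\<close>.\<close>
lemma phiq_square_sum_3:
  "phiq q ^ 2 + phiq (q^3) ^ 2 = 2 * e 2 ^ 3 * e 3 ^ 2 * e 6 / (e 1 ^ 2 * e 4 * e 12)"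
proof -
  interpret q3: theta_base "q^3" by (rule theta_base_power) simp
  interpret q6: theta_base "q^6" by (rule theta_base_power) simp
  let ?f = "\<lambda>m. q powi m * kcoeff (-1) (q^6) m"
  have "(\<lambda>m. norm (?f m)) summable_on UNIV"
    using q6.kronecker_abs_summable[OF minus_1_admissible[of 6], of q] norm_powers[of 1 6] by simp
  hence s: "?f summable_on UNIV"
    by (rule abs_summable_summable)
  have s': "(\<lambda>m. ?f (- m)) summable_on UNIV"
    using summable_on_reindex_bij_witness[of UNIV "\<lambda>m. - m" "\<lambda>m. - m" UNIV ?f "\<lambda>m. ?f (-m)"] s by simp
  \<comment> \<open>With \<open>x = q powi m\<close> this is \<open>x / (1 + x\<^sup>2) + x\<^sup>3 / (1 + x\<^sup>6) = (x + x\<^sup>5) / (1 + x\<^sup>6)\<close>;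
    the term \<open>x\<^sup>5 / (1 + x\<^sup>6)\<close> is the reflection of \<open>x / (1 + x\<^sup>6)\<close> under \<open>x \<mapsto> 1 / x\<close>.\<close>
  have pt: "two_squares_term q m + two_squares_term (q^3) m = ?f m + ?f (- m)" for m
  proof -
    define x where "x = q powi m"
    have x0: "x \<noteq> 0" using q0 by (simp add: x_def)
    have p: "q powi (2 * m) = x^2" "(q^3) powi m = x^3" "(q^3) powi (2 * m) = x^6" "(q^6) powi m = x^6"
      "q powi (-m) = 1 / x" "(q^6) powi (-m) = 1 / x^6"
      by (simp_all add: x_def power_int_minus divide_inverse power_int_power power_int_power' mult_ac)
    have nz: "1 + x^6 \<noteq> 0"
      using q6.admissible_denom[OF minus_1_admissible[of 6], of m] p by simp
    have "1 + x^6 = (1 + x^2) * (1 - x^2 + x^4)" by (simp add: eval_nat_numeral algebra_simps)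
    hence nz2: "1 + x^2 \<noteq> 0" using nz by auto
    have "x / (1 + x^2) = (x - x^3 + x^5) / (1 + x^6)"
      using nz nz2 by (simp add: frac_eq_eq) (simp add: eval_nat_numeral algebra_simps)
    moreover have "(1 / x) * (1 / (1 + 1 / x^6)) = x^5 / (1 + x^6)"
      using nz x0 by (simp add: divide_simps add.commute) (simp add: eval_nat_numeral algebra_simps)
    ultimately show ?thesis
      unfolding two_squares_term_def kcoeff_def p x_def[symmetric] by (simp add: add_divide_distrib diff_divide_distrib)
  qed
  have "phiq q ^ 2 + phiq (q^3) ^ 2 = 2 * ((\<Sum>\<^sub>\<infinity>m. two_squares_term q m) + (\<Sum>\<^sub>\<infinity>m. two_squares_term (q^3) m))"
    unfolding phiq_square q3.phiq_square by simp
  also have "(\<Sum>\<^sub>\<infinity>m. two_squares_term q m) + (\<Sum>\<^sub>\<infinity>m. two_squares_term (q^3) m) = (\<Sum>\<^sub>\<infinity>m. ?f m + ?f (- m))"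
    unfolding pt[symmetric] by (intro infsum_add[symmetric] two_squares_term_summable q3.two_squares_term_summable)
  also have "\<dots> = (\<Sum>\<^sub>\<infinity>m. ?f m) + (\<Sum>\<^sub>\<infinity>m. ?f (- m))"
    by (intro infsum_add s s')
  also have "(\<Sum>\<^sub>\<infinity>m. ?f (- m)) = (\<Sum>\<^sub>\<infinity>m. ?f m)"
    using infsum_int_reflect[of ?f 0] by simp
  also have "(\<Sum>\<^sub>\<infinity>m. ?f m) = kronecker_series q (-1) (q^6)"
    by (simp add: kronecker_series_def)
  also have "\<dots> = e 6 ^ 3 * theta (-q) (q^6) / (theta q (q^6) * theta (-1) (q^6))"
    using q6.kronecker_product[OF minus_1_admissible[of 6], of q] norm_powers[of 1 6]
    by (simp add: euler_def)
  also have "\<dots> = e 2 ^ 3 * e 3 ^ 2 * e 6 / (2 * e 1 ^ 2 * e 4 * e 12)"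
  proof -
    have "f^3 * (b^2 * c * g / (a * d * f)) / (a * f^2 / (b * c) * (2 * g^2 / f)) = b^3 * c^2 * f / (2 * a^2 * d * g)"
      if "a \<noteq> 0" "b \<noteq> 0" "c \<noteq> 0" "d \<noteq> 0" "f \<noteq> 0" "g \<noteq> 0" for a b c d f g :: complex
      using that by (simp add: field_simps) (simp add: eval_nat_numeral)
    note * = this
    show ?thesis unfolding theta_values_6 by (rule *) simp_all
  qed
  finally show ?thesis by (simp add: field_simps)
qed

section \<open>Additive relations between eta quotients of level 12\<close>

lemma wp_diff_values:
  assumes "admissible b" "norm q < norm a" "norm a < 1" "a * b = x" "a / b = y"
  shows "wp b q - wp a q = b * euler q ^ 6 * theta x q * theta y q / (theta a q * theta b q) ^ 2"
  using wp_diff_interior[OF assms(1-3)] assms(4,5) by (simp add: wp_quotient_def euler_def)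

text \<open>The differences of the Weierstrass values with base \<open>q\<^sup>6\<close> at \<open>- q\<close>, \<open>q\<^sup>2\<close> and \<open>q\<^sup>3\<close> are eta quotients whose
  sum around the triangle is zero.\<close>
lemma eta_three_term_1:
  "e 3 ^ 3 * e 4 - q * e 1 * e 12 ^ 3 = e 1 * e 4 ^ 4 * e 6 ^ 2 / (e 2 ^ 2 * e 12)"
proof -
  interpret q6: theta_base "q^6" by (rule theta_base_power) simp
  have adm: "q6.admissible (-q)" "q6.admissible (q^2)" "q6.admissible (q^3)"
    using power_admissible[of 1 6] power_admissible[of 2 6] power_admissible[of 3 6] by simp_all
  define a b c d f g where "a = theta (-q) (q^6)" and "b = theta (q^2) (q^6)" and "c = theta (q^3) (q^6)"
    and "d = theta (-(q^2)) (q^6)" and "f = theta q (q^6)" and "g = theta (-(q^3)) (q^6)"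
  have nz: "a \<noteq> 0" "b \<noteq> 0" "c \<noteq> 0"
    unfolding a_def b_def c_def by (intro q6.theta_admissible adm)+
  have d: "theta (-(q^4)) (q^6) = d" and f: "theta (q^5) (q^6) = f"
    using theta_reflect[of "-(q^2)" "q^6"] theta_reflect[of q "q^6"] q0
    by (simp_all add: d_def f_def eval_nat_numeral)
  have R1: "wp (-q) (q^6) - wp (q^3) (q^6) = (-q) * e 6 ^ 6 * theta (-(q^4)) (q^6) * d / (c * a) ^ 2"
    unfolding a_def c_def d_def
    by (rule q6.wp_diff_values) (use adm norm_powers[of 3 6] q0 in \<open>auto simp: eval_nat_numeral\<close>)
  have R2: "wp (q^2) (q^6) - wp (q^3) (q^6) = q^2 * e 6 ^ 6 * theta (q^5) (q^6) * f / (c * b) ^ 2"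
    unfolding b_def c_def f_def
    by (rule q6.wp_diff_values) (use adm norm_powers[of 3 6] q0 in \<open>auto simp: eval_nat_numeral\<close>)
  have R3: "wp (-q) (q^6) - wp (q^2) (q^6) = (-q) * e 6 ^ 6 * g * a / (b * a) ^ 2"
    unfolding a_def b_def g_def
    by (rule q6.wp_diff_values) (use adm norm_powers[of 2 6] q0 in \<open>auto simp: eval_nat_numeral\<close>)
  have "(-q) * e 6 ^ 6 * d * d / (c * a) ^ 2 - q^2 * e 6 ^ 6 * f * f / (c * b) ^ 2 = (-q) * e 6 ^ 6 * g * a / (b * a) ^ 2"
    unfolding R1[unfolded d, symmetric] R2[unfolded f, symmetric] R3[symmetric] by simp
  moreover have "d^2 * b^2 + q * f^2 * a^2 = g * a * c^2"
    if "(-q) * x * d * d / (c * a) ^ 2 - q^2 * x * f * f / (c * b) ^ 2 = (-q) * x * g * a / (b * a) ^ 2" "x \<noteq> 0" for x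
  proof -
    have "(-q) * x * d * d / (c * a) ^ 2 - q^2 * x * f * f / (c * b) ^ 2 - (-q) * x * g * a / (b * a) ^ 2 =
      (-q) * x * (d^2 * b^2 + q * f^2 * a^2 - g * a * c^2) / (a * b * c)^2"
      using nz by (simp add: field_simps power2_eq_square)
    thus ?thesis using that q0 nz by simp
  qed
  ultimately have "d^2 * b^2 + q * f^2 * a^2 = g * a * c^2" by simp
  moreover have "c1^3 * d1 - q * a1 * g1^3 = a1 * d1^4 * f1^2 / (b1^2 * g1)"
    if "(d1 * f1^2 / (b1 * g1))^2 * b1^2 + q * (a1 * f1^2 / (b1 * c1))^2 * (b1^2 * c1 * g1 / (a1 * d1 * f1))^2 =
        (f1^5 / (c1^2 * g1^2)) * (b1^2 * c1 * g1 / (a1 * d1 * f1)) * (c1^2 / f1)^2"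
      "a1 \<noteq> 0" "b1 \<noteq> 0" "c1 \<noteq> 0" "d1 \<noteq> 0" "f1 \<noteq> 0" "g1 \<noteq> 0" for a1 b1 c1 d1 f1 g1 :: complex
  proof -
    have 1: "(d1 * f1^2 / (b1 * g1))^2 * b1^2 = (a1 * d1^4 * f1^2 / (b1^2 * g1)) * (b1^2 * f1^2 / (a1 * d1^2 * g1))"
      and 2: "q * (a1 * f1^2 / (b1 * c1))^2 * (b1^2 * c1 * g1 / (a1 * d1 * f1))^2 = (q * a1 * g1^3) * (b1^2 * f1^2 / (a1 * d1^2 * g1))"
      and 3: "(f1^5 / (c1^2 * g1^2)) * (b1^2 * c1 * g1 / (a1 * d1 * f1)) * (c1^2 / f1)^2 = (c1^3 * d1) * (b1^2 * f1^2 / (a1 * d1^2 * g1))"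
      using that(2-) by (simp_all add: divide_simps) (simp_all add: eval_nat_numeral)
    have "(a1 * d1^4 * f1^2 / (b1^2 * g1) + q * a1 * g1^3) * (b1^2 * f1^2 / (a1 * d1^2 * g1)) = (c1^3 * d1) * (b1^2 * f1^2 / (a1 * d1^2 * g1))"
      using that(1) unfolding 1 2 3 by (simp only: distrib_right)
    hence "a1 * d1^4 * f1^2 / (b1^2 * g1) + q * a1 * g1^3 = c1^3 * d1"
      using that(2-) by simp
    thus ?thesis by (simp add: algebra_simps)
  qed
  note * = this
  \<comment> \<open>\<open>a1\<close>, \<open>b1\<close>, \<open>c1\<close>, \<open>d1\<close>, \<open>f1\<close>, \<open>g1\<close> are \<open>e 1\<close>, \<open>e 2\<close>, \<open>e 3\<close>, \<open>e 4\<close>, \<open>e 6\<close>, \<open>e 12\<close>.\<close>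
  ultimately show ?thesis
    unfolding a_def b_def c_def d_def f_def g_def theta_values_6 by (intro *) simp_all
qed

text \<open>The same with the points \<open>-1\<close>, \<open>q\<close> and \<open>- q\<^sup>2\<close>.\<close>
lemma eta_three_term_4:
  "e 3 ^ 3 * e 4 - 4 * q * e 1 * e 12 ^ 3 = e 1 ^ 4 * e 4 * e 6 ^ 2 / (e 2 ^ 2 * e 3)"
proof -
  interpret q6: theta_base "q^6" by (rule theta_base_power) simp
  have adm: "q6.admissible (-1)" "q6.admissible q" "q6.admissible (-(q^2))"
    using minus_1_admissible[of 6] power_admissible[of 1 6] power_admissible[of 2 6] by simp_all
  define a b c d f g where "a = theta (-q) (q^6)" and "b = theta (q^2) (q^6)" and "c = theta (-1) (q^6)"
    and "d = theta (-(q^2)) (q^6)" and "f = theta q (q^6)" and "g = theta (-(q^3)) (q^6)"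
  have nz: "d \<noteq> 0" "f \<noteq> 0" "c \<noteq> 0"
    unfolding d_def f_def c_def by (intro q6.theta_admissible adm)+
  have R1: "wp (-1) (q^6) - wp q (q^6) = (-1) * e 6 ^ 6 * a * a / (f * c) ^ 2"
    unfolding a_def f_def c_def
    by (rule q6.wp_diff_values) (use adm norm_powers[of 1 6] q0 in auto)
  have R2: "wp (-1) (q^6) - wp (-(q^2)) (q^6) = (-1) * e 6 ^ 6 * b * b / (d * c) ^ 2"
    unfolding b_def d_def c_def
    by (rule q6.wp_diff_values) (use adm norm_powers[of 2 6] q0 in auto)
  have R3: "wp q (q^6) - wp (-(q^2)) (q^6) = q * e 6 ^ 6 * g * a / (d * f) ^ 2"
    unfolding a_def d_def f_def g_def
    by (rule q6.wp_diff_values) (use adm norm_powers[of 2 6] q0 in \<open>auto simp: eval_nat_numeral\<close>)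
  have "(-1) * e 6 ^ 6 * b * b / (d * c) ^ 2 - (-1) * e 6 ^ 6 * a * a / (f * c) ^ 2 = q * e 6 ^ 6 * g * a / (d * f) ^ 2"
    unfolding R1[symmetric] R2[symmetric] R3[symmetric] by simp
  moreover have "d^2 * a^2 - b^2 * f^2 = q * g * a * c^2"
    if "(-1) * x * b * b / (d * c) ^ 2 - (-1) * x * a * a / (f * c) ^ 2 = q * x * g * a / (d * f) ^ 2" "x \<noteq> 0" for x
  proof -
    have "(-1) * x * b * b / (d * c) ^ 2 - (-1) * x * a * a / (f * c) ^ 2 - q * x * g * a / (d * f) ^ 2 =
      x * (d^2 * a^2 - b^2 * f^2 - q * g * a * c^2) / (c * d * f)^2"
      using nz by (simp add: field_simps power2_eq_square)
    thus ?thesis using that nz by simp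
  qed
  ultimately have "d^2 * a^2 - b^2 * f^2 = q * g * a * c^2" by simp
  moreover have "c1^3 * d1 - 4 * q * a1 * g1^3 = a1^4 * d1 * f1^2 / (b1^2 * c1)"
    if "(d1 * f1^2 / (b1 * g1))^2 * (b1^2 * c1 * g1 / (a1 * d1 * f1))^2 - b1^2 * (a1 * f1^2 / (b1 * c1))^2 =
        q * (f1^5 / (c1^2 * g1^2)) * (b1^2 * c1 * g1 / (a1 * d1 * f1)) * (2 * g1^2 / f1)^2"
      "a1 \<noteq> 0" "b1 \<noteq> 0" "c1 \<noteq> 0" "d1 \<noteq> 0" "f1 \<noteq> 0" "g1 \<noteq> 0" for a1 b1 c1 d1 f1 g1 :: complex
  proof -
    have 1: "(d1 * f1^2 / (b1 * g1))^2 * (b1^2 * c1 * g1 / (a1 * d1 * f1))^2 = (c1^3 * d1) * (b1^2 * f1^2 / (a1^2 * c1 * d1))"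
      and 2: "b1^2 * (a1 * f1^2 / (b1 * c1))^2 = (a1^4 * d1 * f1^2 / (b1^2 * c1)) * (b1^2 * f1^2 / (a1^2 * c1 * d1))"
      and 3: "q * (f1^5 / (c1^2 * g1^2)) * (b1^2 * c1 * g1 / (a1 * d1 * f1)) * (2 * g1^2 / f1)^2 = (4 * q * a1 * g1^3) * (b1^2 * f1^2 / (a1^2 * c1 * d1))"
      using that(2-) by (simp_all add: divide_simps) (simp_all add: eval_nat_numeral)
    have "(c1^3 * d1 - a1^4 * d1 * f1^2 / (b1^2 * c1)) * (b1^2 * f1^2 / (a1^2 * c1 * d1)) = (4 * q * a1 * g1^3) * (b1^2 * f1^2 / (a1^2 * c1 * d1))"
      using that(1) unfolding 1 2 3 by (simp only: left_diff_distrib)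
    hence "c1^3 * d1 - a1^4 * d1 * f1^2 / (b1^2 * c1) = 4 * q * a1 * g1^3"
      using that(2-) by simp
    thus ?thesis by (simp add: algebra_simps)
  qed
  note * = this
  ultimately show ?thesis
    unfolding a_def b_def c_def d_def f_def g_def theta_values_6 by (intro *) simp_all
qed

section \<open>Torsion differences as eta quotients\<close>

text \<open>The values of theta at \<open>q\<close> and \<open>q\<^sup>5\<close> are not eta quotients, but their product is. The same pairing
  is used for \<open>\<plusminus> \<i> q\<close>, and for the products of \<open>q\<close> with the two primitive cube roots of unity.\<close>
lemma wp_diff_12:
  "wp q (q^12) - wp (q^5) (q^12) = q * e 2 ^ 2 * e 3 ^ 2 * e 4 * e 12 / e 1 ^ 2"
proof -
  interpret q4: theta_base "q^4" by (rule theta_base_power) simp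
  interpret q6: theta_base "q^6" by (rule theta_base_power) simp
  interpret q12: theta_base "q^12" by (rule theta_base_power) simp
  have t6: "theta (q^6) (q^12) = e 6 ^ 2 / e 12" using q6.theta_q_base_2 by (simp flip: power_mult)
  have t4: "theta (q^4) (q^12) = e 4" using q4.theta_q_base_3 by (simp flip: power_mult)
  have "theta (q * q^6) (q^12) = theta (q^5) (q^12)"
    using theta_reflect[of "q^5" "q^12"] q0 by (simp add: eval_nat_numeral)
  hence prod: "theta q (q^12) * theta (q^5) (q^12) = e 1 * e 6 * e 12 ^ 2 / (e 2 * e 3)"
    using q6.theta_mult_shift[of q] q0 theta_values_6(4)
    by (simp add: power2_eq_square[of "e 6"] flip: power_mult)
  have "wp q (q^12) - wp (q^5) (q^12) = q * e 12 ^ 6 * theta (q^6) (q^12) * theta (q^4) (q^12) / (theta (q^5) (q^12) * theta q (q^12)) ^ 2"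
    by (rule q12.wp_diff_values)
       (use power_admissible(1)[of 1 12] norm_powers[of 5 12] q0 in \<open>auto simp: eval_nat_numeral\<close>)
  also have "\<dots> = q * e 2 ^ 2 * e 3 ^ 2 * e 4 * e 12 / e 1 ^ 2"
  proof -
    have "q * g^6 * (f^2 / g) * d / (a * f * g^2 / (b * c))^2 = q * b^2 * c^2 * d * g / a^2"
      if "a \<noteq> 0" "b \<noteq> 0" "c \<noteq> 0" "d \<noteq> 0" "f \<noteq> 0" "g \<noteq> 0" for a b c d f g :: complex
      using that by (simp add: divide_simps) (simp add: eval_nat_numeral)
    note * = this
    show ?thesis unfolding mult.commute[of "theta (q^5) _"] prod t6 t4 by (rule *) simp_all
  qed
  finally show ?thesis .
qed

lemma wp_diff_i:
  "wp (\<i> * q) (q^3) - wp (- (\<i> * q)) (q^3) = 2 * \<i> * (q * e 1 * e 2 ^ 2 * e 3 * e 12 ^ 2 / e 4 ^ 2)"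
proof -
  interpret q3: theta_base "q^3" by (rule theta_base_power) simp
  have n: "norm (q^3) < norm (- (\<i> * q))" "norm (- (\<i> * q)) < 1" "norm (q^3) < norm (\<i> * q)" "norm (\<i> * q) < 1"
    using norm_powers[of 1 3] by (simp_all add: norm_mult)
  have t2: "theta (q^2) (q^3) = e 1"
    using theta_reflect[of q "q^3"] q0 theta_q_base_3 by (simp add: eval_nat_numeral)
  have tm: "theta (-1) (q^3) = 2 * e 6 ^ 2 / e 3" using q3.theta_minus_1 by (simp flip: power_mult)
  have "theta (\<i> * q) (q^3) * theta (- (\<i> * q)) (q^3) = theta (- (q^2)) (q^6) * e 3 ^ 2 / e 6"
    using q3.theta_mult_minus[of "\<i> * q"] q0 by (simp add: power_mult_distrib flip: power_mult)
  hence prod: "theta (- (\<i> * q)) (q^3) * theta (\<i> * q) (q^3) = e 3 ^ 2 * e 4 * e 6 / (e 2 * e 12)"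
    unfolding theta_values_6 by (simp add: power2_eq_square mult_ac)
  have "- (\<i> * q) * (\<i> * q) = - (\<i> * \<i>) * (q * q)" by (simp add: algebra_simps)
  hence m: "- (\<i> * q) * (\<i> * q) = q^2" "- (\<i> * q) / (\<i> * q) = -1"
    using q0 by (simp_all add: power2_eq_square)
  have "wp (\<i> * q) (q^3) - wp (- (\<i> * q)) (q^3) = \<i> * q * e 3 ^ 6 * theta (q^2) (q^3) * theta (-1) (q^3) / (theta (- (\<i> * q)) (q^3) * theta (\<i> * q) (q^3)) ^ 2"
    unfolding q3.wp_diff_interior[OF q3.admissible_annulus[OF n(3,4)] n(1,2)] q3.wp_quotient_def m euler_def ..
  also have "\<dots> = 2 * \<i> * (q * e 1 * e 2 ^ 2 * e 3 * e 12 ^ 2 / e 4 ^ 2)"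
  proof -
    have "\<i> * q * c^6 * a * (2 * f^2 / c) / (c^2 * d * f / (b * g))^2 = 2 * \<i> * (q * a * b^2 * c * g^2 / d^2)"
      if "a \<noteq> 0" "b \<noteq> 0" "c \<noteq> 0" "d \<noteq> 0" "f \<noteq> 0" "g \<noteq> 0" for a b c d f g :: complex
      using that by (simp add: divide_simps) (simp add: eval_nat_numeral)
    note * = this
    show ?thesis unfolding prod t2 tm by (rule *) simp_all
  qed
  finally show ?thesis .
qed

lemma wp_diff_cube_root:
  assumes w: "w^2 + w + 1 = 0"
  shows "wp (w * q) (q^4) - wp (w^2 * q) (q^4) = (w - w^2) * (q * e 1 ^ 2 * e 4 * e 6 ^ 2 * e 12 / e 3 ^ 2)"
proof -
  interpret q3: theta_base "q^3" by (rule theta_base_power) simp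
  interpret q4: theta_base "q^4" by (rule theta_base_power) simp
  note w3 = cube_root_of_unity(1)[OF w] and w0 = cube_root_of_unity(2)[OF w]
    and nw = cube_root_of_unity(3)[OF w]
  have n: "norm (q^4) < norm (w^2 * q)" "norm (w^2 * q) < 1" "norm (q^4) < norm (w * q)" "norm (w * q) < 1"
    using norm_powers[of 1 4] nw by (simp_all add: norm_mult norm_power)
  have tw: "theta w (q^4) = (1 - w) * e 12" using q4.theta_cube_root[OF w] by (simp flip: power_mult)
  have t3: "theta (q^3) (q^12) = e 3 * e 12 / e 6" using q3.theta_q_base_4 by (simp flip: power_mult)
  have cube: "theta q (q^4) * theta (w * q) (q^4) * theta (w^2 * q) (q^4) = theta (q^3) (q^12) * e 4 ^ 3 / e 12"
    using q4.theta_mult_cube_roots[OF q0 w] by (simp flip: power_mult)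
  have prod: "theta (w^2 * q) (q^4) * theta (w * q) (q^4) = e 2 * e 3 * e 4 ^ 2 / (e 1 * e 6)"
  proof -
    have "y * x = b * c * d^2 / (a * f)"
      if "a * d / b * x * y = c * g / f * d^3 / g"
        "a \<noteq> 0" "b \<noteq> 0" "c \<noteq> 0" "d \<noteq> 0" "f \<noteq> 0" "g \<noteq> 0" for a b c d f g x y :: complex
      using that by (simp add: field_simps) (simp add: eval_nat_numeral mult_ac)
    note * = this
    show ?thesis
      using *[OF cube[unfolded t3 theta_q_base_4]] by simp
  qed
  have "w^2 * q * (w * q) = w^3 * q^2" by (simp add: eval_nat_numeral mult_ac)
  hence m: "w^2 * q * (w * q) = q^2" "w^2 * q / (w * q) = w"
    using w3 w0 q0 by (simp_all add: power2_eq_square)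
  have "wp (w * q) (q^4) - wp (w^2 * q) (q^4) = w * q * e 4 ^ 6 * theta (q^2) (q^4) * theta w (q^4) / (theta (w^2 * q) (q^4) * theta (w * q) (q^4)) ^ 2"
    unfolding q4.wp_diff_interior[OF q4.admissible_annulus[OF n(3,4)] n(1,2)] q4.wp_quotient_def m euler_def ..
  also have "\<dots> = (w - w^2) * (q * e 1 ^ 2 * e 4 * e 6 ^ 2 * e 12 / e 3 ^ 2)"
  proof -
    have "w * q * d^6 * (b^2 / d) * ((1 - w) * g) / (b * c * d^2 / (a * f))^2 = (w - w^2) * (q * a^2 * d * f^2 * g / c^2)"
      if "a \<noteq> 0" "b \<noteq> 0" "c \<noteq> 0" "d \<noteq> 0" "f \<noteq> 0" "g \<noteq> 0" for a b c d f g :: complex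
      using that by (simp add: divide_simps) (simp add: eval_nat_numeral algebra_simps)
    note * = this
    show ?thesis unfolding prod tw theta_values_4 by (rule *) simp_all
  qed
  finally show ?thesis .
qed

end

section \<open>The four Kronecker symbols\<close>

lemma legendre_values: "Legendre a p \<in> {-1, 0, 1}"
  by (simp add: Legendre_def)

text \<open>A congruence modulo \<open>p > 2\<close> determines a value in \<open>{-1, 0, 1}\<close>.\<close>
lemma legendre_eqI:
  assumes "prime p" "2 < p" "[Legendre a (int p) = x] (mod int p)" "x \<in> {-1, 0, 1}"
  shows "Legendre a (int p) = x"
proof -
  have "int p dvd Legendre a (int p) - x"
    using assms(3) by (simp add: cong_iff_dvd_diff)
  moreover have "\<bar>Legendre a (int p) - x\<bar> < int p"
    using legendre_values[of a "int p"] assms(2,4) by auto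
  ultimately show ?thesis
    using dvd_imp_le_int[of "Legendre a (int p) - x" "int p"] by auto
qed

lemma legendre_mult:
  assumes "prime p" "2 < p"
  shows "Legendre (a * b) (int p) = Legendre a (int p) * Legendre b (int p)"
proof (rule legendre_eqI[OF assms])
  have "[Legendre (a * b) (int p) = (a * b) ^ ((p - 1) div 2)] (mod int p)"
    by (rule euler_criterion[OF assms])
  moreover have "[Legendre a (int p) * Legendre b (int p) = (a * b) ^ ((p - 1) div 2)] (mod int p)"
    unfolding power_mult_distrib by (intro cong_mult euler_criterion assms)
  ultimately show "[Legendre (a * b) (int p) = Legendre a (int p) * Legendre b (int p)] (mod int p)"
    by (metis cong_sym cong_trans)
  show "Legendre a (int p) * Legendre b (int p) \<in> {-1, 0, 1}"
    using legendre_values[of a "int p"] legendre_values[of b "int p"] by auto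
qed

lemma legendre_minus_1:
  assumes "prime p" "2 < p"
  shows "Legendre (-1) (int p) = (-1) ^ ((p - 1) div 2)"
  by (rule legendre_eqI[OF assms euler_criterion[OF assms]])
     (metis insertI1 insert_commute minus_one_power_iff)

lemma legendre_4:
  assumes "prime p" "2 < p"
  shows "Legendre 4 (int p) = 1"
proof -
  have "\<not> int p dvd 2"
    using assms zdvd_imp_le[of "int p" 2] by auto
  hence "\<not> int p dvd 2 ^ 2"
    using assms prime_dvd_power_int[of "int p" 2 2] by auto
  hence "\<not> [4 = 0] (mod int p)"
    by (simp add: cong_0_iff)
  moreover have "QuadRes (int p) 4"
    unfolding QuadRes_def by (rule exI[of _ 2]) simp
  ultimately show ?thesis by (simp add: Legendre_def)
qed

definition character4 :: "nat \<Rightarrow> int" where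
  "character4 m = (if m mod 4 = 1 then 1 else if m mod 4 = 3 then -1 else 0)"

definition character3 :: "nat \<Rightarrow> int" where
  "character3 m = (if m mod 3 = 1 then 1 else if m mod 3 = 2 then -1 else 0)"

lemma character4_mult: "character4 (a * b) = character4 a * character4 b"
proof -
  have "a mod 4 \<in> {0, 1, 2, 3}" "b mod 4 \<in> {0, 1, 2, 3}" by auto
  thus ?thesis
    unfolding character4_def mod_mult_eq[of a 4 b, symmetric] by auto
qed

lemma character3_mult: "character3 (a * b) = character3 a * character3 b"
proof -
  have "a mod 3 \<in> {0, 1, 2}" "b mod 3 \<in> {0, 1, 2}" by auto
  thus ?thesis
    unfolding character3_def mod_mult_eq[of a 3 b, symmetric] by auto
qed

lemma legendre_mod_3: "Legendre (int m) 3 = character3 m"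
proof -
  have *: "[y^2 = int m] (mod 3) \<longleftrightarrow> (y mod 3)^2 mod 3 = int (m mod 3)" for y
    by (simp add: cong_def power_mod zmod_int)
  have sq: "(y mod 3)^2 mod 3 \<in> {0, 1}" for y :: int
  proof -
    have "y mod 3 \<in> {0, 1, 2}" by auto
    thus ?thesis by auto
  qed
  have i3: "int m mod 3 = int (m mod 3)" by (simp add: zmod_int)
  have "m mod 3 \<in> {0, 1, 2}" by auto
  thus ?thesis
  proof (elim insertE emptyE)
    assume "m mod 3 = 0"
    thus ?thesis by (simp add: Legendre_def character3_def cong_def i3)
  next
    assume m: "m mod 3 = 1"
    have "QuadRes 3 (int m)" unfolding QuadRes_def * using m by (intro exI[of _ 1]) simp
    thus ?thesis using m by (simp add: Legendre_def character3_def cong_def i3)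
  next
    assume m: "m mod 3 = 2"
    have "\<not> QuadRes 3 (int m)" unfolding QuadRes_def *
    proof
      assume "\<exists>y. (y mod 3)^2 mod 3 = int (m mod 3)"
      then obtain y :: int where "(y mod 3)^2 mod 3 = int (m mod 3)" ..
      thus False using sq[of y] m by auto
    qed
    thus ?thesis using m by (simp add: Legendre_def character3_def cong_def i3)
  qed
qed

lemma character4_odd: "odd m \<Longrightarrow> character4 m = (-1) ^ ((m - 1) div 2)"
proof -
  assume "odd m"
  hence "m mod 4 = 1 \<or> m mod 4 = 3" by presburger
  moreover define k where "k = m div 4"
  ultimately have "m = 4 * k + 1 \<or> m = 4 * k + 3" by presburger
  thus ?thesis by (auto simp: character4_def)
qed

lemma legendre_3:
  assumes p: "prime p" "2 < p"
  shows "Legendre 3 (int p) = character4 p * character3 p"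
proof (cases "p = 3")
  case True
  thus ?thesis by (simp add: Legendre_def character3_def cong_def)
next
  case False
  have odd: "odd p" using p prime_odd_nat by blast
  have "Legendre (int p) (int 3) * Legendre (int 3) (int p) = (-1) ^ ((p - 1) div 2 * ((3 - 1) div 2))"
    by (rule Quadratic_Reciprocity) (use p False in auto)
  hence "character3 p * Legendre 3 (int p) = character4 p"
    using legendre_mod_3[of p] character4_odd[OF odd] by simp
  moreover have "character3 p * character3 p = 1"
  proof -
    have "\<not> 3 dvd p" using p False primes_dvd_imp_eq[of 3 p] by auto
    hence "p mod 3 \<in> {1, 2}" by (auto simp: dvd_eq_mod_eq_0)
    thus ?thesis by (auto simp: character3_def)
  qed
  ultimately show ?thesis by (metis mult.assoc mult.commute mult_1)
qed

text \<open>The Kronecker symbol is completely multiplicative in \<open>m\<close>, so only its values at primes matter; these are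
  given by quadratic reciprocity below.\<close>
lemma kronecker_eqI:
  fixes f :: "nat \<Rightarrow> int"
  assumes one: "f 1 = 1" and mult: "\<And>a b. f (a * b) = f a * f b"
    and primes: "\<And>p. prime p \<Longrightarrow> kronecker_prime t p = f p" and m: "m > 0"
  shows "kronecker t m = f m"
proof -
  have pow: "f (p ^ k) = f p ^ k" for p k
    using one mult by (induction k) auto
  have "f m = f (\<Prod>p\<in>prime_factors m. p ^ multiplicity p m)"
    using prime_factorization_nat[OF m] by simp
  also have "\<dots> = (\<Prod>p\<in>prime_factors m. f (p ^ multiplicity p m))"
  proof -
    have "f (prod g A) = (\<Prod>p\<in>A. f (g p))" if "finite A" for g and A :: "nat set"
      using that by (induction A rule: finite_induct) (auto simp: mult one[simplified])
    thus ?thesis by simp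
  qed
  also have "\<dots> = kronecker t m"
    using m primes by (auto simp: kronecker_def pow in_prime_factors_iff intro!: prod.cong)
  finally show ?thesis ..
qed

lemma prime_gt_2: "prime p \<Longrightarrow> p \<noteq> 2 \<Longrightarrow> 2 < (p :: nat)"
  using prime_ge_2_nat[of p] by linarith

lemma kronecker_1: "m > 0 \<Longrightarrow> kronecker 1 m = 1"
proof (rule kronecker_eqI[of "\<lambda>_. 1"])
  fix p :: nat assume p: "prime p"
  have "\<not> [1 = 0] (mod int p)" using p by (auto simp: cong_0_iff)
  moreover have "QuadRes (int p) 1" unfolding QuadRes_def by (rule exI[of _ 1]) simp
  ultimately show "kronecker_prime 1 p = 1" by (simp add: kronecker_prime_def Legendre_def)
qed auto

lemma kronecker_minus_4: "m > 0 \<Longrightarrow> kronecker (-4) m = character4 m"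
proof (rule kronecker_eqI)
  fix p :: nat assume p: "prime p"
  show "kronecker_prime (-4) p = character4 p"
  proof (cases "p = 2")
    case False
    note p' = p prime_gt_2[OF p False]
    have "odd p" using p' prime_odd_nat by blast
    moreover have "Legendre (-1 * 4) (int p) = Legendre (-1) (int p) * Legendre 4 (int p)"
      by (rule legendre_mult[OF p'])
    ultimately show ?thesis
      using False legendre_4[OF p'] legendre_minus_1[OF p'] character4_odd by (simp add: kronecker_prime_def)
  qed (simp add: kronecker_prime_def character4_def)
qed (simp_all add: character4_mult character4_def[of "Suc 0"] character4_def[of 1])

lemma kronecker_minus_3: "m > 0 \<Longrightarrow> kronecker (-3) m = character3 m"
proof (rule kronecker_eqI)
  fix p :: nat assume p: "prime p"
  show "kronecker_prime (-3) p = character3 p"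
  proof (cases "p = 2")
    case False
    note p' = p prime_gt_2[OF p False]
    have odd: "odd p" using p' prime_odd_nat by blast
    have "Legendre (-1 * 3) (int p) = Legendre (-1) (int p) * Legendre 3 (int p)"
      by (rule legendre_mult[OF p'])
    moreover have "character4 p * character4 p = 1"
      using character4_odd[OF odd] by (simp flip: power_mult_distrib)
    ultimately show ?thesis
      using False legendre_3[OF p'] legendre_minus_1[OF p'] character4_odd[OF odd]
      by (simp add: kronecker_prime_def)
  qed (simp add: kronecker_prime_def character3_def)
qed (simp_all add: character3_mult character3_def[of "Suc 0"] character3_def[of 1])

lemma kronecker_12: "m > 0 \<Longrightarrow> kronecker 12 m = character4 m * character3 m"
proof (rule kronecker_eqI)
  fix p :: nat assume p: "prime p"
  show "kronecker_prime 12 p = character4 p * character3 p"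
  proof (cases "p = 2")
    case False
    note p' = p prime_gt_2[OF p False]
    have "Legendre (4 * 3) (int p) = Legendre 4 (int p) * Legendre 3 (int p)"
      by (rule legendre_mult[OF p'])
    thus ?thesis
      using False legendre_3[OF p'] legendre_4[OF p'] by (simp add: kronecker_prime_def)
  qed (simp add: kronecker_prime_def character4_def)
qed (simp_all add: character3_mult character4_mult character3_def[of "Suc 0"] character3_def[of 1]
     character4_def[of "Suc 0"] character4_def[of 1])

section \<open>Lambert series\<close>

text \<open>The generating function of \<open>m x\<^sup>m\<close>.\<close>
definition double_pole :: "complex \<Rightarrow> complex" where "double_pole x = x / (1 - x) ^ 2"

lemma double_pole_inverse: "double_pole (1 / x) = double_pole x"
proof (cases "x = 0 \<or> x = 1")
  case False
  hence "1 - 1 / x \<noteq> 0" "1 - x \<noteq> 0" by auto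
  thus ?thesis using False by (simp add: double_pole_def divide_simps) (simp add: power2_eq_square algebra_simps)
qed (auto simp: double_pole_def)

lemma double_pole_has_sum:
  assumes "norm x < 1"
  shows "((\<lambda>m. of_nat m * x ^ m) has_sum double_pole x) {1..}"
proof -
  have sums: "(\<lambda>m. of_nat m * y ^ m) sums (y / (1 - y) ^ 2)" if "norm y < 1" for y :: "'a :: {real_normed_field, banach}"
  proof -
    have "(\<lambda>n. y * (of_nat (Suc n) * y ^ n)) sums (y * (1 / (1 - y) ^ 2))"
      by (intro sums_mult geometric_deriv_sums that)
    hence "(\<lambda>n. of_nat (Suc n) * y ^ Suc n) sums (y / (1 - y) ^ 2)" by (simp add: mult_ac)
    thus ?thesis by (subst (asm) sums_Suc_iff) simp
  qed
  have "summable (\<lambda>m. norm (of_nat m * x ^ m))"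
    using sums[of "norm x"] assms by (simp add: norm_mult norm_power sums_iff)
  hence "((\<lambda>m. of_nat m * x ^ m) has_sum double_pole x) UNIV"
    using sums[OF assms] unfolding double_pole_def by (rule norm_summable_imp_has_sum)
  moreover have "((\<lambda>m. of_nat m * x ^ m) has_sum double_pole x) UNIV \<longleftrightarrow> ((\<lambda>m. of_nat m * x ^ m) has_sum double_pole x) {1..}"
    by (rule has_sum_cong_neutral) auto
  ultimately show ?thesis by simp
qed

text \<open>Summation over the pairs \<open>(d, m)\<close> instead of over \<open>n = d m\<close> and the divisors \<open>m\<close> of \<open>n\<close>.\<close>
lemma lambert_expansion:
  fixes f g :: "nat \<Rightarrow> complex"
  assumes q: "norm q < 1" and f: "\<And>m. norm (f m) \<le> 1" and g: "\<And>d. norm (g d) \<le> 1"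
  shows "(\<Sum>n. sigma_chars f g (Suc n) * q ^ Suc n) =
    (\<Sum>\<^sub>\<infinity>d\<in>{1..}. g d * (\<Sum>\<^sub>\<infinity>m\<in>{1..}. f m * (of_nat m * (q ^ d) ^ m)))"
proof -
  let ?t = "\<lambda>(d, m). g d * (f m * (of_nat m * (q ^ d) ^ m))"
  let ?r = "norm q"
  have abs: "(\<lambda>x. norm (?t x)) summable_on {1..} \<times> {1..}"
  proof (cases "q = 0")
    case True
    hence "norm (?t x) = 0" if "x \<in> {1..} \<times> {1..}" for x using that by auto
    thus ?thesis using summable_on_cong[of "{1..} \<times> {1..}" "\<lambda>x. norm (?t x)" "\<lambda>_. 0"] by simp
  next
    case False
    have 1: "(\<lambda>d. norm (q ^ d)) summable_on {1..}"
      using q by (intro summable_on_subset[OF norm_summable_imp_summable_on[of "\<lambda>d. norm (q ^ d)"]])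
        (auto simp: norm_power intro!: summable_geometric)
    have "((\<lambda>m. of_nat m * of_real ?r ^ m) has_sum double_pole (of_real ?r)) {1..}"
      by (rule double_pole_has_sum) (use q in simp)
    hence "(\<lambda>m. of_nat m * complex_of_real ?r ^ m) summable_on {1..}"
      by (rule has_sum_imp_summable)
    hence 2: "(\<lambda>m. norm (of_nat m * complex_of_real ?r ^ m)) summable_on {1..}"
      by (simp only: summable_on_iff_abs_summable_on_complex)
    have "(\<lambda>(d, m). q ^ d * (of_nat m * complex_of_real ?r ^ m)) summable_on {1..} \<times> {1..}"
      by (rule infsum_product[OF 1 2])
    hence "(\<lambda>x. norm ((\<lambda>(d, m). q ^ d * (of_nat m * complex_of_real ?r ^ m)) x)) summable_on {1..} \<times> {1..}"
      by (simp only: summable_on_iff_abs_summable_on_complex)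
    hence "(\<lambda>x. norm ((\<lambda>(d, m). q ^ d * (of_nat m * complex_of_real ?r ^ m)) x) * (1 / ?r)) summable_on {1..} \<times> {1..}"
      by (rule summable_on_cmult_left)
    thus ?thesis
    proof (rule Infinite_Sum.abs_summable_on_comparison_test')
      fix x :: "nat \<times> nat" assume "x \<in> {1..} \<times> {1..}"
      then obtain d m where x: "x = (d, m)" "d \<ge> 1" "m \<ge> 1" by auto
      \<comment> \<open>\<open>d * m \<ge> (d - 1) + m\<close> bounds the term by a product of a geometric term in \<open>d\<close> and one in \<open>m\<close>.\<close>
      obtain a b where ab: "d = Suc a" "m = Suc b" using x by (metis Suc_le_D One_nat_def)
      have "norm (?t x) = norm (g d) * (norm (f m) * (of_nat m * ?r ^ (d * m)))"
        unfolding x by (simp add: norm_mult norm_power flip: power_mult)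
      also have "\<dots> \<le> 1 * (1 * (of_nat m * ?r ^ (d * m)))"
        by (intro mult_mono f g) auto
      also have "?r ^ (d * m) \<le> ?r ^ (a + m)"
        using q by (intro power_decreasing) (auto simp: ab)
      hence "1 * (1 * (of_nat m * ?r ^ (d * m))) \<le> of_nat m * ?r ^ (a + m)"
        by (simp add: mult_left_mono)
      also have "\<dots> = norm ((\<lambda>(d, m). q ^ d * (of_nat m * complex_of_real ?r ^ m)) x) * (1 / ?r)"
        using False by (simp add: x ab norm_mult norm_power power_add del: of_nat_Suc)
      finally show "norm (?t x) \<le> norm ((\<lambda>(d, m). q ^ d * (of_nat m * complex_of_real ?r ^ m)) x) * (1 / ?r)" .
    qed
  qed
  let ?u = "\<lambda>(n, m). f m * g (n div m) * of_nat m * q ^ n"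
  have bij: "bij_betw (\<lambda>(d, m). (d * m, m)) ({1..} \<times> {1..}) (SIGMA n:{1::nat..}. {m. m dvd n})"
    by (rule bij_betwI[of _ _ _ "\<lambda>(n, m). (n div m, m)"]) (auto simp: Suc_le_eq dvd_div_eq_0_iff dest: dvd_pos_nat)
  have tu: "?u ((\<lambda>(d, m). (d * m, m)) x) = ?t x" if "x \<in> {1..} \<times> {1..}" for x
    using that by (auto simp: power_mult)
  have "(\<lambda>x. norm (?u ((\<lambda>(d, m). (d * m, m)) x))) summable_on {1..} \<times> {1..}"
    using abs tu summable_on_cong by (metis (no_types, lifting))
  hence uabs: "(\<lambda>x. norm (?u x)) summable_on (SIGMA n:{1::nat..}. {m. m dvd n})"
    using summable_on_reindex_bij_betw[OF bij, of "\<lambda>x. norm (?u x)"] by blast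
  hence us: "?u summable_on (SIGMA n:{1::nat..}. {m. m dvd n})"
    by (rule abs_summable_summable)
  have inner: "(\<Sum>\<^sub>\<infinity>m\<in>{m. m dvd n}. f m * g (n div m) * of_nat m * q ^ n) = sigma_chars f g n * q ^ n" if "n \<in> {1..}" for n
  proof -
    have "finite {m. m dvd n}" using that by (intro finite_divisors_nat) auto
    thus ?thesis by (simp add: sigma_chars_def sum_distrib_right)
  qed
  have "((\<lambda>n. \<Sum>\<^sub>\<infinity>m\<in>{m. m dvd n}. f m * g (n div m) * of_nat m * q ^ n) summable_on {1..})"
    using summable_on_Sigma_banach[OF us] by simp
  hence "(\<lambda>n. sigma_chars f g n * q ^ n) summable_on {1..}"
    using summable_on_cong[of "{1..}"] inner by (metis (no_types, lifting))
  hence "((\<lambda>n. sigma_chars f g n * q ^ n) has_sum (\<Sum>\<^sub>\<infinity>n\<in>{1..}. sigma_chars f g n * q ^ n)) {1..}"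
    by simp
  hence "((\<lambda>n. sigma_chars f g (Suc n) * q ^ Suc n) has_sum (\<Sum>\<^sub>\<infinity>n\<in>{1..}. sigma_chars f g n * q ^ n)) UNIV"
    by (subst has_sum_reindex_bij_witness[of UNIV "\<lambda>n. n - 1" Suc "{1..}"]) auto
  hence "(\<Sum>n. sigma_chars f g (Suc n) * q ^ Suc n) = (\<Sum>\<^sub>\<infinity>n\<in>{1..}. sigma_chars f g n * q ^ n)"
    by (metis has_sum_imp_sums sums_unique)
  also have "\<dots> = (\<Sum>\<^sub>\<infinity>n\<in>{1..}. \<Sum>\<^sub>\<infinity>m\<in>{m. m dvd n}. f m * g (n div m) * of_nat m * q ^ n)"
    by (intro infsum_cong inner[symmetric])
  also have "\<dots> = infsum ?u (SIGMA n:{1..}. {m. m dvd n})"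
    using infsum_Sigma_banach[OF us] by simp
  also have "\<dots> = infsum (\<lambda>x. ?u ((\<lambda>(d, m). (d * m, m)) x)) ({1..} \<times> {1..})"
    by (rule infsum_reindex_bij_betw[OF bij, symmetric])
  also have "\<dots> = infsum ?t ({1..} \<times> {1..})"
    by (intro infsum_cong tu)
  also have "\<dots> = (\<Sum>\<^sub>\<infinity>d\<in>{1..}. \<Sum>\<^sub>\<infinity>m\<in>{1..}. g d * (f m * (of_nat m * (q ^ d) ^ m)))"
    using infsum_Sigma_banach[OF abs_summable_summable[OF abs]] by simp
  also have "\<dots> = (\<Sum>\<^sub>\<infinity>d\<in>{1..}. g d * (\<Sum>\<^sub>\<infinity>m\<in>{1..}. f m * (of_nat m * (q ^ d) ^ m)))"
    by (simp only: infsum_cmult_right')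
  finally show ?thesis .
qed

text \<open>The Eisenstein series as a function of the nome.\<close>
definition eisq :: "int \<Rightarrow> int \<Rightarrow> complex \<Rightarrow> complex" where
  "eisq t1 t2 q = eis_const t1 t2 + (\<Sum>n. sigma_chars (chi t1) (chi t2) (Suc n) * q ^ Suc n)"

lemma chi_simps:
  assumes "m > 0"
  shows "chi 1 m = 1" "chi (-4) m = of_int (character4 m)" "chi (-3) m = of_int (character3 m)"
    "chi 12 m = of_int (character4 m * character3 m)"
  using assms by (simp_all add: chi_def kronecker_1 kronecker_minus_4 kronecker_minus_3 kronecker_12)

lemma norm_chi_le_1: "t \<in> {1, -4, -3, 12} \<Longrightarrow> norm (chi t m) \<le> 1"
proof (cases "m = 0")
  case True
  thus ?thesis by (simp add: chi_def kronecker_def)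
next
  case False
  assume "t \<in> {1, -4, -3, 12}"
  thus ?thesis using False
    by (elim insertE) (auto simp: chi_simps character4_def character3_def)
qed

lemma eisq_lambert:
  assumes "norm q < 1" "t1 \<in> {1, -4, -3, 12}" "t2 \<in> {1, -4, -3, 12}"
  shows "eisq t1 t2 q = eis_const t1 t2 +
    (\<Sum>\<^sub>\<infinity>d\<in>{1..}. chi t2 d * (\<Sum>\<^sub>\<infinity>m\<in>{1..}. chi t1 m * (of_nat m * (q ^ d) ^ m)))"
  unfolding eisq_def using lambert_expansion[OF assms(1) norm_chi_le_1[OF assms(2)] norm_chi_le_1[OF assms(3)]]
  by simp

lemma twisted_double_pole_has_sum:
  assumes "norm c = 1" "norm x < 1"
  shows "((\<lambda>m. c ^ m * (of_nat m * x ^ m)) has_sum double_pole (c * x)) {1..}"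
  using double_pole_has_sum[of "c * x"] assms by (simp add: norm_mult power_mult_distrib mult_ac)

lemma sum_chi_1:
  assumes x: "norm x < 1"
  shows "(\<Sum>\<^sub>\<infinity>m\<in>{1..}. chi 1 m * (of_nat m * x ^ m)) = double_pole x"
proof -
  have "(\<Sum>\<^sub>\<infinity>m\<in>{1..}. chi 1 m * (of_nat m * x ^ m)) = (\<Sum>\<^sub>\<infinity>m\<in>{1..}. of_nat m * x ^ m)"
    by (intro infsum_cong) (auto simp: chi_simps)
  thus ?thesis using infsumI[OF double_pole_has_sum[OF x]] by simp
qed

lemma power_mod_period:
  fixes c :: complex
  assumes "c ^ N = 1"
  shows "c ^ m = c ^ (m mod N)"
proof -
  have "c ^ m = c ^ (N * (m div N) + m mod N)" by simp
  thus ?thesis using assms by (simp only: power_add power_mult power_one mult_1)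
qed

text \<open>A character with values \<open>\<chi>(m)\<close> is a combination of the powers \<open>c\<^sup>m\<close> of roots of unity, by its Gauss sum. The
  same is done for the characters modulo 3 and 12 below.\<close>
lemma sum_chi_minus_4:
  assumes x: "norm x < 1"
  shows "(\<Sum>\<^sub>\<infinity>m\<in>{1..}. chi (-4) m * (of_nat m * x ^ m)) = (double_pole (\<i> * x) - double_pole (- (\<i> * x))) / (2 * \<i>)"
proof -
  have c: "chi (-4) m = (\<i> ^ m - (-\<i>) ^ m) / (2 * \<i>)" if "m \<in> {1..}" for m
  proof -
    have "\<i> ^ 4 = 1" "(-\<i>) ^ 4 = 1" by (simp_all add: eval_nat_numeral)
    hence "\<i> ^ m = \<i> ^ (m mod 4)" "(-\<i>) ^ m = (-\<i>) ^ (m mod 4)"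
      by (intro power_mod_period; simp)+
    moreover have "m mod 4 \<in> {0, 1, 2, 3}" by auto
    ultimately show ?thesis
      using that by (auto simp: chi_simps character4_def power2_eq_square power3_eq_cube)
  qed
  have "((\<lambda>m. (\<i> ^ m * (of_nat m * x ^ m) + - ((-\<i>) ^ m * (of_nat m * x ^ m))) * (1 / (2 * \<i>))) has_sum
      (double_pole (\<i> * x) + - double_pole ((-\<i>) * x)) * (1 / (2 * \<i>))) {1..}"
    by (intro has_sum_cmult_left has_sum_add has_sum_uminusI twisted_double_pole_has_sum x) simp_all
  hence "((\<lambda>m. chi (-4) m * (of_nat m * x ^ m)) has_sum (double_pole (\<i> * x) + - double_pole ((-\<i>) * x)) * (1 / (2 * \<i>))) {1..}"
    by (subst (asm) has_sum_cong[of "{1..}" _ "\<lambda>m. chi (-4) m * (of_nat m * x ^ m)"])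
       (simp_all add: c algebra_simps diff_divide_distrib)
  thus ?thesis using infsumI by fastforce
qed

lemma sum_chi_minus_3:
  assumes x: "norm x < 1" and w: "w^2 + w + 1 = 0"
  shows "(\<Sum>\<^sub>\<infinity>m\<in>{1..}. chi (-3) m * (of_nat m * x ^ m)) = (double_pole (w * x) - double_pole (w^2 * x)) / (w - w^2)"
proof -
  note w3 = cube_root_of_unity(1)[OF w] and nw = cube_root_of_unity(3)[OF w]
    and ne = cube_root_of_unity(4)[OF w]
  have c: "chi (-3) m = (w ^ m - (w^2) ^ m) / (w - w^2)" if "m \<in> {1..}" for m
  proof -
    have "(w^2) ^ 3 = (w ^ 3) ^ 2" by (simp flip: power_mult)
    hence "w ^ m = w ^ (m mod 3)" "(w^2) ^ m = (w^2) ^ (m mod 3)"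
      using w3 by (intro power_mod_period; simp)+
    moreover have "(w^2)^2 = w" using w3 by (simp add: eval_nat_numeral mult_ac)
    hence "w ^ 2 - (w^2)^2 = - (w - w^2)" by simp
    moreover have "m mod 3 \<in> {0, 1, 2}" by auto
    moreover have "- (w - w^2) / (w - w^2) = -1" 
    proof -
      have "- x / x = -1" if "x \<noteq> 0" for x :: complex using that by simp
      thus ?thesis using ne .
    qed
    ultimately show ?thesis
      using that ne by (auto simp: chi_simps character3_def)
  qed
  have "((\<lambda>m. (w ^ m * (of_nat m * x ^ m) + - ((w^2) ^ m * (of_nat m * x ^ m))) * (1 / (w - w^2))) has_sum
      (double_pole (w * x) + - double_pole (w^2 * x)) * (1 / (w - w^2))) {1..}"
    by (intro has_sum_cmult_left has_sum_add has_sum_uminusI twisted_double_pole_has_sum x) (simp_all add: nw norm_power)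
  hence "((\<lambda>m. chi (-3) m * (of_nat m * x ^ m)) has_sum (double_pole (w * x) + - double_pole (w^2 * x)) * (1 / (w - w^2))) {1..}"
    by (subst (asm) has_sum_cong[of "{1..}" _ "\<lambda>m. chi (-3) m * (of_nat m * x ^ m)"])
       (simp_all add: c algebra_simps diff_divide_distrib)
  thus ?thesis using infsumI by fastforce
qed

lemma primitive_12th_root:
  fixes c :: complex
  assumes c: "c^4 - c^2 + 1 = 0"
  shows "c ^ 6 = -1" "c ^ 12 = 1" "norm c = 1" "(c - c^5) ^ 2 = 3" "c - c^5 \<noteq> 0" "c^11 = - (c^5)" "c^7 = - c"
proof -
  have "c ^ 6 = (c^2 + 1) * (c^4 - c^2 + 1) - 1"
    by (simp add: eval_nat_numeral algebra_simps)
  thus c6: "c ^ 6 = -1" by (simp add: c)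
  have "c ^ 12 = (c ^ 6) ^ 2" by (simp flip: power_mult)
  thus c12: "c ^ 12 = 1" by (simp add: c6)
  show "norm c = 1" using power_eq_1_iff[OF c12] by simp
  have "(c - c^5) ^ 2 = c^2 - 2 * c^6 + c^6 * c^4" by (simp add: eval_nat_numeral algebra_simps)
  also have "\<dots> = 3 - (c^4 - c^2 + 1)" by (simp add: c6)
  finally show s: "(c - c^5) ^ 2 = 3" by (simp add: c)
  show "c - c^5 \<noteq> 0" using s by auto
  have "c ^ 11 = c ^ 6 * c ^ 5" "c ^ 7 = c ^ 6 * c" by (simp_all add: eval_nat_numeral mult_ac)
  thus "c^11 = - (c^5)" "c^7 = - c" by (simp_all add: c6)
qed

lemma sum_chi_12:
  assumes x: "norm x < 1" and c: "c^4 - c^2 + 1 = 0"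
  shows "(\<Sum>\<^sub>\<infinity>m\<in>{1..}. chi 12 m * (of_nat m * x ^ m)) =
    (double_pole (c * x) - double_pole (c^5 * x) + (double_pole (c^11 * x) - double_pole (c^7 * x))) / (2 * (c - c^5))"
proof -
  note p = primitive_12th_root[OF c]
  have ch: "chi 12 m = (c ^ m - (c^5) ^ m + ((c^11) ^ m - (c^7) ^ m)) / (2 * (c - c^5))" if "m \<in> {1..}" for m
  proof -
    define r where "r = m mod 12"
    have r: "r \<in> {0, 1, 2, 3, 4, 5, 6, 7, 8, 9, 10, 11}" 
    proof -
      have "r < 12" by (simp add: r_def)
      hence "r = 0 \<or> r = 1 \<or> r = 2 \<or> r = 3 \<or> r = 4 \<or> r = 5 \<or> r = 6 \<or> r = 7 \<or> r = 8 \<or> r = 9 \<or> r = 10 \<or> r = 11"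
        by arith
      thus ?thesis by auto
    qed
    have "(c ^ k) ^ m = c ^ ((k * r) mod 12)" for k
    proof -
      have "(c ^ k) ^ m = c ^ ((k * m) mod 12)"
        using power_mod_period[OF p(2), of "k * m"] by (simp add: power_mult)
      also have "(k * m) mod 12 = (k * r) mod 12" by (simp add: r_def mod_mult_right_eq)
      finally show ?thesis .
    qed
    from this[of 1] this[of 5] this[of 7] this[of 11]
    have "c ^ m - (c^5) ^ m + ((c^11) ^ m - (c^7) ^ m) =
       c ^ (r mod 12) - c ^ ((5 * r) mod 12) + (c ^ ((11 * r) mod 12) - c ^ ((7 * r) mod 12))"
      by simp
    moreover have "m mod 4 = r mod 4" "m mod 3 = r mod 3"
      by (simp_all add: r_def mod_mod_cancel)
    ultimately have "c ^ m - (c^5) ^ m + ((c^11) ^ m - (c^7) ^ m) =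
        of_int (character4 m * character3 m) * (2 * (c - c^5))"
      using r unfolding character4_def character3_def
      by (elim insertE emptyE) (simp_all add: p(6,7))
    thus ?thesis using that p(5) by (simp add: chi_simps)
  qed
  have "((\<lambda>m. ((c ^ m * (of_nat m * x ^ m) + - ((c^5) ^ m * (of_nat m * x ^ m))) +
        ((c^11) ^ m * (of_nat m * x ^ m) + - ((c^7) ^ m * (of_nat m * x ^ m)))) * (1 / (2 * (c - c^5)))) has_sum
      ((double_pole (c * x) + - double_pole (c^5 * x)) + (double_pole (c^11 * x) + - double_pole (c^7 * x))) * (1 / (2 * (c - c^5)))) {1..}"
    by (intro has_sum_cmult_left has_sum_add has_sum_uminusI twisted_double_pole_has_sum x) (simp_all add: p(3) norm_power)
  hence "((\<lambda>m. chi 12 m * (of_nat m * x ^ m)) has_sum 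
     ((double_pole (c * x) + - double_pole (c^5 * x)) + (double_pole (c^11 * x) + - double_pole (c^7 * x))) * (1 / (2 * (c - c^5)))) {1..}"
    by (subst (asm) has_sum_cong[of "{1..}" _ "\<lambda>m. chi 12 m * (of_nat m * x ^ m)"])
       (simp_all only: ch times_divide_eq_right times_divide_eq_left mult_1_right ring_distribs mult_minus_left diff_conv_add_uminus)
  from infsumI[OF this] show ?thesis by simp
qed

section \<open>The Eisenstein series as eta quotients\<close>

text \<open>In each of the four series the summand at \<open>d \<ge> 1\<close> is brought into the form \<open>H d + H (- d)\<close>, where \<open>H\<close> sums to
  a difference of Weierstrass values.\<close>
lemma infsum_symmetric_int:
  fixes H :: "int \<Rightarrow> complex"
  assumes H: "(H has_sum S) UNIV"
  shows "(\<Sum>\<^sub>\<infinity>d\<in>{1::nat..}. H (int d) + H (- int d)) = S - H 0"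
proof -
  have s: "H summable_on A" for A
    using has_sum_imp_summable[OF H] summable_on_subset_banach by blast
  have p: "((\<lambda>d. H (int d)) has_sum infsum H {1..}) {1::nat..}"
    by (subst has_sum_reindex_bij_witness[of _ nat int "{1..}" H]) (auto intro: has_sum_infsum s)
  have n: "((\<lambda>d. H (- int d)) has_sum infsum H {..-1}) {1::nat..}"
    by (subst has_sum_reindex_bij_witness[of _ "\<lambda>k. nat (-k)" "\<lambda>d. - int d" "{..-1}" H]) (auto intro: has_sum_infsum s)
  have "UNIV = insert 0 ({1..} \<union> {..-1::int})" by auto
  hence "S = infsum H (insert 0 ({1..} \<union> {..-1::int}))" using infsumI[OF H] by simp
  also have "\<dots> = H 0 + infsum H ({1..} \<union> {..-1})"
    by (rule infsum_insert) (auto intro: s)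
  also have "infsum H ({1..} \<union> {..-1}) = infsum H {1..} + infsum H {..-1}"
    by (rule infsum_Un_disjoint) (auto intro: s)
  finally show ?thesis using infsumI[OF has_sum_add[OF p n]] by simp
qed

context theta_base
begin

lemma wp_has_sum:
  assumes b: "admissible b"
  shows "((\<lambda>m. double_pole (b * q powi m)) has_sum wp b q) UNIV"
proof -
  obtain C where C: "C > 0" "\<And>n. norm (kcoeff b q (int n)) \<le> C"
    "\<And>n. norm (kcoeff b q (- int n)) \<le> C * norm q ^ n"
    using kcoeff_bounds[OF b] by metis
  have eq: "double_pole (b * q powi m) = b * q powi m * (kcoeff b q m * kcoeff b q m)" for m
    by (simp add: double_pole_def kcoeff_def power2_eq_square)
  have geo: "summable (\<lambda>n. norm b * (C * C) * norm q ^ n)"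
    using q1 by (intro summable_mult summable_geometric) auto
  have "(\<lambda>m. norm (double_pole (b * q powi m))) summable_on UNIV"
  proof (rule abs_summable_on_int)
    show "summable (\<lambda>n. norm (double_pole (b * q powi (int n))))"
    proof (rule summable_comparison_test'[OF geo])
      fix n
      have "norm (double_pole (b * q powi (int n))) = norm b * norm q ^ n * (norm (kcoeff b q (int n)) * norm (kcoeff b q (int n)))"
        unfolding eq by (simp add: norm_mult norm_power)
      also have "\<dots> \<le> norm b * norm q ^ n * (C * C)"
        by (intro mult_left_mono mult_mono C) (use C(1) in auto)
      finally show "norm (norm (double_pole (b * q powi (int n)))) \<le> norm b * (C * C) * norm q ^ n"
        by (simp add: mult_ac)
    qed
    show "summable (\<lambda>n. norm (double_pole (b * q powi (- int n))))"
    proof (rule summable_comparison_test'[OF geo])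
      fix n
      have "norm (double_pole (b * q powi (- int n))) = norm b / norm q ^ n * (norm (kcoeff b q (- int n)) * norm (kcoeff b q (- int n)))"
        unfolding eq by (simp add: norm_mult norm_power power_int_minus norm_inverse divide_inverse)
      also have "\<dots> \<le> norm b / norm q ^ n * ((C * norm q ^ n) * (C * norm q ^ n))"
        by (intro mult_left_mono mult_mono C) (use C(1) in auto)
      also have "\<dots> = norm b * (C * C) * norm q ^ n"
        using q0 by simp
      finally show "norm (norm (double_pole (b * q powi (- int n)))) \<le> norm b * (C * C) * norm q ^ n"
        by simp
    qed
  qed
  hence "(\<lambda>m. double_pole (b * q powi m)) summable_on UNIV" by (rule abs_summable_summable)
  thus ?thesis unfolding wp_def by (simp add: double_pole_def)
qed

lemma wp_has_sum_residue:
  assumes N: "r < N" and b: "theta_base.admissible (q ^ N) (b * q ^ r)"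
  shows "((\<lambda>k. if k mod int N = int r then double_pole (b * q powi k) else 0) has_sum wp (b * q ^ r) (q ^ N)) UNIV"
proof -
  interpret qN: theta_base "q ^ N" by (rule theta_base_power) (use N in auto)
  have "b * q ^ r * (q ^ N) powi m = b * q powi (int N * m + int r)" for m
    using q0 by (simp add: power_int_add power_int_power)
  hence "((\<lambda>m. double_pole (b * q powi (int N * m + int r))) has_sum wp (b * q ^ r) (q ^ N)) UNIV"
    using qN.wp_has_sum[OF b] by (simp only:)
  hence "((\<lambda>k. double_pole (b * q powi k)) has_sum wp (b * q ^ r) (q ^ N)) {k. k mod int N = int r}"
    by (subst (asm) has_sum_reindex_bij_witness[of _ "\<lambda>k. k div int N" "\<lambda>m. int N * m + int r" "{k. k mod int N = int r}" "\<lambda>k. double_pole (b * q powi k)"])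
       (use N in \<open>auto simp: mult.commute minus_mod_eq_mult_div[symmetric]\<close>)
  moreover have "?thesis \<longleftrightarrow> ((\<lambda>k. double_pole (b * q powi k)) has_sum wp (b * q ^ r) (q ^ N)) {k. k mod int N = int r}"
    by (rule has_sum_cong_neutral) auto
  ultimately show ?thesis by simp
qed

end

lemma cube_root_of_unity_exists: "\<exists>w::complex. w^2 + w + 1 = 0"
proof -
  define w where "w = Complex (- 1 / 2) (sqrt 3 / 2)"
  have "w^2 + w + 1 = 0"
    by (auto simp: w_def complex_eq_iff power2_eq_square)
  thus ?thesis ..
qed

context theta_base
begin

text \<open>Both points lie on the unit circle, which is why \<open>wp_diff\<close> is required there.\<close>
lemma wp_diff_12th_root:
  assumes c: "c^4 - c^2 + 1 = 0"
  shows "wp c q - wp (c^5) q = - 2 * (c - c^5) * (e 1 * e 3 * e 4 ^ 2 * e 6 ^ 2 / e 12 ^ 2)"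
proof -
  interpret q2: theta_base "q^2" by (rule theta_base_power) simp
  interpret q4: theta_base "q^4" by (rule theta_base_power) simp
  note p = primitive_12th_root[OF c]
  \<comment> \<open>The primitive cube root of unity among the powers of \<open>c\<close>; note \<open>c\<^sup>2 = - w\<^sup>2\<close>.\<close>
  define w where "w = c^4"
  have c2: "c^2 = 1 + w" using c by (simp add: w_def algebra_simps)
  have w: "w^2 + w + 1 = 0"
  proof -
    have "w^2 = c^6 * c^2" by (simp add: w_def flip: power_mult power_add)
    thus ?thesis using p(1) c2 by simp
  qed
  note w3 = cube_root_of_unity(1)[OF w]
  hence w4: "(w^2)^2 = w" by (simp add: eval_nat_numeral mult_ac)
  have nz: "c \<noteq> 0" "w \<noteq> 0" "w \<noteq> 1" using p(3) w3 w by auto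
  have nc: "norm q < norm (c^5)" "norm (c^5) \<le> 1" using p(3) q1 by (simp_all add: norm_power)
  have c5: "c^5 \<noteq> 1" "c \<noteq> 1"
  proof -
    show "c \<noteq> 1" using c by auto
    show "c^5 \<noteq> 1"
    proof
      assume "c^5 = 1"
      moreover have "c^6 = c * c^5" by (simp add: eval_nat_numeral)
      ultimately show False using p(1) c by (simp add: eval_nat_numeral)
    qed
  qed
  have m: "c^5 * c = -1" "c^5 / c = w"
    using p(1) nz by (simp_all add: w_def eval_nat_numeral mult_ac)
  have t1: "theta (-1) q = 2 * e 2 ^ 2 / e 1" using theta_minus_1 by simp
  have tw: "theta w q = (1 - w) * e 3" using theta_cube_root[OF w] .
  have inv: "theta (c^5) q = theta (-c) q / c"
  proof -
    have "c^5 = 1 / (-c)" using m nz by (simp add: field_simps)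
    thus ?thesis using theta_inverse[OF q1, of "-c"] nz by simp
  qed
  have T1: "theta c q * theta (-c) q = theta (-(w^2)) (q^2) * e 1 ^ 2 / e 2"
  proof -
    have "c^2 + w^2 = 0" using c2 w by (simp add: add_ac)
    hence "c^2 = -(w^2)" by (simp add: eq_neg_iff_add_eq_0)
    thus ?thesis using theta_mult_minus[OF nz(1)] by simp
  qed
  have T2: "theta (w^2) (q^2) * theta (-(w^2)) (q^2) = theta w (q^4) * e 2 ^ 2 / e 4"
    using q2.theta_mult_minus[of "w^2"] nz w4 by (simp flip: power_mult)
  have w': "(w^2)^2 + w^2 + 1 = 0" unfolding w4 using w by (simp add: add_ac)
  have T3: "theta (w^2) (q^2) = (1 - w^2) * e 6" "theta w (q^4) = (1 - w) * e 12"
    using q2.theta_cube_root[OF w'] q4.theta_cube_root[OF w] by (simp_all flip: power_mult)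
  have T4: "theta (-(w^2)) (q^2) = - w * (e 12 * e 2 ^ 2 / (e 4 * e 6))"
  proof -
    have "- (1 - w) * w^2 = w^3 - w^2" by (simp add: eval_nat_numeral algebra_simps)
    hence "1 - w^2 = - (1 - w) * w^2" by (simp only: w3)
    hence "(- (1 - w) * w^2 * e 6) * theta (-(w^2)) (q^2) = (1 - w) * e 12 * e 2 ^ 2 / e 4"
      using T2 unfolding T3 by simp
    also have "\<dots> = (- (1 - w) * w^2 * e 6) * (- w * (e 12 * e 2 ^ 2 / (e 4 * e 6)))"
    proof -
      have "(- (1 - w) * w^2 * e 6) * (- w * (e 12 * e 2 ^ 2 / (e 4 * e 6))) = w^3 * ((1 - w) * e 12 * e 2 ^ 2 / e 4)"
        by (simp add: field_simps power2_eq_square[of w] power3_eq_cube[of w])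
      thus ?thesis by (simp add: w3)
    qed
    finally have "(- (1 - w) * w^2 * e 6) * theta (-(w^2)) (q^2) = (- (1 - w) * w^2 * e 6) * (- w * (e 12 * e 2 ^ 2 / (e 4 * e 6)))" .
    moreover have "- (1 - w) * w^2 * e 6 \<noteq> 0" using nz by simp
    ultimately show ?thesis by (simp only: mult_cancel_left simp_thms)
  qed
  have P: "(theta (c^5) q * theta c q) ^ 2 = - ((e 12 * e 2 * e 1 ^ 2 / (e 4 * e 6)) ^ 2)"
  proof -
    have "theta (c^5) q * theta c q = (theta c q * theta (-c) q) / c"
      unfolding inv by (simp add: mult_ac)
    also have "\<dots> = - (w / c) * (e 12 * e 2 * e 1 ^ 2 / (e 4 * e 6))"
      unfolding T1 T4 by (simp add: power2_eq_square[of "e 2"] mult_ac)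
    also have "w / c = c^3" using nz by (simp add: w_def eval_nat_numeral)
    finally have "theta (c^5) q * theta c q = - (c^3) * (e 12 * e 2 * e 1 ^ 2 / (e 4 * e 6))" .
    hence "(theta (c^5) q * theta c q) ^ 2 = (- (c^3)) ^ 2 * (e 12 * e 2 * e 1 ^ 2 / (e 4 * e 6)) ^ 2"
      by (simp only: power_mult_distrib)
    also have "(- (c^3)) ^ 2 = c^6" by (simp flip: power_mult)
    finally show ?thesis by (simp add: p(1))
  qed
  have "wp c q - wp (c^5) q = wp_quotient (c^5) c"
    by (rule wp_diff[OF admissible_circle[OF p(3) c5(2)] nc c5(1)])
  also have "\<dots> = c * e 1 ^ 6 * (2 * e 2 ^ 2 / e 1) * ((1 - w) * e 3) / (- ((e 12 * e 2 * e 1 ^ 2 / (e 4 * e 6)) ^ 2))"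
    unfolding wp_quotient_def m t1 tw P by (simp add: euler_def)
  also have "\<dots> = - 2 * (c * (1 - w)) * (e 1 * e 3 * e 4 ^ 2 * e 6 ^ 2 / e 12 ^ 2)"
  proof -
    have "x * a^6 * (2 * b^2 / a) * (y * d) / (- ((h * b * a^2 / (f * g)) ^ 2)) = - 2 * (x * y) * (a * d * f^2 * g^2 / h^2)"
      if "a \<noteq> 0" "b \<noteq> 0" "f \<noteq> 0" "g \<noteq> 0" "h \<noteq> 0" for a b d f g h x y :: complex
      using that by (simp add: divide_simps) (simp add: eval_nat_numeral)
    note * = this
    show ?thesis by (rule *) simp_all
  qed
  also have "c * (1 - w) = c - c^5" by (simp add: w_def eval_nat_numeral algebra_simps)
  finally show ?thesis .
qed

lemma norm_q_power: "d \<in> {1..} \<Longrightarrow> norm (q ^ d) < 1"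
  by (rule norm_power_less_1[OF q1]) auto

lemma double_pole_reflect: "double_pole (c * q powi (- k)) = double_pole (1 / c * q powi k)"
  using double_pole_inverse[of "1 / c * q powi k"] by (simp add: power_int_minus field_simps)

lemma eisq_1_12: "eisq 1 12 q = q * e 2 ^ 2 * e 3 ^ 2 * e 4 * e 12 / e 1 ^ 2"
proof -
  define H where "H k = (if k mod int 12 = int 1 then double_pole (1 * q powi k) else 0) +
     - (if k mod int 12 = int 5 then double_pole (1 * q powi k) else 0)" for k
  have "(H has_sum (wp (1 * q ^ 1) (q ^ 12) + - wp (1 * q ^ 5) (q ^ 12))) UNIV"
    unfolding H_def
    by (intro has_sum_add has_sum_uminusI wp_has_sum_residue)
       (use power_admissible(1)[of 1 12] power_admissible(1)[of 5 12] in simp_all)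
  hence H: "(H has_sum (q * e 2 ^ 2 * e 3 ^ 2 * e 4 * e 12 / e 1 ^ 2)) UNIV"
    using wp_diff_12 by simp
  have "eisq 1 12 q = (\<Sum>\<^sub>\<infinity>d\<in>{1..}. chi 12 d * (\<Sum>\<^sub>\<infinity>m\<in>{1..}. chi 1 m * (of_nat m * (q ^ d) ^ m)))"
    using eisq_lambert[OF q1, of 1 12] by (simp add: eis_const_def)
  also have "\<dots> = (\<Sum>\<^sub>\<infinity>d\<in>{1..}. H (int d) + H (- int d))"
  proof (intro infsum_cong)
    fix d :: nat assume d: "d \<in> {1..}"
    define r where "r = d mod 12"
    have "r < 12" by (simp add: r_def)
    hence r: "r = 0 \<or> r = 1 \<or> r = 2 \<or> r = 3 \<or> r = 4 \<or> r = 5 \<or> r = 6 \<or> r = 7 \<or> r = 8 \<or> r = 9 \<or> r = 10 \<or> r = 11"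
      by arith
    have "d mod 4 = r mod 4" "d mod 3 = r mod 3"
      by (simp_all add: r_def mod_mod_cancel)
    hence ch: "chi 12 d = of_int (character4 r * character3 r)"
      using d by (simp add: chi_simps character4_def character3_def)
    have 1: "int d mod 12 = int r" by (simp add: r_def zmod_int)
    hence 2: "(- int d) mod 12 = (- int r) mod 12" by (metis mod_minus_eq)
    have 3: "double_pole (q powi (- int d)) = double_pole (q ^ d)"
      using double_pole_reflect[of 1 "int d"] by simp
    have "H (int d) + H (- int d) = of_int (character4 r * character3 r) * double_pole (q ^ d)"
      unfolding H_def character4_def character3_def
      using r 1 2 3 by (elim disjE) simp_all
    thus "chi 12 d * (\<Sum>\<^sub>\<infinity>m\<in>{1..}. chi 1 m * (of_nat m * (q ^ d) ^ m)) = H (int d) + H (- int d)"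
      by (simp only: sum_chi_1[OF norm_q_power[OF d]] ch)
  qed
  also have "\<dots> = q * e 2 ^ 2 * e 3 ^ 2 * e 4 * e 12 / e 1 ^ 2"
    using infsum_symmetric_int[OF H] by (simp add: H_def)
  finally show ?thesis .
qed

lemma eisq_minus_4_minus_3: "eisq (-4) (-3) q = q * e 1 * e 2 ^ 2 * e 3 * e 12 ^ 2 / e 4 ^ 2"
proof -
  interpret q3: theta_base "q^3" by (rule theta_base_power) simp
  define H where "H k = ((if k mod int 3 = int 1 then double_pole (\<i> * q powi k) else 0) +
     - (if k mod int 3 = int 1 then double_pole ((-\<i>) * q powi k) else 0)) * (1 / (2 * \<i>))" for k
  have "(H has_sum ((wp (\<i> * q ^ 1) (q ^ 3) + - wp ((-\<i>) * q ^ 1) (q ^ 3)) * (1 / (2 * \<i>)))) UNIV"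
    unfolding H_def
    by (intro has_sum_cmult_left has_sum_add has_sum_uminusI wp_has_sum_residue q3.admissible_annulus)
       (use norm_powers[of 1 3] in \<open>simp_all add: norm_mult\<close>)
  moreover have "(wp (\<i> * q ^ 1) (q ^ 3) + - wp ((-\<i>) * q ^ 1) (q ^ 3)) * (1 / (2 * \<i>)) =
      q * e 1 * e 2 ^ 2 * e 3 * e 12 ^ 2 / e 4 ^ 2"
    using wp_diff_i by (simp add: mult_ac)
  ultimately have H: "(H has_sum (q * e 1 * e 2 ^ 2 * e 3 * e 12 ^ 2 / e 4 ^ 2)) UNIV"
    by simp
  have "eisq (-4) (-3) q = (\<Sum>\<^sub>\<infinity>d\<in>{1..}. chi (-3) d * (\<Sum>\<^sub>\<infinity>m\<in>{1..}. chi (-4) m * (of_nat m * (q ^ d) ^ m)))"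
    using eisq_lambert[OF q1, of "-4" "-3"] by (simp add: eis_const_def)
  also have "\<dots> = (\<Sum>\<^sub>\<infinity>d\<in>{1..}. H (int d) + H (- int d))"
  proof (intro infsum_cong)
    fix d :: nat assume d: "d \<in> {1..}"
    define r where "r = d mod 3"
    have "r < 3" by (simp add: r_def)
    hence r: "r = 0 \<or> r = 1 \<or> r = 2" by arith
    have ch: "chi (-3) d = of_int (character3 r)"
      using d by (simp add: chi_simps character3_def r_def)
    have 1: "int d mod 3 = int r" by (simp add: r_def zmod_int)
    hence 2: "(- int d) mod 3 = (- int r) mod 3" by (metis mod_minus_eq)
    have 3: "double_pole (\<i> * q powi (- int d)) = double_pole (- (\<i> * q ^ d))" "double_pole (- (\<i> * q powi (- int d))) = double_pole (\<i> * q ^ d)"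
      using double_pole_reflect[of "\<i>" "int d"] double_pole_reflect[of "-\<i>" "int d"] by simp_all
    have "H (int d) + H (- int d) = of_int (character3 r) * ((double_pole (\<i> * q ^ d) - double_pole (- (\<i> * q ^ d))) / (2 * \<i>))"
      unfolding H_def character3_def
      using r 1 2 3 by (elim disjE) (simp_all add: field_simps)
    thus "chi (-3) d * (\<Sum>\<^sub>\<infinity>m\<in>{1..}. chi (-4) m * (of_nat m * (q ^ d) ^ m)) = H (int d) + H (- int d)"
      by (simp only: sum_chi_minus_4[OF norm_q_power[OF d]] ch)
  qed
  also have "\<dots> = q * e 1 * e 2 ^ 2 * e 3 * e 12 ^ 2 / e 4 ^ 2"
    using infsum_symmetric_int[OF H] by (simp add: H_def)
  finally show ?thesis .
qed

lemma eisq_minus_3_minus_4: "eisq (-3) (-4) q = q * e 1 ^ 2 * e 4 * e 6 ^ 2 * e 12 / e 3 ^ 2"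
proof -
  obtain w :: complex where w: "w^2 + w + 1 = 0" using cube_root_of_unity_exists by blast
  note w3 = cube_root_of_unity(1)[OF w] and w0 = cube_root_of_unity(2)[OF w]
    and nw = cube_root_of_unity(3)[OF w] and ne = cube_root_of_unity(4)[OF w]
  have inv: "1 / w = w^2" "1 / w^2 = w"
    using w3 w0 by (simp_all add: field_simps eval_nat_numeral)
  interpret q4: theta_base "q^4" by (rule theta_base_power) simp
  define H where "H k = ((if k mod int 4 = int 1 then double_pole (w * q powi k) else 0) +
     - (if k mod int 4 = int 1 then double_pole (w^2 * q powi k) else 0)) * (1 / (w - w^2))" for k
  have "(H has_sum ((wp (w * q ^ 1) (q ^ 4) + - wp (w^2 * q ^ 1) (q ^ 4)) * (1 / (w - w^2)))) UNIV"
    unfolding H_def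
    by (intro has_sum_cmult_left has_sum_add has_sum_uminusI wp_has_sum_residue q4.admissible_annulus)
       (use norm_powers[of 1 4] in \<open>simp_all add: norm_mult norm_power nw\<close>)
  moreover have "(wp (w * q ^ 1) (q ^ 4) + - wp (w^2 * q ^ 1) (q ^ 4)) * (1 / (w - w^2)) =
      q * e 1 ^ 2 * e 4 * e 6 ^ 2 * e 12 / e 3 ^ 2"
    using wp_diff_cube_root[OF w] ne by simp
  ultimately have H: "(H has_sum (q * e 1 ^ 2 * e 4 * e 6 ^ 2 * e 12 / e 3 ^ 2)) UNIV"
    by simp
  have "eisq (-3) (-4) q = (\<Sum>\<^sub>\<infinity>d\<in>{1..}. chi (-4) d * (\<Sum>\<^sub>\<infinity>m\<in>{1..}. chi (-3) m * (of_nat m * (q ^ d) ^ m)))"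
    using eisq_lambert[OF q1, of "-3" "-4"] by (simp add: eis_const_def)
  also have "\<dots> = (\<Sum>\<^sub>\<infinity>d\<in>{1..}. H (int d) + H (- int d))"
  proof (intro infsum_cong)
    fix d :: nat assume d: "d \<in> {1..}"
    define r where "r = d mod 4"
    have "r < 4" by (simp add: r_def)
    hence r: "r = 0 \<or> r = 1 \<or> r = 2 \<or> r = 3" by arith
    have ch: "chi (-4) d = of_int (character4 r)"
      using d by (simp add: chi_simps character4_def r_def)
    have 1: "int d mod 4 = int r" by (simp add: r_def zmod_int)
    hence 2: "(- int d) mod 4 = (- int r) mod 4" by (metis mod_minus_eq)
    have 3: "double_pole (w * q powi (- int d)) = double_pole (w^2 * q ^ d)" "double_pole (w^2 * q powi (- int d)) = double_pole (w * q ^ d)"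
      using double_pole_reflect[of w "int d"] double_pole_reflect[of "w^2" "int d"] unfolding inv by simp_all
    have "H (int d) + H (- int d) = of_int (character4 r) * ((double_pole (w * q ^ d) - double_pole (w^2 * q ^ d)) / (w - w^2))"
      unfolding H_def character4_def
      using r 1 2 3 by (elim disjE) (simp_all add: diff_divide_distrib)
    thus "chi (-4) d * (\<Sum>\<^sub>\<infinity>m\<in>{1..}. chi (-3) m * (of_nat m * (q ^ d) ^ m)) = H (int d) + H (- int d)"
      by (simp only: sum_chi_minus_3[OF norm_q_power[OF d] w] ch)
  qed
  also have "\<dots> = q * e 1 ^ 2 * e 4 * e 6 ^ 2 * e 12 / e 3 ^ 2"
    using infsum_symmetric_int[OF H] by (simp add: H_def)
  finally show ?thesis .
qed

lemma eisq_12_1: "eisq 12 1 q = - (e 1 * e 3 * e 4 ^ 2 * e 6 ^ 2 / e 12 ^ 2)"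
proof -
  obtain w :: complex where w: "w^2 + w + 1 = 0" using cube_root_of_unity_exists by blast
  \<comment> \<open>A root of order 4 times one of order 3 has order 12.\<close>
  define c where "c = \<i> * w"
  have c: "c^4 - c^2 + 1 = 0"
  proof -
    have "c^4 - c^2 + 1 = w^4 + w^2 + 1" by (simp add: c_def power_mult_distrib)
    also have "\<dots> = (w^2 + w + 1) * (w^2 - w + 1)" by (simp add: eval_nat_numeral algebra_simps)
    finally show ?thesis by (simp add: w)
  qed
  note p = primitive_12th_root[OF c]
  have nz: "c \<noteq> 0" "c \<noteq> 1" using c by auto
  have "c^5 \<noteq> 1"
  proof
    assume "c^5 = 1"
    moreover have "c^6 = c * c^5" by (simp add: eval_nat_numeral)
    ultimately show False using p(1) c by (simp add: eval_nat_numeral)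
  qed
  hence adm: "admissible c" "admissible (c^5)"
    using p(3) nz by (auto intro!: admissible_circle simp: norm_power)
  have inv: "1 / c = c^11" "1 / c^5 = c^7"
    using p(2) nz by (simp_all add: field_simps flip: power_Suc power_add)
  define H where "H k = (double_pole (c * q powi k) + - double_pole (c^5 * q powi k)) * (1 / (2 * (c - c^5)))" for k
  have "(H has_sum ((wp c q + - wp (c^5) q) * (1 / (2 * (c - c^5))))) UNIV"
    unfolding H_def
    by (intro has_sum_cmult_left has_sum_add has_sum_uminusI wp_has_sum adm)
  moreover have "(wp c q + - wp (c^5) q) * (1 / (2 * (c - c^5))) = - (e 1 * e 3 * e 4 ^ 2 * e 6 ^ 2 / e 12 ^ 2)"
  proof -
    have "(x + - y) * (1 / (2 * s)) = - t" if "x - y = - 2 * s * t" "s \<noteq> 0" for x y s t :: complex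
      using that by (simp add: field_simps)
    from this[OF wp_diff_12th_root[OF c] p(5)] show ?thesis .
  qed
  ultimately have H: "(H has_sum (- (e 1 * e 3 * e 4 ^ 2 * e 6 ^ 2 / e 12 ^ 2))) UNIV"
    by simp
  \<comment> \<open>The term at 0 produces the constant term of the Eisenstein series.\<close>
  have H0: "H 0 = -1"
  proof -
    define s where "s = c - c^5"
    have s: "s^2 = 3" "s \<noteq> 0" using p(4,5) by (simp_all add: s_def)
    have "c * c^5 = -1" using p(1) by (simp add: eval_nat_numeral)
    have "(1 - c)^2 = (s - 2) * c" "(1 - c^5)^2 = (- s - 2) * c^5"
      using \<open>c * c^5 = -1\<close> by (simp_all add: s_def power2_eq_square algebra_simps)
    hence "double_pole c = 1 / (s - 2)" "double_pole (c^5) = 1 / (- s - 2)"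
      using nz by (simp_all add: double_pole_def)
    moreover have inv: "(s - 2) * (- s - 2) = 1" using s(1) by (simp add: algebra_simps power2_eq_square)
    hence "1 / (s - 2) = - s - 2" "1 / (- s - 2) = s - 2"
      by (metis inverse_unique inverse_eq_divide, metis inverse_unique inverse_eq_divide mult.commute)
    ultimately have "double_pole c + - double_pole (c^5) = - 2 * s" by simp
    thus ?thesis using s by (simp add: H_def s_def[symmetric])
  qed
  have "eisq 12 1 q = -1 + (\<Sum>\<^sub>\<infinity>d\<in>{1..}. chi 1 d * (\<Sum>\<^sub>\<infinity>m\<in>{1..}. chi 12 m * (of_nat m * (q ^ d) ^ m)))"
    using eisq_lambert[OF q1, of 12 1] by (simp add: eis_const_def)
  also have "(\<Sum>\<^sub>\<infinity>d\<in>{1..}. chi 1 d * (\<Sum>\<^sub>\<infinity>m\<in>{1..}. chi 12 m * (of_nat m * (q ^ d) ^ m))) =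
     (\<Sum>\<^sub>\<infinity>d\<in>{1..}. H (int d) + H (- int d))"
  proof (intro infsum_cong)
    fix d :: nat assume d: "d \<in> {1..}"
    have 3: "double_pole (c * q powi (- int d)) = double_pole (c^11 * q ^ d)" "double_pole (c^5 * q powi (- int d)) = double_pole (c^7 * q ^ d)"
      using double_pole_reflect[of c "int d"] double_pole_reflect[of "c^5" "int d"] unfolding inv by simp_all
    have "H (int d) + H (- int d) = (double_pole (c * q ^ d) - double_pole (c^5 * q ^ d) + (double_pole (c^11 * q ^ d) - double_pole (c^7 * q ^ d))) / (2 * (c - c^5))"
      unfolding H_def 3 by (simp add: add_divide_distrib)
    thus "chi 1 d * (\<Sum>\<^sub>\<infinity>m\<in>{1..}. chi 12 m * (of_nat m * (q ^ d) ^ m)) = H (int d) + H (- int d)"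
      using d by (simp only: sum_chi_12[OF norm_q_power[OF d] c]) (simp add: chi_simps)
  qed
  also have "\<dots> = - (e 1 * e 3 * e 4 ^ 2 * e 6 ^ 2 / e 12 ^ 2) + 1"
    using infsum_symmetric_int[OF H] H0 by simp
  finally show ?thesis by simp
qed

end

section \<open>The Eisenstein series in terms of theta squares\<close>

text \<open>The two quartic forms \<open>(X + Y) (3 Y - X)\<close> and \<open>(X - Y) (X + 3 Y)\<close> add up to \<open>4 X Y\<close>.\<close>
lemma quartic_relation_complement:
  fixes x y a :: complex
  assumes "(x^2 + y^2) * (3 * y^2 - x^2) = 4 * (x * y) * a"
  shows "4 * (x * y) * (x * y - a) = (x^2 - y^2) * (x^2 + 3 * y^2)"
proof -
  have "4 * (x * y) * (x * y - a) = 4 * (x * y) * (x * y) - (x^2 + y^2) * (3 * y^2 - x^2)"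
    unfolding assms by (simp add: algebra_simps)
  also have "\<dots> = (x^2 - y^2) * (x^2 + 3 * y^2)"
    by (simp add: algebra_simps power2_eq_square)
  finally show ?thesis .
qed

context theta_base
begin

lemma phiq_minus_eta: "phiq (-q) = e 1 ^ 2 / e 2"
  using theta_base.phiq_eq_theta[OF minus_theta_base] theta_q_base_2 by simp

lemma phiq_cube_eta:
  "phiq (q^3) = e 6 ^ 5 / (e 3 ^ 2 * e 12 ^ 2)" "phiq (-(q^3)) = e 3 ^ 2 / e 6"
proof -
  interpret q3: theta_base "q^3" by (rule theta_base_power) simp
  show "phiq (q^3) = e 6 ^ 5 / (e 3 ^ 2 * e 12 ^ 2)" "phiq (-(q^3)) = e 3 ^ 2 / e 6"
    using q3.phiq_eta q3.phiq_minus_eta by (simp_all flip: power_mult)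
qed

lemma phiq_square_sum_triple_3: "phiq q ^ 2 + 3 * phiq (q^3) ^ 2 = 4 * e 2 * e 4 ^ 2 * e 6 ^ 3 / (e 1 * e 3 * e 12 ^ 2)"
proof -
  have "phiq q ^ 2 + 3 * phiq (q^3) ^ 2 =
     2 * (phiq q ^ 2 + phiq (q^3) ^ 2) - (phiq q ^ 2 - phiq (q^3) ^ 2)" by simp
  also have "\<dots> = 4 * e 2 ^ 3 * e 6 / (e 1 ^ 2 * e 3 * e 4 ^ 2 * e 12) * (e 3 ^ 3 * e 4 - q * e 1 * e 12 ^ 3)"
  proof -
    have "2 * (2 * b^3 * c^2 * f / (a^2 * d * g)) - 4 * x * b^3 * f * g^2 / (a * c * d^2) =
       4 * b^3 * f / (a^2 * c * d^2 * g) * (c^3 * d - x * a * g^3)"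
      if "a \<noteq> 0" "b \<noteq> 0" "c \<noteq> 0" "d \<noteq> 0" "f \<noteq> 0" "g \<noteq> 0" for a b c d f g x :: complex
      using that by (simp add: divide_simps) (simp add: eval_nat_numeral algebra_simps)
    note * = this
    show ?thesis unfolding phiq_square_sum_3 phiq_square_diff_3 by (rule *) simp_all
  qed
  also have "\<dots> = 4 * e 2 * e 4 ^ 2 * e 6 ^ 3 / (e 1 * e 3 * e 12 ^ 2)"
  proof -
    have "4 * b^3 * f / (a^2 * c * d^2 * g) * (a * d^4 * f^2 / (b^2 * g)) = 4 * b * d^2 * f^3 / (a * c * g^2)"
      if "a \<noteq> 0" "b \<noteq> 0" "c \<noteq> 0" "d \<noteq> 0" "f \<noteq> 0" "g \<noteq> 0" for a b c d f g :: complex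
      using that by (simp add: divide_simps) (simp add: eval_nat_numeral algebra_simps)
    note * = this
    show ?thesis unfolding eta_three_term_1 by (rule *) simp_all
  qed
  finally show ?thesis .
qed

lemma phiq_square_diff_triple_3: "3 * phiq (q^3) ^ 2 - phiq q ^ 2 = 2 * e 1 ^ 2 * e 2 * e 6 ^ 3 / (e 3 ^ 2 * e 4 * e 12)"
proof -
  have "3 * phiq (q^3) ^ 2 - phiq q ^ 2 =
     (phiq q ^ 2 + phiq (q^3) ^ 2) - 2 * (phiq q ^ 2 - phiq (q^3) ^ 2)" by simp
  also have "\<dots> = 2 * e 2 ^ 3 * e 6 / (e 1 ^ 2 * e 3 * e 4 ^ 2 * e 12) * (e 3 ^ 3 * e 4 - 4 * q * e 1 * e 12 ^ 3)"
  proof -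
    have "2 * b^3 * c^2 * f / (a^2 * d * g) - 2 * (4 * x * b^3 * f * g^2 / (a * c * d^2)) =
       2 * b^3 * f / (a^2 * c * d^2 * g) * (c^3 * d - 4 * x * a * g^3)"
      if "a \<noteq> 0" "b \<noteq> 0" "c \<noteq> 0" "d \<noteq> 0" "f \<noteq> 0" "g \<noteq> 0" for a b c d f g x :: complex
      using that by (simp add: divide_simps) (simp add: eval_nat_numeral algebra_simps)
    note * = this
    show ?thesis unfolding phiq_square_sum_3 phiq_square_diff_3 by (rule *) simp_all
  qed
  also have "\<dots> = 2 * e 1 ^ 2 * e 2 * e 6 ^ 3 / (e 3 ^ 2 * e 4 * e 12)"
  proof -
    have "2 * b^3 * f / (a^2 * c * d^2 * g) * (a^4 * d * f^2 / (b^2 * c)) = 2 * a^2 * b * f^3 / (c^2 * d * g)"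
      if "a \<noteq> 0" "b \<noteq> 0" "c \<noteq> 0" "d \<noteq> 0" "f \<noteq> 0" "g \<noteq> 0" for a b c d f g :: complex
      using that by (simp add: divide_simps) (simp add: eval_nat_numeral algebra_simps)
    note * = this
    show ?thesis unfolding eta_three_term_4 by (rule *) simp_all
  qed
  finally show ?thesis .
qed

text \<open>A form of the modular equation of degree 3, read off from eta exponents.\<close>
lemma phiq_quartic_relation:
  "(phiq q ^ 2 + phiq (q^3) ^ 2) * (3 * phiq (q^3) ^ 2 - phiq q ^ 2) = 4 * (phiq q * phiq (q^3)) * (phiq (-q) * phiq (-(q^3)))"
proof -
  have "2 * b^3 * c^2 * f / (a^2 * d * g) * (2 * a^2 * b * f^3 / (c^2 * d * g)) =
     4 * (b^5 / (a^2 * d^2) * (f^5 / (c^2 * g^2))) * (a^2 / b * (c^2 / f))"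
    if "a \<noteq> 0" "b \<noteq> 0" "c \<noteq> 0" "d \<noteq> 0" "f \<noteq> 0" "g \<noteq> 0" for a b c d f g :: complex
    using that by (simp add: divide_simps) (simp add: eval_nat_numeral algebra_simps)
  note * = this
  show ?thesis
    unfolding phiq_square_sum_3 phiq_square_diff_triple_3 unfolding phiq_eta phiq_minus_eta phiq_cube_eta by (rule *) simp_all
qed

text \<open>All factors are known eta quotients, so only exponents are compared.\<close>
lemma eisq_products:
  defines "X \<equiv> phiq q ^ 2" and "Y \<equiv> phiq (q^3) ^ 2" and "Z \<equiv> phiq q * phiq (q^3)"
  shows "32 * Z * eisq 1 12 q = (X - Y) * (X + Y) * (X + 3 * Y)"
    and "32 * Z * eisq (-3) (-4) q = (X - Y) * (3 * Y - X) * (X + 3 * Y)"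
    and "16 * Z * eisq (-4) (-3) q = (X - Y) * (X + Y) * (3 * Y - X)"
    and "16 * Z * eisq 12 1 q = - ((X + Y) * (3 * Y - X) * (X + 3 * Y))"
proof -
  note defs = X_def Y_def Z_def
  have 1: "32 * (b^5 / (a^2 * d^2) * (f^5 / (c^2 * g^2))) * (x * b^2 * c^2 * d * g / a^2) =
      4 * x * b^3 * f * g^2 / (a * c * d^2) * (2 * b^3 * c^2 * f / (a^2 * d * g)) * (4 * b * d^2 * f^3 / (a * c * g^2))"
    if "a \<noteq> 0" "b \<noteq> 0" "c \<noteq> 0" "d \<noteq> 0" "f \<noteq> 0" "g \<noteq> 0" for a b c d f g x :: complex
    using that by (simp add: divide_simps) (simp add: eval_nat_numeral algebra_simps)
  show "32 * Z * eisq 1 12 q = (X - Y) * (X + Y) * (X + 3 * Y)"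
    unfolding defs phiq_square_sum_3 phiq_square_diff_3 phiq_square_sum_triple_3 eisq_1_12 unfolding phiq_eta phiq_cube_eta
    by (rule 1) simp_all
  have 2: "32 * (b^5 / (a^2 * d^2) * (f^5 / (c^2 * g^2))) * (x * a^2 * d * f^2 * g / c^2) =
      4 * x * b^3 * f * g^2 / (a * c * d^2) * (2 * a^2 * b * f^3 / (c^2 * d * g)) * (4 * b * d^2 * f^3 / (a * c * g^2))"
    if "a \<noteq> 0" "b \<noteq> 0" "c \<noteq> 0" "d \<noteq> 0" "f \<noteq> 0" "g \<noteq> 0" for a b c d f g x :: complex
    using that by (simp add: divide_simps) (simp add: eval_nat_numeral algebra_simps)
  show "32 * Z * eisq (-3) (-4) q = (X - Y) * (3 * Y - X) * (X + 3 * Y)"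
    unfolding defs phiq_square_sum_3 phiq_square_diff_3 phiq_square_sum_triple_3 phiq_square_diff_triple_3 eisq_minus_3_minus_4 unfolding phiq_eta phiq_cube_eta
    by (rule 2) simp_all
  have 3: "16 * (b^5 / (a^2 * d^2) * (f^5 / (c^2 * g^2))) * (x * a * b^2 * c * g^2 / d^2) =
      4 * x * b^3 * f * g^2 / (a * c * d^2) * (2 * b^3 * c^2 * f / (a^2 * d * g)) * (2 * a^2 * b * f^3 / (c^2 * d * g))"
    if "a \<noteq> 0" "b \<noteq> 0" "c \<noteq> 0" "d \<noteq> 0" "f \<noteq> 0" "g \<noteq> 0" for a b c d f g x :: complex
    using that by (simp add: divide_simps) (simp add: eval_nat_numeral algebra_simps)
  show "16 * Z * eisq (-4) (-3) q = (X - Y) * (X + Y) * (3 * Y - X)"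
    unfolding defs phiq_square_sum_3 phiq_square_diff_3 phiq_square_diff_triple_3 eisq_minus_4_minus_3 unfolding phiq_eta phiq_cube_eta
    by (rule 3) simp_all
  have 4: "16 * (b^5 / (a^2 * d^2) * (f^5 / (c^2 * g^2))) * (- (a * c * d^2 * f^2 / g^2)) =
      - ((2 * b^3 * c^2 * f / (a^2 * d * g)) * (2 * a^2 * b * f^3 / (c^2 * d * g)) * (4 * b * d^2 * f^3 / (a * c * g^2)))"
    if "a \<noteq> 0" "b \<noteq> 0" "c \<noteq> 0" "d \<noteq> 0" "f \<noteq> 0" "g \<noteq> 0" for a b c d f g :: complex
    using that by (simp add: divide_simps) (simp add: eval_nat_numeral algebra_simps)
  show "16 * Z * eisq 12 1 q = - ((X + Y) * (3 * Y - X) * (X + 3 * Y))"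
    unfolding defs phiq_square_sum_3 phiq_square_sum_triple_3 phiq_square_diff_triple_3 eisq_12_1 unfolding phiq_eta phiq_cube_eta
    by (rule 4) simp_all
qed

text \<open>The difference is not a product by itself; but \<open>4 Z\<close> times it is \<open>U T\<close>, by the quartic relation.\<close>
lemma phiq_product_odd_part: "phiq q * phiq (q^3) - phiq (-q) * phiq (-(q^3)) = 4 * q * e 4 ^ 2 * e 12 ^ 2 / (e 2 * e 6)"
proof -
  have nz: "phiq q \<noteq> 0" "phiq (q^3) \<noteq> 0"
    unfolding phiq_eta phiq_cube_eta by simp_all
  have "4 * (phiq q * phiq (q^3)) * (phiq q * phiq (q^3) - phiq (-q) * phiq (-(q^3))) =
    (phiq q ^ 2 - phiq (q^3) ^ 2) * (phiq q ^ 2 + 3 * phiq (q^3) ^ 2)"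
    by (rule quartic_relation_complement[OF phiq_quartic_relation])
  also have "\<dots> = 4 * (phiq q * phiq (q^3)) * (4 * q * e 4 ^ 2 * e 12 ^ 2 / (e 2 * e 6))"
  proof -
    have "4 * x * b^3 * f * g^2 / (a * c * d^2) * (4 * b * d^2 * f^3 / (a * c * g^2)) =
       4 * (b^5 / (a^2 * d^2) * (f^5 / (c^2 * g^2))) * (4 * x * d^2 * g^2 / (b * f))"
      if "a \<noteq> 0" "b \<noteq> 0" "c \<noteq> 0" "d \<noteq> 0" "f \<noteq> 0" "g \<noteq> 0" for a b c d f g x :: complex
      using that by (simp add: divide_simps) (simp add: eval_nat_numeral algebra_simps)
    note * = this
    show ?thesis unfolding phiq_square_diff_3 phiq_square_sum_triple_3 unfolding phiq_eta phiq_cube_eta by (rule *) simp_all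
  qed
  finally have "4 * (phiq q * phiq (q^3)) * (phiq q * phiq (q^3) - phiq (-q) * phiq (-(q^3))) =
    4 * (phiq q * phiq (q^3)) * (4 * q * e 4 ^ 2 * e 12 ^ 2 / (e 2 * e 6))" .
  moreover have "4 * (phiq q * phiq (q^3)) \<noteq> 0" using nz by simp
  ultimately show ?thesis by (simp only: mult_cancel_left simp_thms)
qed

text \<open>Again equalities of eta quotients, now with factors up to \<open>e 24\<close>.\<close>
lemma level_24_relations:
  defines "M \<equiv> phiq q * phiq (q^3) - phiq (-q) * phiq (-(q^3))"
    and "G \<equiv> phiq (q^2) * phiq (q^6)" and "X2 \<equiv> phiq (q^2) ^ 2" and "Y2 \<equiv> phiq (q^6) ^ 2"
  shows "M \<noteq> 0" "G \<noteq> 0"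
    and "2 * G * (phiq q ^ 2 - phiq (-q) ^ 2) = (X2 + 3 * Y2) * M"
    and "2 * G * (phiq (q^3) ^ 2 - phiq (-(q^3)) ^ 2) = (X2 - Y2) * M"
    and "M ^ 2 = (X2 - Y2) * (X2 + 3 * Y2)"
proof -
  interpret q2: theta_base "q^2" by (rule theta_base_power) simp
  interpret q3: theta_base "q^3" by (rule theta_base_power) simp
  note defs = M_def G_def X2_def Y2_def
  have eta: "phiq (q^2) = e 4 ^ 5 / (e 2 ^ 2 * e 8 ^ 2)" "phiq (q^6) = e 12 ^ 5 / (e 6 ^ 2 * e 24 ^ 2)"
    using q2.phiq_eta q2.phiq_cube_eta(1) by (simp_all flip: power_mult)
  have T2: "phiq (q^2) ^ 2 + 3 * phiq (q^6) ^ 2 = 4 * e 4 * e 8 ^ 2 * e 12 ^ 3 / (e 2 * e 6 * e 24 ^ 2)"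
    using q2.phiq_square_sum_triple_3 by (simp flip: power_mult)
  have U2: "phiq (q^2) ^ 2 - phiq (q^6) ^ 2 = 4 * q ^ 2 * e 4 ^ 3 * e 12 * e 24 ^ 2 / (e 2 * e 6 * e 8 ^ 2)"
    using q2.phiq_square_diff_3 by (simp flip: power_mult)
  have nu: "phiq (q^3) ^ 2 - phiq (-(q^3)) ^ 2 = 8 * q ^ 3 * e 24 ^ 4 / e 12 ^ 2"
    using q3.phiq_square_odd_part by (simp flip: power_mult)
  show "M \<noteq> 0" unfolding M_def phiq_product_odd_part using q0 by simp
  show "G \<noteq> 0" unfolding G_def eta by simp
  \<comment> \<open>Here \<open>a\<close>, \<open>b\<close>, \<open>c\<close>, \<open>d\<close>, \<open>f\<close>, \<open>g\<close> stand for \<open>e 2\<close>, \<open>e 4\<close>, \<open>e 8\<close>, \<open>e 6\<close>, \<open>e 12\<close>, \<open>e 24\<close>.\<close>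
  have 1: "2 * (b^5 / (a^2 * c^2) * (f^5 / (d^2 * g^2))) * (8 * x * c^4 / b^2) =
      4 * b * c^2 * f^3 / (a * d * g^2) * (4 * x * b^2 * f^2 / (a * d))"
    if "a \<noteq> 0" "b \<noteq> 0" "c \<noteq> 0" "d \<noteq> 0" "f \<noteq> 0" "g \<noteq> 0" for a b c d f g x :: complex
    using that by (simp add: divide_simps) (simp add: eval_nat_numeral algebra_simps)
  show "2 * G * (phiq q ^ 2 - phiq (-q) ^ 2) = (X2 + 3 * Y2) * M"
    unfolding defs phiq_product_odd_part T2 phiq_square_odd_part unfolding eta by (rule 1) simp_all
  have 2: "2 * (b^5 / (a^2 * c^2) * (f^5 / (d^2 * g^2))) * (8 * x^3 * g^4 / f^2) =
      4 * x^2 * b^3 * f * g^2 / (a * d * c^2) * (4 * x * b^2 * f^2 / (a * d))"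
    if "a \<noteq> 0" "b \<noteq> 0" "c \<noteq> 0" "d \<noteq> 0" "f \<noteq> 0" "g \<noteq> 0" for a b c d f g x :: complex
    using that by (simp add: divide_simps) (simp add: eval_nat_numeral algebra_simps)
  show "2 * G * (phiq (q^3) ^ 2 - phiq (-(q^3)) ^ 2) = (X2 - Y2) * M"
    unfolding defs phiq_product_odd_part U2 nu unfolding eta by (rule 2) simp_all
  have 3: "(4 * x * b^2 * f^2 / (a * d)) ^ 2 =
      4 * x^2 * b^3 * f * g^2 / (a * d * c^2) * (4 * b * c^2 * f^3 / (a * d * g^2))"
    if "a \<noteq> 0" "b \<noteq> 0" "c \<noteq> 0" "d \<noteq> 0" "f \<noteq> 0" "g \<noteq> 0" for a b c d f g x :: complex
    using that by (simp add: divide_simps) (simp add: eval_nat_numeral algebra_simps)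
  show "M ^ 2 = (X2 - Y2) * (X2 + 3 * Y2)"
    unfolding defs phiq_product_odd_part T2 U2 by (rule 3) simp_all
qed

section \<open>The rows of the table\<close>

text \<open>Multiplication by \<open>32 Z\<close> turns both sides into polynomials in \<open>X\<close> and \<open>Y\<close>.\<close>
lemma rows_level_12:
  defines "x \<equiv> phiq q" and "y \<equiv> phiq (q^3)"
  shows "x * x * x * y = - eisq 12 1 q + 6 * eisq 1 12 q + 3 * eisq (-4) (-3) q - 2 * eisq (-3) (-4) q"
    and "x * y * y * y = - eisq 12 1 q + 2 * eisq 1 12 q - eisq (-4) (-3) q + 2 * eisq (-3) (-4) q"
proof -
  have nz: "x \<noteq> 0" "y \<noteq> 0"
    unfolding x_def y_def phiq_eta phiq_cube_eta by simp_all
  note E = eisq_products[folded x_def y_def]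
  have "32 * (x * y) * (- eisq 12 1 q + 6 * eisq 1 12 q + 3 * eisq (-4) (-3) q - 2 * eisq (-3) (-4) q) =
      - 2 * (16 * (x * y) * eisq 12 1 q) + 6 * (32 * (x * y) * eisq 1 12 q) +
      6 * (16 * (x * y) * eisq (-4) (-3) q) - 2 * (32 * (x * y) * eisq (-3) (-4) q)"
    by (simp add: algebra_simps)
  also have "\<dots> = 32 * (x * y) * (x * x * x * y)"
    unfolding E by (simp add: algebra_simps power2_eq_square)
  finally show "x * x * x * y = - eisq 12 1 q + 6 * eisq 1 12 q + 3 * eisq (-4) (-3) q - 2 * eisq (-3) (-4) q"
    using nz by simp
  have "32 * (x * y) * (- eisq 12 1 q + 2 * eisq 1 12 q - eisq (-4) (-3) q + 2 * eisq (-3) (-4) q) =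
      - 2 * (16 * (x * y) * eisq 12 1 q) + 2 * (32 * (x * y) * eisq 1 12 q) -
      2 * (16 * (x * y) * eisq (-4) (-3) q) + 2 * (32 * (x * y) * eisq (-3) (-4) q)"
    by (simp add: algebra_simps)
  also have "\<dots> = 32 * (x * y) * (x * y * y * y)"
    unfolding E by (simp add: algebra_simps power2_eq_square)
  finally show "x * y * y * y = - eisq 12 1 q + 2 * eisq 1 12 q - eisq (-4) (-3) q + 2 * eisq (-3) (-4) q"
    using nz by simp
qed

text \<open>The level 24 relations express \<open>x\<^sup>2\<close>, \<open>y\<^sup>2\<close> and \<open>x y\<close> through \<open>s = \<phi>(q\<^sup>2)\<^sup>2\<close>, \<open>t = \<phi>(q\<^sup>6)\<^sup>2\<close>, \<open>p = g h\<close> and the odd part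
  \<open>M\<close> of \<open>x y\<close>. After multiplication by \<open>16 p\<close>, both sides of each row are polynomials in these four, subject to
  \<open>p\<^sup>2 = s t\<close> and \<open>M\<^sup>2 = (s - t) (s + 3 t)\<close>.\<close>
lemma rows_level_24:
  defines "x \<equiv> phiq q" and "y \<equiv> phiq (q^3)" and "g \<equiv> phiq (q^2)" and "h \<equiv> phiq (q^6)"
  shows "x * x * g * h = - eisq 12 1 (q^2) + 3 * eisq 1 12 q + 3 * eisq (-4) (-3) (q^2) + eisq (-3) (-4) q"
    and "x * g * g * y = - eisq 12 1 (q^2) + 3 * eisq 1 12 q - 3 * eisq (-4) (-3) (q^2) - eisq (-3) (-4) q"
    and "x * y * h * h = - eisq 12 1 (q^2) + eisq 1 12 q + eisq (-4) (-3) (q^2) + eisq (-3) (-4) q"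
    and "g * y * y * h = - eisq 12 1 (q^2) + eisq 1 12 q - eisq (-4) (-3) (q^2) - eisq (-3) (-4) q"
proof -
  interpret q2: theta_base "q^2" by (rule theta_base_power) simp
  interpret q3: theta_base "q^3" by (rule theta_base_power) simp
  define xm ym where "xm = phiq (-q)" and "ym = phiq (-(q^3))"
  note fold = x_def[symmetric] y_def[symmetric] g_def[symmetric] h_def[symmetric] xm_def[symmetric] ym_def[symmetric]
  define M where "M = x * y - xm * ym"
  define p where "p = g * h"
  define s t where "s = g^2" and "t = h^2"
  have nz: "M \<noteq> 0" "p \<noteq> 0" "x * y \<noteq> 0"
    using level_24_relations(1,2) unfolding fold M_def p_def
    by (auto simp: x_def y_def phiq_eta phiq_cube_eta)
  have L: "2 * p * (x^2 - xm^2) = (s + 3 * t) * M" "2 * p * (y^2 - ym^2) = (s - t) * M"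
    "M^2 = (s - t) * (s + 3 * t)"
    using level_24_relations(3-5) unfolding fold M_def p_def s_def t_def by auto
  have even: "x^2 + xm^2 = 2 * s" "y^2 + ym^2 = 2 * t"
    using phiq_square_even_part q3.phiq_square_even_part unfolding s_def t_def x_def y_def xm_def ym_def g_def h_def
    by (simp_all flip: power_mult)
  have pst: "p^2 = s * t" by (simp add: p_def s_def t_def power_mult_distrib)
  have VW: "(x^2 + y^2) * (3 * y^2 - x^2) = 4 * (x * y) * (xm * ym)"
    using phiq_quartic_relation unfolding fold .
  have UT: "(x^2 - y^2) * (x^2 + 3 * y^2) = 4 * (x * y) * M"
    unfolding M_def by (rule quartic_relation_complement[OF VW, symmetric])
  have X: "4 * p * x^2 = 4 * p * s + (s + 3 * t) * M" and Y: "4 * p * y^2 = 4 * p * t + (s - t) * M"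
  proof -
    have m: "xm^2 = 2 * s - x^2" "ym^2 = 2 * t - y^2" using even by (simp_all add: eq_diff_eq add.commute)
    show "4 * p * x^2 = 4 * p * s + (s + 3 * t) * M"
      unfolding L(1)[symmetric] m by (simp add: algebra_simps)
    show "4 * p * y^2 = 4 * p * t + (s - t) * M"
      unfolding L(2)[symmetric] m by (simp add: algebra_simps)
  qed
  have Z: "4 * p * (x * y) = s * (s - t) + t * (s + 3 * t) + 2 * p * M"
  proof -
    have "2 * ((x * y + xm * ym) * M) = (x^2 - xm^2) * (y^2 + ym^2) + (x^2 + xm^2) * (y^2 - ym^2)"
      unfolding M_def by (simp add: algebra_simps power2_eq_square)
    hence "2 * ((x * y + xm * ym) * M) = 2 * (t * (x^2 - xm^2) + s * (y^2 - ym^2))"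
      unfolding even by (simp add: algebra_simps)
    hence "(x * y + xm * ym) * M = t * (x^2 - xm^2) + s * (y^2 - ym^2)"
      by (simp only: mult_cancel_left) simp
    hence "2 * p * ((x * y + xm * ym) * M) = 2 * p * (t * (x^2 - xm^2) + s * (y^2 - ym^2))"
      by (simp only:)
    also have "\<dots> = t * (2 * p * (x^2 - xm^2)) + s * (2 * p * (y^2 - ym^2))"
      by (simp add: algebra_simps)
    also have "\<dots> = (s * (s - t) + t * (s + 3 * t)) * M"
      unfolding L(1,2) by (simp add: algebra_simps)
    finally have "2 * p * (x * y + xm * ym) = s * (s - t) + t * (s + 3 * t)"
      using nz(1) by (simp flip: mult.assoc)
    moreover have "4 * p * (x * y) = 2 * p * (x * y + xm * ym) + 2 * p * M"
      unfolding M_def by (simp add: algebra_simps)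
    ultimately show ?thesis by simp
  qed
  have E: "8 * eisq 1 12 q = (x^2 + y^2) * M" "8 * eisq (-3) (-4) q = (3 * y^2 - x^2) * M"
  proof -
    have "4 * (x * y) * (8 * eisq 1 12 q) = 32 * (x * y) * eisq 1 12 q" by simp
    also have "\<dots> = (x^2 + y^2) * ((x^2 - y^2) * (x^2 + 3 * y^2))"
      using eisq_products(1) unfolding fold by (simp only: mult_ac)
    also have "\<dots> = 4 * (x * y) * ((x^2 + y^2) * M)" unfolding UT by (simp only: mult_ac)
    finally show "8 * eisq 1 12 q = (x^2 + y^2) * M" using nz(3) by simp
    have "4 * (x * y) * (8 * eisq (-3) (-4) q) = 32 * (x * y) * eisq (-3) (-4) q" by simp
    also have "\<dots> = (3 * y^2 - x^2) * ((x^2 - y^2) * (x^2 + 3 * y^2))"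
      using eisq_products(2) unfolding fold by (simp only: mult_ac)
    also have "\<dots> = 4 * (x * y) * ((3 * y^2 - x^2) * M)" unfolding UT by (simp only: mult_ac)
    finally show "8 * eisq (-3) (-4) q = (3 * y^2 - x^2) * M" using nz(3) by simp
  qed
  have A: "16 * p * eisq 1 12 q = 2 * p * (s + t) * M + (s + t) * M^2"
  proof -
    have "2 * (16 * p * eisq 1 12 q) = 4 * p * (8 * eisq 1 12 q)" by simp
    also have "\<dots> = (4 * p * x^2 + 4 * p * y^2) * M" unfolding E by (simp add: algebra_simps)
    also have "\<dots> = 2 * (2 * p * (s + t) * M + (s + t) * M^2)"
      unfolding X Y by (simp add: algebra_simps power2_eq_square)
    finally show ?thesis by (simp only: mult_cancel_left) simp
  qed
  have B: "16 * p * eisq (-3) (-4) q = 2 * p * (3 * t - s) * M + (s - 3 * t) * M^2"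
  proof -
    have "2 * (16 * p * eisq (-3) (-4) q) = 4 * p * (8 * eisq (-3) (-4) q)" by simp
    also have "\<dots> = (3 * (4 * p * y^2) - 4 * p * x^2) * M" unfolding E by (simp add: algebra_simps)
    also have "\<dots> = 2 * (2 * p * (3 * t - s) * M + (s - 3 * t) * M^2)"
      unfolding X Y by (simp add: algebra_simps power2_eq_square)
    finally show ?thesis by (simp only: mult_cancel_left) simp
  qed
  have C: "16 * p * eisq (-4) (-3) (q^2) = (s - t) * (s + t) * (3 * t - s)"
    and D: "16 * p * eisq 12 1 (q^2) = - ((s + t) * (3 * t - s) * (s + 3 * t))"
    using q2.eisq_products(3,4) unfolding p_def s_def t_def g_def h_def by (simp_all flip: power_mult)
  have combine: "r = - eisq 12 1 (q^2) + k * eisq 1 12 q + l * eisq (-4) (-3) (q^2) + m * eisq (-3) (-4) q"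
    if "16 * p * r = - (16 * p * eisq 12 1 (q^2)) + k * (16 * p * eisq 1 12 q) +
       l * (16 * p * eisq (-4) (-3) (q^2)) + m * (16 * p * eisq (-3) (-4) q)" for r k l m
  proof -
    have "16 * p * r = 16 * p * (- eisq 12 1 (q^2) + k * eisq 1 12 q + l * eisq (-4) (-3) (q^2) + m * eisq (-3) (-4) q)"
      unfolding that by (simp add: algebra_simps)
    thus ?thesis using nz(2) by simp
  qed
  have "16 * p * (x^2 * p) = 4 * p * (4 * p * x^2)" "16 * p * (y^2 * p) = 4 * p * (4 * p * y^2)" by simp_all
  hence lhs_p: "16 * p * (x^2 * p) = 16 * (s * t) * s + 4 * p * (s + 3 * t) * M"
    "16 * p * (y^2 * p) = 16 * (s * t) * t + 4 * p * (s - t) * M"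
    unfolding X Y pst[symmetric] by (simp_all add: algebra_simps power2_eq_square)
  have "16 * p * (x * y * r) = 4 * r * (4 * p * (x * y))" for r by simp
  hence lhs_xy: "16 * p * (x * y * r) = 4 * r * (s * (s - t) + t * (s + 3 * t) + 2 * p * M)" for r
    unfolding Z .
  have "x^2 * p = - eisq 12 1 (q^2) + 3 * eisq 1 12 q + 3 * eisq (-4) (-3) (q^2) + 1 * eisq (-3) (-4) q"
    by (rule combine, simp only: lhs_p A B C D L(3)) (simp add: algebra_simps)
  thus "x * x * g * h = - eisq 12 1 (q^2) + 3 * eisq 1 12 q + 3 * eisq (-4) (-3) (q^2) + eisq (-3) (-4) q"
    by (simp add: p_def power2_eq_square mult_ac)
  have "x * y * s = - eisq 12 1 (q^2) + 3 * eisq 1 12 q + (-3) * eisq (-4) (-3) (q^2) + (-1) * eisq (-3) (-4) q"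
    by (rule combine, simp only: lhs_xy A B C D L(3)) (simp add: algebra_simps)
  thus "x * g * g * y = - eisq 12 1 (q^2) + 3 * eisq 1 12 q - 3 * eisq (-4) (-3) (q^2) - eisq (-3) (-4) q"
    by (simp add: s_def power2_eq_square mult_ac)
  have "x * y * t = - eisq 12 1 (q^2) + 1 * eisq 1 12 q + 1 * eisq (-4) (-3) (q^2) + 1 * eisq (-3) (-4) q"
    by (rule combine, simp only: lhs_xy A B C D L(3)) (simp add: algebra_simps)
  thus "x * y * h * h = - eisq 12 1 (q^2) + eisq 1 12 q + eisq (-4) (-3) (q^2) + eisq (-3) (-4) q"
    by (simp add: t_def power2_eq_square mult_ac)
  have "y^2 * p = - eisq 12 1 (q^2) + 1 * eisq 1 12 q + (-1) * eisq (-4) (-3) (q^2) + (-1) * eisq (-3) (-4) q"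
    by (rule combine, simp only: lhs_p A B C D L(3)) (simp add: algebra_simps)
  thus "g * y * y * h = - eisq 12 1 (q^2) + eisq 1 12 q - eisq (-4) (-3) (q^2) - eisq (-3) (-4) q"
    by (simp add: p_def power2_eq_square mult_ac)
qed

end

lemma nome_theta_base: "Im z > 0 \<Longrightarrow> theta_base (nome z)"
  by unfold_locales (auto simp: nome_def)

lemma nome_of_nat_mult: "nome (of_nat a * z) = nome z ^ a"
  by (simp add: nome_def mult_ac flip: exp_of_nat_mult)

lemma phi_eq_phiq: "phi (of_nat a * z) = phiq (nome z ^ a)"
  by (simp add: phi_def phiq_def nome_of_nat_mult)

lemma eis_eq_eisq: "eis t1 t2 z = eisq t1 t2 (nome z)" "eis t1 t2 (2 * z) = eisq t1 t2 (nome z ^ 2)"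
  using nome_of_nat_mult[of 2 z] by (simp_all add: eis_def eisq_def)

theorem theorem3p3:
  fixes a1 a2 a3 a4 :: nat and b1 b2 b3 b4 b5 b6 b7 b8 :: int and z :: complex
  assumes "((a1, a2, a3, a4), (b1, b2, b3, b4, b5, b6, b7, b8)) \<in>
      {((1, 1, 1, 3), (-1,  0, 6, 0,  3,  0, -2,  0)),
       ((1, 1, 2, 6), ( 0, -1, 3, 0,  0,  3,  1,  0)),
       ((1, 2, 2, 3), ( 0, -1, 3, 0,  0, -3, -1,  0)),
       ((1, 3, 3, 3), (-1,  0, 2, 0, -1,  0,  2,  0)),
       ((1, 3, 6, 6), ( 0, -1, 1, 0,  0,  1,  1,  0)),
       ((2, 2, 2, 6), ( 0, -1, 0, 6,  0,  3,  0, -2)),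
       ((2, 3, 3, 6), ( 0, -1, 1, 0,  0, -1, -1,  0)),
       ((2, 6, 6, 6), ( 0, -1, 0, 2,  0, -1,  0,  2))}"
    and "Im z > 0"
  shows "phi_prod a1 a2 a3 a4 z =
      of_int b1 * eis 12 1 z + of_int b2 * eis 12 1 (2 * z)
    + of_int b3 * eis 1 12 z + of_int b4 * eis 1 12 (2 * z)
    + of_int b5 * eis (-4) (-3) z + of_int b6 * eis (-4) (-3) (2 * z)
    + of_int b7 * eis (-3) (-4) z + of_int b8 * eis (-3) (-4) (2 * z)"
proof -
  interpret theta_base "nome z" using assms(2) by (rule nome_theta_base)
  interpret q2: theta_base "nome z ^ 2" by (rule theta_base_power) simp
  note rows = rows_level_12 rows_level_24 q2.rows_level_12
  from assms(1) show ?thesis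
    unfolding phi_prod_def phi_eq_phiq eis_eq_eisq(2) unfolding eis_eq_eisq(1)
    by (elim insertE emptyE) (use rows in \<open>simp_all flip: power_mult\<close>)
qed

end
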